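(* Let $\mathbf{k}$ be a field. Every injective object of $\mathcal{A}$ is a standard object. Moreover, every indecomposable injective object of $\mathcal{A}$ is isomorphic to $\mathbf{I}^r$ for some $r\ge0$.
   Context: Let $\mathfrak{S}=\bigcup_{n\ge1}\mathfrak{S}_n$ be the infinite symmetric group (finitary permutations of $\{1,2,\ldots\}$), and $\mathfrak{S}^n\subset\mathfrak{S}$ the subgroup fixing each of $1,\ldots,n$. Let $\mathbf{K}=\mathbf{k}(\xi_1,\xi_2,\ldots)$, on which $\mathfrak{S}$ acts by permuting variables. $\mathcal{A}$ is the category of smooth $\mathbf{K}$-semilinear representations of $\mathfrak{S}$: $\mathbf{K}$-vector spaces $M$ with an additive action of $\mathfrak{S}$ satisfying $\sigma(av)=(\sigma a)(\sigma v)$, such that every $v\in M$ is fixed by $\mathfrak{S}^n$ for some $n$. Morphisms are $\mathbf{K}$-linear $\mathfrak{S}$-equivariant maps. $\mathbf{I}^r=\mathbf{K}\otimes_{\mathbf{k}}\mathbf{V}^r$, where $\mathbf{V}^r$ is the $\mathbf{k}$-vector space with basis $\{e_S\}$ indexed by the $r$-element subsets $S$ of $\{1,2,\ldots\}$, permuted by $\mathfrak{S}$. An object of $\mathcal{A}$ is standard if it is isomorphic to a (possibly infinite) direct sum of objects of the form $\mathbf{I}^r$ ($r\ge0$ allowed to vary). *)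

theory Defs
  imports
    "HOL-Algebra.Module"
    "HOL-Algebra.AbelCoset"
    "HOL-Library.Poly_Mapping"
    "HOL-Library.FuncSet"
    "HOL-Computational_Algebra.Fraction_Field"
    "HOL-Combinatorics.Perm"
begin

unbundle permutation_syntax

section \<open>The field of rational functions and the action of the infinite symmetric group\<close>

text \<open>
  The type \<^typ>\<open>nat perm\<close> of finitary permutations is the infinite symmetric group. The set
  \<open>{1, 2, \<dots>}\<close> is replaced by \<^typ>\<open>nat\<close>, so that the variables are \<open>\<xi>\<^sub>0, \<xi>\<^sub>1, \<dots>\<close> and the
  \<open>n\<close>-th subgroup of the smoothness condition fixes \<open>0, \<dots>, n - 1\<close>.
  A monomial is its finitely supported exponent vector.
\<close>

type_synonym 'k mpoly = "(nat \<Rightarrow>\<^sub>0 nat) \<Rightarrow>\<^sub>0 'k"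
type_synonym 'k ratfun = "'k mpoly fract"

text \<open>The exponent of \<open>\<xi>\<^sub>i\<close> in \<open>\<sigma> m\<close> is the exponent of \<open>\<xi>\<close> with index \<open>\<sigma>\<^sup>-\<^sup>1 i\<close> in \<open>m\<close>;
  thus \<open>\<sigma>\<close> sends \<open>\<xi>\<^sub>i\<close> to the variable with index \<open>\<sigma> i\<close>.\<close>

definition perm_monom :: "nat perm \<Rightarrow> (nat \<Rightarrow>\<^sub>0 nat) \<Rightarrow> (nat \<Rightarrow>\<^sub>0 nat)" where
  "perm_monom \<sigma> m = Poly_Mapping.map_key (\<lambda>i. inverse \<sigma> \<langle>$\<rangle> i) m"

definition perm_mpoly :: "nat perm \<Rightarrow> 'k::comm_ring_1 mpoly \<Rightarrow> 'k mpoly" where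
  "perm_mpoly \<sigma> p = Poly_Mapping.map_key (perm_monom (inverse \<sigma>)) p"

lemma inj_perm: "inj (\<lambda>i. \<sigma> \<langle>$\<rangle> i)"
  by (simp add: inj_def apply_inj)

lemma lookup_perm_monom [simp]:
  "Poly_Mapping.lookup (perm_monom \<sigma> m) i = Poly_Mapping.lookup m (inverse \<sigma> \<langle>$\<rangle> i)"
  by (simp add: perm_monom_def map_key.rep_eq inj_perm)

lemma perm_monom_one [simp]: "perm_monom 1 m = m"
  by (rule poly_mapping_eqI) simp

lemma perm_monom_mult: "perm_monom (\<sigma> * \<tau>) m = perm_monom \<sigma> (perm_monom \<tau> m)"
  by (rule poly_mapping_eqI) (simp add: apply_times)

lemma perm_monom_inverse [simp]:
  "perm_monom \<sigma> (perm_monom (inverse \<sigma>) m) = m" "perm_monom (inverse \<sigma>) (perm_monom \<sigma> m) = m"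
  by (simp_all flip: perm_monom_mult)

lemma perm_monom_add: "perm_monom \<sigma> (m + m') = perm_monom \<sigma> m + perm_monom \<sigma> m'"
  by (rule poly_mapping_eqI) (simp add: lookup_add)

lemma inj_perm_monom: "inj (perm_monom \<sigma>)"
  by (rule inj_on_inverseI[where g = "perm_monom (inverse \<sigma>)"]) simp

lemma lookup_perm_mpoly [simp]:
  "Poly_Mapping.lookup (perm_mpoly \<sigma> p) m = Poly_Mapping.lookup p (perm_monom (inverse \<sigma>) m)"
  by (simp add: perm_mpoly_def map_key.rep_eq inj_perm_monom)

lemma perm_mpoly_0 [simp]: "perm_mpoly \<sigma> 0 = 0"
  by (rule poly_mapping_eqI) simp

lemma perm_mpoly_one_perm [simp]: "perm_mpoly 1 p = p"
  by (rule poly_mapping_eqI) simp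

lemma perm_mpoly_mult_perm: "perm_mpoly (\<sigma> * \<tau>) p = perm_mpoly \<sigma> (perm_mpoly \<tau> p)"
  by (rule poly_mapping_eqI) (simp add: perm_monom_mult)

lemma perm_mpoly_add: "perm_mpoly \<sigma> (p + q) = perm_mpoly \<sigma> p + perm_mpoly \<sigma> q"
  by (rule poly_mapping_eqI) (simp add: lookup_add)

lemma perm_mpoly_single:
  "perm_mpoly \<sigma> (Poly_Mapping.single m c) = Poly_Mapping.single (perm_monom \<sigma> m) c"
  by (rule poly_mapping_eqI) (auto simp: lookup_single when_def)

lemma poly_mapping_add_induct [case_names zero add]:
  fixes p :: "'a \<Rightarrow>\<^sub>0 'b::comm_monoid_add"
  assumes "P 0" "\<And>p m c. m \<notin> Poly_Mapping.keys p \<Longrightarrow> c \<noteq> 0 \<Longrightarrow> P p \<Longrightarrow> P (Poly_Mapping.single m c + p)"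
  shows "P p"
  using assms
proof (induction p rule: update_induct)
  case (update p a b)
  have "Poly_Mapping.update a b p = Poly_Mapping.single a b + p"
    using update.hyps
    by (intro poly_mapping_eqI) (auto simp: lookup_update lookup_add lookup_single when_def in_keys_iff)
  then show ?case using update by simp
qed

lemma perm_mpoly_mult: "perm_mpoly \<sigma> (p * q) = perm_mpoly \<sigma> p * perm_mpoly \<sigma> q"
proof (induction p rule: poly_mapping_add_induct)
  case (add p m c)
  have "perm_mpoly \<sigma> (Poly_Mapping.single m c * q) = perm_mpoly \<sigma> (Poly_Mapping.single m c) * perm_mpoly \<sigma> q"
    by (induction q rule: poly_mapping_add_induct)
      (simp_all add: perm_mpoly_add perm_mpoly_single distrib_left mult_single perm_monom_add)
  with add show ?case by (simp add: distrib_right perm_mpoly_add)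
qed simp

lemma perm_mpoly_eq_0_iff [simp]: "perm_mpoly \<sigma> p = 0 \<longleftrightarrow> p = 0"
proof
  assume "perm_mpoly \<sigma> p = 0"
  then have "perm_mpoly (inverse \<sigma> * \<sigma>) p = 0"
    by (simp only: perm_mpoly_mult_perm perm_mpoly_0)
  then show "p = 0" by simp
qed simp

lift_definition perm_ratfun :: "nat perm \<Rightarrow> 'k::field ratfun \<Rightarrow> 'k ratfun"
  is "\<lambda>\<sigma> (p, q). (perm_mpoly \<sigma> p, perm_mpoly \<sigma> q)"
  by (auto simp flip: perm_mpoly_mult)

lemma perm_ratfun_Fract:
  "q \<noteq> 0 \<Longrightarrow> perm_ratfun \<sigma> (Fract p q) = Fract (perm_mpoly \<sigma> p) (perm_mpoly \<sigma> q)"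
  by transfer simp

lemma perm_monom_0 [simp]: "perm_monom \<sigma> 0 = 0"
  by (rule poly_mapping_eqI) simp

lemma perm_mpoly_1 [simp]: "perm_mpoly \<sigma> 1 = 1"
  using perm_mpoly_single[of \<sigma> 0 1] by simp

lemma perm_ratfun_0 [simp]: "perm_ratfun \<sigma> 0 = 0"
  by (simp add: Zero_fract_def perm_ratfun_Fract)

lemma perm_ratfun_1 [simp]: "perm_ratfun \<sigma> 1 = 1"
  by (simp add: One_fract_def perm_ratfun_Fract)

lemma perm_ratfun_add: "perm_ratfun \<sigma> (a + b) = perm_ratfun \<sigma> a + perm_ratfun \<sigma> b"
  by (cases a; cases b) (simp add: perm_ratfun_Fract perm_mpoly_add perm_mpoly_mult)

lemma perm_ratfun_mult: "perm_ratfun \<sigma> (a * b) = perm_ratfun \<sigma> a * perm_ratfun \<sigma> b"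
  by (cases a; cases b) (simp add: perm_ratfun_Fract perm_mpoly_mult)

lemma perm_ratfun_one_perm [simp]: "perm_ratfun 1 a = a"
  by (cases a) (simp add: perm_ratfun_Fract)

lemma perm_ratfun_mult_perm: "perm_ratfun (\<sigma> * \<tau>) a = perm_ratfun \<sigma> (perm_ratfun \<tau> a)"
  by (cases a) (simp add: perm_ratfun_Fract perm_mpoly_mult_perm)

definition ratfun_ring :: "'k::field ratfun ring" where
  "ratfun_ring = \<lparr>carrier = UNIV, mult = (*), one = 1, zero = 0, add = (+)\<rparr>"

lemma ratfun_ring_simps [simp]:
  "carrier ratfun_ring = UNIV" "x \<otimes>\<^bsub>ratfun_ring\<^esub> y = x * y" "\<one>\<^bsub>ratfun_ring\<^esub> = 1"
  "x \<oplus>\<^bsub>ratfun_ring\<^esub> y = x + y" "\<zero>\<^bsub>ratfun_ring\<^esub> = 0"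
  by (simp_all add: ratfun_ring_def)

lemma cring_ratfun_ring: "cring (ratfun_ring :: 'k::field ratfun ring)"
proof (rule cringI)
  have *: "\<exists>y. x + y = 0" for x :: "'k ratfun"
    by (rule exI[of _ "- x"]) simp
  show "abelian_group (ratfun_ring :: 'k ratfun ring)"
    by (rule abelian_groupI) (simp_all add: add.assoc add.commute *)
  show "comm_monoid (ratfun_ring :: 'k ratfun ring)"
    by (rule comm_monoidI) (simp_all add: mult.assoc mult.commute)
qed (simp add: distrib_right)

section \<open>Smooth semilinear representations\<close>

text \<open>The fields \<open>mult\<close> and \<open>one\<close> inherited from the ring record play no role.\<close>

record ('a, 'b) semilin = "('a, 'b) module" +
  act :: "nat perm \<Rightarrow> 'b \<Rightarrow> 'b"

locale smooth_semilinear =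
  module ratfun_ring M for M :: "('k::field ratfun, 'a, 'm) semilin_scheme" (structure) +
  assumes act_closed: "v \<in> carrier M \<Longrightarrow> act M \<sigma> v \<in> carrier M"
    and act_one: "v \<in> carrier M \<Longrightarrow> act M 1 v = v"
    and act_mult: "v \<in> carrier M \<Longrightarrow> act M (\<sigma> * \<tau>) v = act M \<sigma> (act M \<tau> v)"
    and act_add: "v \<in> carrier M \<Longrightarrow> w \<in> carrier M \<Longrightarrow>
      act M \<sigma> (v \<oplus> w) = act M \<sigma> v \<oplus> act M \<sigma> w"
    and act_smult: "v \<in> carrier M \<Longrightarrow>
      act M \<sigma> (a \<odot> v) = perm_ratfun \<sigma> a \<odot> act M \<sigma> v"
    and smooth: "v \<in> carrier M \<Longrightarrow>
      \<exists>n. \<forall>\<sigma>. (\<forall>i<n. \<sigma> \<langle>$\<rangle> i = i) \<longrightarrow> act M \<sigma> v = v"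

definition semilin_hom ::
  "('k::field ratfun, 'a) semilin \<Rightarrow> ('k ratfun, 'b) semilin \<Rightarrow> ('a \<Rightarrow> 'b) set" where
  "semilin_hom M N = {f \<in> hom (add_monoid M) (add_monoid N).
     (\<forall>a. \<forall>v\<in>carrier M. f (a \<odot>\<^bsub>M\<^esub> v) = a \<odot>\<^bsub>N\<^esub> f v) \<and>
     (\<forall>\<sigma>. \<forall>v\<in>carrier M. f (act M \<sigma> v) = act N \<sigma> (f v))}"

text \<open>A bijective morphism has a morphism as its inverse.\<close>

definition semilin_iso ::
  "('k::field ratfun, 'a) semilin \<Rightarrow> ('k ratfun, 'b) semilin \<Rightarrow> bool" where
  "semilin_iso M N \<longleftrightarrow> (\<exists>f\<in>semilin_hom M N. bij_betw f (carrier M) (carrier N))"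

text \<open>
  Monomorphisms are the injective morphisms (see \<open>inj_on_iff_mono\<close> below).
  The test objects \<open>X\<close> and \<open>Y\<close> have their underlying sets in the type of \<open>M\<close>. This does not
  change the notion: by Baer's criterion injectivity in the Grothendieck category of smooth
  semilinear representations can be tested on the subobjects of the generators
  \<open>K[\<SS>/\<SS>\<^sup>n]\<close>, which have the (infinite) cardinality of the field \<open>K\<close> of
  rational functions, and if \<open>M \<noteq> 0\<close> then its type is at least as large as \<open>K\<close>.
  For \<open>M = 0\<close> the condition holds trivially.
\<close>

definition injective_object :: "('k::field ratfun, 'a) semilin \<Rightarrow> bool" where
  "injective_object M \<longleftrightarrow> smooth_semilinear M \<and>
     (\<forall>(X :: ('k ratfun, 'a) semilin) (Y :: ('k ratfun, 'a) semilin) f g.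
        smooth_semilinear X \<and> smooth_semilinear Y \<and>
        f \<in> semilin_hom X Y \<and> inj_on f (carrier X) \<and> g \<in> semilin_hom X M \<longrightarrow>
        (\<exists>h\<in>semilin_hom Y M. \<forall>x\<in>carrier X. h (f x) = g x))"

definition subobject :: "'a set \<Rightarrow> ('k::field ratfun, 'a) semilin \<Rightarrow> bool" where
  "subobject N M \<longleftrightarrow> submodule N ratfun_ring M \<and> (\<forall>\<sigma>. \<forall>v\<in>N. act M \<sigma> v \<in> N)"

definition indecomposable_object :: "('k::field ratfun, 'a) semilin \<Rightarrow> bool" where
  "indecomposable_object M \<longleftrightarrow> smooth_semilinear M \<and> carrier M \<noteq> {\<zero>\<^bsub>M\<^esub>} \<and>
     (\<forall>A B. subobject A M \<and> subobject B M \<and>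
        A \<inter> B = {\<zero>\<^bsub>M\<^esub>} \<and> A <+>\<^bsub>M\<^esub> B = carrier M \<longrightarrow>
        A = {\<zero>\<^bsub>M\<^esub>} \<or> B = {\<zero>\<^bsub>M\<^esub>})"

definition semilin_sum ::
  "'i set \<Rightarrow> ('i \<Rightarrow> ('k::field ratfun, 'a) semilin) \<Rightarrow> ('k ratfun, 'i \<Rightarrow> 'a) semilin" where
  "semilin_sum J M =
    \<lparr>carrier = {x \<in> \<Pi>\<^sub>E j\<in>J. carrier (M j). finite {j \<in> J. x j \<noteq> \<zero>\<^bsub>M j\<^esub>}},
     mult = undefined, one = undefined,
     zero = (\<lambda>j\<in>J. \<zero>\<^bsub>M j\<^esub>),
     add = (\<lambda>x y. \<lambda>j\<in>J. x j \<oplus>\<^bsub>M j\<^esub> y j),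
     smult = (\<lambda>a x. \<lambda>j\<in>J. a \<odot>\<^bsub>M j\<^esub> x j),
     act = (\<lambda>\<sigma> x. \<lambda>j\<in>J. act (M j) \<sigma> (x j))\<rparr>"

section \<open>Standard objects\<close>

text \<open>For \<open>r = 0\<close> the finiteness condition matters, as infinite sets have cardinality \<open>0\<close>.\<close>

definition subsets_of_card :: "nat \<Rightarrow> nat set set" where
  "subsets_of_card r = {S. finite S \<and> card S = r}"

definition Vspace :: "nat \<Rightarrow> (nat set \<Rightarrow>\<^sub>0 'k::zero) set" where
  "Vspace r = {v. Poly_Mapping.keys v \<subseteq> subsets_of_card r}"

definition perm_vec :: "nat perm \<Rightarrow> (nat set \<Rightarrow>\<^sub>0 'k::zero) \<Rightarrow> (nat set \<Rightarrow>\<^sub>0 'k)" where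
  "perm_vec \<sigma> v = Poly_Mapping.map_key (\<lambda>S. (\<lambda>i. inverse \<sigma> \<langle>$\<rangle> i) ` S) v"

text \<open>
  The base change \<open>K \<otimes> V\<^sup>r\<close> along \<open>k \<subseteq> K\<close> is realised as the \<open>K\<close>-vector space with the basis
  \<open>e\<^sub>S\<close>, where a permutation acts simultaneously on the coefficients and on the basis. That this
  is the tensor product, by way of the canonical map \<open>tens\<close>, is shown in \<open>tens_universal\<close>,
  \<open>tens_unique\<close>, \<open>smult_tens\<close> and \<open>act_tens\<close> below.
\<close>

definition Iobj :: "nat \<Rightarrow> ('k::field ratfun, nat set \<Rightarrow>\<^sub>0 'k ratfun) semilin" where
  "Iobj r =
    \<lparr>carrier = Vspace r,
     mult = undefined, one = undefined,
     zero = 0,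
     add = (+),
     smult = (\<lambda>a. Poly_Mapping.map (\<lambda>b. a * b)),
     act = (\<lambda>\<sigma> v. Poly_Mapping.map (perm_ratfun \<sigma>) (perm_vec \<sigma> v))\<rparr>"

text \<open>
  The index set may be taken inside the type of \<open>M\<close>: the summands are nonzero, so any index
  set of a decomposition of \<open>M\<close> injects into \<open>carrier M\<close>.
\<close>

definition standard_object :: "('k::field ratfun, 'a) semilin \<Rightarrow> bool" where
  "standard_object M \<longleftrightarrow> smooth_semilinear M \<and>
     (\<exists>(J :: 'a set) r. semilin_iso M (semilin_sum J (\<lambda>j. Iobj (r j))))"

section \<open>Sanity checks\<close>

lemma fixing_finite:
  fixes P :: "nat perm \<Rightarrow> 'a \<Rightarrow> bool"
  assumes "finite A" "\<And>x. x \<in> A \<Longrightarrow> \<exists>n. \<forall>\<sigma>. (\<forall>i<n. \<sigma> \<langle>$\<rangle> i = i) \<longrightarrow> P \<sigma> x"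
  shows "\<exists>n. \<forall>\<sigma>. (\<forall>i<n. \<sigma> \<langle>$\<rangle> i = i) \<longrightarrow> (\<forall>x\<in>A. P \<sigma> x)"
  using assms
proof (induction A rule: finite_induct)
  case (insert x A)
  obtain n where n: "\<forall>\<sigma>. (\<forall>i<n. \<sigma> \<langle>$\<rangle> i = i) \<longrightarrow> (\<forall>x\<in>A. P \<sigma> x)"
    using insert by auto
  obtain m where m: "\<forall>\<sigma>. (\<forall>i<m. \<sigma> \<langle>$\<rangle> i = i) \<longrightarrow> P \<sigma> x"
    using insert.prems[of x] by auto
  show ?case
  proof (intro exI[of _ "max m n"] allI impI)
    fix \<sigma> :: "nat perm" assume "\<forall>i<max m n. \<sigma> \<langle>$\<rangle> i = i"
    then show "\<forall>x\<in>insert x A. P \<sigma> x" using n m by (simp add: less_max_iff_disj)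
  qed
qed simp

lemma inverse_fix: "\<sigma> \<langle>$\<rangle> i = i \<Longrightarrow> inverse \<sigma> \<langle>$\<rangle> i = i"
  by (metis apply_inverse bij_apply bij_is_inj inv_f_f)

lemma apply_inverse_simps [simp]:
  "\<sigma> \<langle>$\<rangle> (inverse \<sigma> \<langle>$\<rangle> i) = i" "inverse \<sigma> \<langle>$\<rangle> (\<sigma> \<langle>$\<rangle> i) = i"
  by (simp_all add: apply_sequence)

lemma perm_monom_smooth: "\<exists>n. \<forall>\<sigma>. (\<forall>i<n. \<sigma> \<langle>$\<rangle> i = i) \<longrightarrow> perm_monom \<sigma> m = m"
proof -
  have "\<exists>n. \<forall>\<sigma>. (\<forall>i<n. \<sigma> \<langle>$\<rangle> i = i) \<longrightarrow> (\<forall>i\<in>Poly_Mapping.keys m. \<sigma> \<langle>$\<rangle> i = i)"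
    by (rule fixing_finite) (auto intro: exI[of _ "Suc i" for i])
  moreover have "perm_monom \<sigma> m = m" if "\<forall>i\<in>Poly_Mapping.keys m. \<sigma> \<langle>$\<rangle> i = i" for \<sigma>
  proof (rule poly_mapping_eqI)
    fix i
    show "Poly_Mapping.lookup (perm_monom \<sigma> m) i = Poly_Mapping.lookup m i"
    proof (cases "inverse \<sigma> \<langle>$\<rangle> i \<in> Poly_Mapping.keys m \<or> i \<in> Poly_Mapping.keys m")
      case True
      then have "inverse \<sigma> \<langle>$\<rangle> i = i"
        using that inverse_fix by (metis apply_inverse_simps(1))
      then show ?thesis by simp
    qed (simp add: in_keys_iff)
  qed
  ultimately show ?thesis by blast
qed

lemma perm_mpoly_smooth: "\<exists>n. \<forall>\<sigma>. (\<forall>i<n. \<sigma> \<langle>$\<rangle> i = i) \<longrightarrow> perm_mpoly \<sigma> p = p"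
proof -
  have "\<exists>n. \<forall>\<sigma>. (\<forall>i<n. \<sigma> \<langle>$\<rangle> i = i) \<longrightarrow> (\<forall>m\<in>Poly_Mapping.keys p. perm_monom \<sigma> m = m)"
    by (rule fixing_finite) (auto simp: perm_monom_smooth)
  moreover have "perm_mpoly \<sigma> p = p" if *: "\<forall>m\<in>Poly_Mapping.keys p. perm_monom \<sigma> m = m" for \<sigma>
  proof (rule poly_mapping_eqI)
    fix m
    show "Poly_Mapping.lookup (perm_mpoly \<sigma> p) m = Poly_Mapping.lookup p m"
    proof (cases "perm_monom (inverse \<sigma>) m \<in> Poly_Mapping.keys p \<or> m \<in> Poly_Mapping.keys p")
      case True
      then have "perm_monom (inverse \<sigma>) m = m"
        using * by (metis perm_monom_inverse)
      then show ?thesis by simp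
    qed (simp add: in_keys_iff)
  qed
  ultimately show ?thesis by blast
qed

lemma perm_ratfun_smooth: "\<exists>n. \<forall>\<sigma>. (\<forall>i<n. \<sigma> \<langle>$\<rangle> i = i) \<longrightarrow> perm_ratfun \<sigma> a = a"
proof (cases a)
  case (Fract p q)
  have "\<exists>n. \<forall>\<sigma>. (\<forall>i<n. \<sigma> \<langle>$\<rangle> i = i) \<longrightarrow> (\<forall>p\<in>{p, q}. perm_mpoly \<sigma> p = p)"
    by (rule fixing_finite) (auto simp: perm_mpoly_smooth)
  then show ?thesis using Fract perm_ratfun_Fract[of q _ p] by (metis insertCI)
qed

lemma lookup_map_0: "f 0 = 0 \<Longrightarrow> Poly_Mapping.lookup (Poly_Mapping.map f v) S = f (Poly_Mapping.lookup v S)"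
  by (simp add: Poly_Mapping.map.rep_eq when_def)

lemma lookup_perm_vec [simp]:
  "Poly_Mapping.lookup (perm_vec \<sigma> v) S = Poly_Mapping.lookup v ((\<lambda>i. inverse \<sigma> \<langle>$\<rangle> i) ` S)"
proof -
  have "inj (\<lambda>S. (\<lambda>i. inverse \<sigma> \<langle>$\<rangle> i) ` S)"
    by (rule inj_on_inverseI[where g = "\<lambda>S. (\<lambda>i. \<sigma> \<langle>$\<rangle> i) ` S"]) (simp add: image_image)
  then show ?thesis by (simp add: perm_vec_def map_key.rep_eq)
qed

lemma subsets_of_card_perm:
  "(\<lambda>i. \<sigma> \<langle>$\<rangle> i) ` S \<in> subsets_of_card r \<longleftrightarrow> S \<in> subsets_of_card r"
  using inj_perm[of \<sigma>] inj_on_subset[OF inj_perm, of S \<sigma>]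
  by (auto simp: subsets_of_card_def card_image finite_image_iff)

lemma Vspace_iff: "v \<in> Vspace r \<longleftrightarrow> (\<forall>S. S \<notin> subsets_of_card r \<longrightarrow> Poly_Mapping.lookup v S = 0)"
  by (auto simp: Vspace_def in_keys_iff subset_iff)

lemma Iobj_simps [simp]:
  "carrier (Iobj r) = Vspace r" "\<zero>\<^bsub>Iobj r\<^esub> = 0" "x \<oplus>\<^bsub>Iobj r\<^esub> y = x + y"
  "a \<odot>\<^bsub>Iobj r\<^esub> x = Poly_Mapping.map (\<lambda>b. a * b) x"
  "act (Iobj r) \<sigma> x = Poly_Mapping.map (perm_ratfun \<sigma>) (perm_vec \<sigma> x)"
  by (simp_all add: Iobj_def)

lemma smooth_semilinear_Iobj: "smooth_semilinear (Iobj r :: ('k::field ratfun, _) semilin)"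
proof (intro smooth_semilinear.intro smooth_semilinear_axioms.intro moduleI cring_ratfun_ring)
  have inv: "\<exists>y\<in>Vspace r. x + y = 0" if "x \<in> Vspace r" for x :: "nat set \<Rightarrow>\<^sub>0 'k ratfun"
    using that by (intro bexI[of _ "- x"]) (auto simp: Vspace_iff)
  show "abelian_group (Iobj r :: ('k ratfun, _) semilin)"
    by (rule abelian_groupI) (auto simp: Vspace_iff lookup_add add_ac intro!: inv)
next
  fix v :: "nat set \<Rightarrow>\<^sub>0 'k ratfun"
  assume v: "v \<in> carrier (Iobj r)"
  have "\<exists>n. \<forall>\<sigma>. (\<forall>i<n. \<sigma> \<langle>$\<rangle> i = i) \<longrightarrow> (\<forall>S\<in>Poly_Mapping.keys v.
     perm_ratfun \<sigma> (Poly_Mapping.lookup v S) = Poly_Mapping.lookup v S)"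
    by (rule fixing_finite) (auto simp: perm_ratfun_smooth)
  then obtain n where n: "\<And>\<sigma> S. (\<forall>i<n. \<sigma> \<langle>$\<rangle> i = i) \<Longrightarrow> S \<in> Poly_Mapping.keys v \<Longrightarrow>
     perm_ratfun \<sigma> (Poly_Mapping.lookup v S) = Poly_Mapping.lookup v S"
    by blast
  have "\<exists>n. \<forall>\<sigma>. (\<forall>i<n. \<sigma> \<langle>$\<rangle> i = i) \<longrightarrow> (\<forall>i\<in>\<Union>(Poly_Mapping.keys v). \<sigma> \<langle>$\<rangle> i = i)"
    using v by (intro fixing_finite)
      (auto simp: Vspace_def subsets_of_card_def intro: exI[of _ "Suc i" for i])
  then obtain m where m: "\<And>\<sigma> S i. (\<forall>i<m. \<sigma> \<langle>$\<rangle> i = i) \<Longrightarrow> S \<in> Poly_Mapping.keys v \<Longrightarrow>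
      i \<in> S \<Longrightarrow> \<sigma> \<langle>$\<rangle> i = i"
    by blast
  show "\<exists>n. \<forall>\<sigma>. (\<forall>i<n. \<sigma> \<langle>$\<rangle> i = i) \<longrightarrow> act (Iobj r) \<sigma> v = v"
  proof (intro exI[of _ "max m n"] allI impI)
    fix \<sigma> :: "nat perm" assume \<sigma>: "\<forall>i<max m n. \<sigma> \<langle>$\<rangle> i = i"
    have fixS: "(\<lambda>i. \<sigma> \<langle>$\<rangle> i) ` S = S" if "S \<in> Poly_Mapping.keys v" for S
      using m[of \<sigma> S] \<sigma> that by force
    have "Poly_Mapping.lookup (act (Iobj r) \<sigma> v) S = Poly_Mapping.lookup v S" for S
    proof (cases "S \<in> Poly_Mapping.keys v \<or> (\<lambda>i. inverse \<sigma> \<langle>$\<rangle> i) ` S \<in> Poly_Mapping.keys v")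
      case True
      have "(\<lambda>i. \<sigma> \<langle>$\<rangle> i) ` (\<lambda>i. inverse \<sigma> \<langle>$\<rangle> i) ` S = S"
           "(\<lambda>i. inverse \<sigma> \<langle>$\<rangle> i) ` (\<lambda>i. \<sigma> \<langle>$\<rangle> i) ` S = S"
        by (simp_all add: image_image)
      then have "(\<lambda>i. inverse \<sigma> \<langle>$\<rangle> i) ` S = S" "S \<in> Poly_Mapping.keys v"
        using fixS True by metis+
      then show ?thesis using n \<sigma> by (simp add: lookup_map_0)
    qed (simp add: lookup_map_0 in_keys_iff)
    then show "act (Iobj r) \<sigma> v = v" by (rule poly_mapping_eqI)
  qed
qed (auto intro!: poly_mapping_eqI simp: Vspace_iff lookup_map_0 lookup_add subsets_of_card_perm
       algebra_simps perm_ratfun_add perm_ratfun_mult perm_ratfun_mult_perm apply_times image_comp)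

lemma (in smooth_semilinear) act_zero: "act M \<sigma> \<zero> = \<zero>"
  using act_add[of \<zero> \<zero> \<sigma>] act_closed[of \<zero> \<sigma>]
  by (metis M.add.l_cancel_one' M.zero_closed M.l_zero)

lemma inj_on_iff_mono:
  fixes X :: "('k::field ratfun, 'a) semilin" and Y :: "('k ratfun, 'b) semilin"
  assumes X: "smooth_semilinear X" and Y: "smooth_semilinear Y" and f: "f \<in> semilin_hom X Y"
  shows "inj_on f (carrier X) \<longleftrightarrow>
    (\<forall>(Z :: ('k ratfun, 'a) semilin) u v. smooth_semilinear Z \<and>
       u \<in> semilin_hom Z X \<and> v \<in> semilin_hom Z X \<and> (\<forall>z\<in>carrier Z. f (u z) = f (v z)) \<longrightarrow>
       (\<forall>z\<in>carrier Z. u z = v z))"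
    (is "_ \<longleftrightarrow> ?mono")
proof
  assume "inj_on f (carrier X)"
  then show ?mono
    by (auto simp: semilin_hom_def hom_def Pi_iff inj_on_def)
next
  assume mono: ?mono
  interpret X: smooth_semilinear X by (fact X)
  interpret Y: smooth_semilinear Y by (fact Y)
  have hom: "group_hom (add_monoid X) (add_monoid Y) f"
    using f by (intro group_hom.intro group_hom_axioms.intro X.M.a_group Y.M.a_group)
      (simp add: semilin_hom_def)
  define H where "H = kernel (add_monoid X) (add_monoid Y) f"
  have H: "x \<in> H \<longleftrightarrow> x \<in> carrier X \<and> f x = \<zero>\<^bsub>Y\<^esub>" for x
    by (simp add: H_def kernel_def)
  have "subgroup H (add_monoid X)"
    unfolding H_def by (rule group_hom.subgroup_kernel[OF hom])
  then have sub: "submodule H ratfun_ring X"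
    using f by (auto simp: submodule_def submodule_axioms_def H semilin_hom_def)
  let ?Z = "X\<lparr>carrier := H\<rparr>"
  have mod: "module ratfun_ring ?Z"
    by (rule submodule.submodule_is_module[OF sub X.module_axioms])
  have Z: "smooth_semilinear ?Z"
  proof (intro smooth_semilinear.intro mod smooth_semilinear_axioms.intro)
    fix v \<sigma> assume "v \<in> carrier ?Z"
    then show "act ?Z \<sigma> v \<in> carrier ?Z"
      using f by (auto simp: H X.act_closed semilin_hom_def Y.act_zero)
  qed (simp_all add: H X.act_one X.act_mult X.act_add X.act_smult X.smooth)
  have u: "(\<lambda>x. x) \<in> semilin_hom ?Z X"
    by (auto simp: semilin_hom_def hom_def H)
  have v: "(\<lambda>x. \<zero>\<^bsub>X\<^esub>) \<in> semilin_hom ?Z X"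
    by (auto simp: semilin_hom_def hom_def H X.act_zero)
  have f0: "f \<zero>\<^bsub>X\<^esub> = \<zero>\<^bsub>Y\<^esub>"
    using group_hom.hom_one[OF hom] by simp
  have "\<forall>z\<in>carrier ?Z. z = \<zero>\<^bsub>X\<^esub>"
    using mono[rule_format, of ?Z "\<lambda>x. x" "\<lambda>x. \<zero>\<^bsub>X\<^esub>"] Z u v f0 by (simp add: H)
  then have "H = {\<zero>\<^bsub>X\<^esub>}"
    using f0 by (auto simp: H)
  then show "inj_on f (carrier X)"
    using group_hom.inj_iff_trivial_ker[OF hom] by (simp add: H_def)
qed

lemma semilin_sum_simps [simp]:
  "carrier (semilin_sum J M) = {x \<in> \<Pi>\<^sub>E j\<in>J. carrier (M j). finite {j \<in> J. x j \<noteq> \<zero>\<^bsub>M j\<^esub>}}"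
  "\<zero>\<^bsub>semilin_sum J M\<^esub> = (\<lambda>j\<in>J. \<zero>\<^bsub>M j\<^esub>)"
  "x \<oplus>\<^bsub>semilin_sum J M\<^esub> y = (\<lambda>j\<in>J. x j \<oplus>\<^bsub>M j\<^esub> y j)"
  "a \<odot>\<^bsub>semilin_sum J M\<^esub> x = (\<lambda>j\<in>J. a \<odot>\<^bsub>M j\<^esub> x j)"
  "act (semilin_sum J M) \<sigma> x = (\<lambda>j\<in>J. act (M j) \<sigma> (x j))"
  by (simp_all add: semilin_sum_def)

lemma smooth_semilinear_sum:
  fixes M :: "'i \<Rightarrow> ('k::field ratfun, 'a) semilin"
  assumes obj: "\<And>j. j \<in> J \<Longrightarrow> smooth_semilinear (M j)"
  shows "smooth_semilinear (semilin_sum J M)"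
proof -
  have mod: "module ratfun_ring (M j)" if "j \<in> J" for j
    using obj[OF that] by (rule smooth_semilinear.axioms)
  have ab: "abelian_group (M j)" if "j \<in> J" for j
    using mod[OF that] by (rule module.axioms)
  have abm: "abelian_monoid (M j)" if "j \<in> J" for j
    using ab[OF that] by (rule abelian_group.axioms(1))
  have fin: "finite {j \<in> J. h j \<noteq> \<zero>\<^bsub>M j\<^esub>}"
    if "finite {j \<in> J. f j \<noteq> \<zero>\<^bsub>M j\<^esub>}" "finite {j \<in> J. g j \<noteq> \<zero>\<^bsub>M j\<^esub>}"
      "\<And>j. j \<in> J \<Longrightarrow> f j = \<zero>\<^bsub>M j\<^esub> \<Longrightarrow> g j = \<zero>\<^bsub>M j\<^esub> \<Longrightarrow> h j = \<zero>\<^bsub>M j\<^esub>" for f g h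
    by (rule finite_subset[OF _ finite_UnI[OF that(1,2)]]) (use that(3) in auto)
  have minus0: "\<ominus>\<^bsub>M j\<^esub> \<zero>\<^bsub>M j\<^esub> = \<zero>\<^bsub>M j\<^esub>" if "j \<in> J" for j
    using monoid.inv_one[OF group.is_monoid[OF abelian_group.a_group[OF ab[OF that]]]] by (simp add: a_inv_def)
  let ?S = "semilin_sum J M"
  have addc: "x \<oplus>\<^bsub>?S\<^esub> y \<in> carrier ?S" if "x \<in> carrier ?S" "y \<in> carrier ?S" for x y
  proof -
    have "finite {j \<in> J. (x \<oplus>\<^bsub>?S\<^esub> y) j \<noteq> \<zero>\<^bsub>M j\<^esub>}"
      by (rule fin[of x y]) (use that in \<open>auto simp: abelian_monoid.l_zero[OF abm] abelian_monoid.zero_closed[OF abm]\<close>)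
    with that show ?thesis
      by (auto simp: abelian_monoid.a_closed[OF abm] PiE_iff)
  qed
  have smc: "a \<odot>\<^bsub>?S\<^esub> x \<in> carrier ?S" if "x \<in> carrier ?S" for a x
  proof -
    have "finite {j \<in> J. (a \<odot>\<^bsub>?S\<^esub> x) j \<noteq> \<zero>\<^bsub>M j\<^esub>}"
      by (rule fin[of x x]) (use that module.smult_r_null[OF mod] in \<open>auto\<close>)
    with that module.smult_closed[OF mod] show ?thesis
      by (auto simp: PiE_iff)
  qed
  have actc: "act ?S \<sigma> x \<in> carrier ?S" if "x \<in> carrier ?S" for \<sigma> x
  proof -
    have "finite {j \<in> J. (act ?S \<sigma> x) j \<noteq> \<zero>\<^bsub>M j\<^esub>}"
      by (rule fin[of x x]) (use that in \<open>auto simp: smooth_semilinear.act_zero[OF obj]\<close>)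
    with that show ?thesis
      by (auto simp: PiE_iff smooth_semilinear.act_closed[OF obj])
  qed
  have inv: "\<exists>y\<in>carrier ?S. y \<oplus>\<^bsub>?S\<^esub> x = \<zero>\<^bsub>?S\<^esub>" if "x \<in> carrier ?S" for x
  proof (rule bexI)
    let ?y = "\<lambda>j\<in>J. \<ominus>\<^bsub>M j\<^esub> x j"
    have "finite {j \<in> J. ?y j \<noteq> \<zero>\<^bsub>M j\<^esub>}"
      by (rule fin[of x x]) (use that in \<open>auto simp: minus0\<close>)
    with that show "?y \<in> carrier ?S"
      by (auto simp: PiE_iff abelian_group.a_inv_closed[OF ab])
    show "?y \<oplus>\<^bsub>?S\<^esub> x = \<zero>\<^bsub>?S\<^esub>"
      using that by (auto intro!: restrict_ext simp: PiE_iff abelian_group.l_neg[OF ab])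
  qed
  have zeroc: "\<zero>\<^bsub>?S\<^esub> \<in> carrier ?S"
  proof -
    have "{j \<in> J. (\<lambda>j\<in>J. \<zero>\<^bsub>M j\<^esub>) j \<noteq> \<zero>\<^bsub>M j\<^esub>} = {}" by simp
    then have "finite {j \<in> J. (\<lambda>j\<in>J. \<zero>\<^bsub>M j\<^esub>) j \<noteq> \<zero>\<^bsub>M j\<^esub>}" by (simp only: finite.emptyI)
    moreover have "(\<lambda>j\<in>J. \<zero>\<^bsub>M j\<^esub>) \<in> (\<Pi>\<^sub>E j\<in>J. carrier (M j))"
      by (simp add: abelian_monoid.zero_closed[OF abm])
    ultimately show ?thesis by (simp only: semilin_sum_simps mem_Collect_eq)
  qed
  have abS: "abelian_group ?S"
  proof (rule abelian_groupI)
    fix x y z assume c: "x \<in> carrier ?S" "y \<in> carrier ?S" "z \<in> carrier ?S"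
    show "(x \<oplus>\<^bsub>?S\<^esub> y) \<oplus>\<^bsub>?S\<^esub> z = x \<oplus>\<^bsub>?S\<^esub> (y \<oplus>\<^bsub>?S\<^esub> z)"
      using c by (auto intro!: restrict_ext simp: PiE_iff abelian_monoid.a_assoc[OF abm])
  next
    fix x y assume c: "x \<in> carrier ?S" "y \<in> carrier ?S"
    show "x \<oplus>\<^bsub>?S\<^esub> y = y \<oplus>\<^bsub>?S\<^esub> x"
      using c by (auto intro!: restrict_ext simp: PiE_iff abelian_monoid.a_comm[OF abm])
  next
    fix x assume c: "x \<in> carrier ?S"
    show "\<zero>\<^bsub>?S\<^esub> \<oplus>\<^bsub>?S\<^esub> x = x"
      using c by (auto intro!: ext simp: PiE_iff extensional_def abelian_monoid.l_zero[OF abm])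
  qed (fact addc zeroc inv)+
  show ?thesis
  proof (intro smooth_semilinear.intro smooth_semilinear_axioms.intro moduleI cring_ratfun_ring abS smc actc)
    fix x assume c: "x \<in> carrier ?S"
    show "act ?S 1 x = x"
      using c by (auto intro!: ext simp: PiE_iff extensional_def smooth_semilinear.act_one[OF obj])
    show "\<one>\<^bsub>ratfun_ring\<^esub> \<odot>\<^bsub>?S\<^esub> x = x"
      using c module.smult_one[OF mod] by (auto intro!: ext simp: PiE_iff extensional_def)
    show "act ?S (\<sigma> * \<tau>) x = act ?S \<sigma> (act ?S \<tau> x)" for \<sigma> \<tau>
      using c by (auto intro!: restrict_ext simp: PiE_iff smooth_semilinear.act_mult[OF obj])
    show "act ?S \<sigma> (a \<odot>\<^bsub>?S\<^esub> x) = perm_ratfun \<sigma> a \<odot>\<^bsub>?S\<^esub> act ?S \<sigma> x" for \<sigma> a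
      using c by (auto intro!: restrict_ext simp: PiE_iff smooth_semilinear.act_smult[OF obj])
    show "(a \<oplus>\<^bsub>ratfun_ring\<^esub> b) \<odot>\<^bsub>?S\<^esub> x = a \<odot>\<^bsub>?S\<^esub> x \<oplus>\<^bsub>?S\<^esub> b \<odot>\<^bsub>?S\<^esub> x" for a b
      using c module.smult_l_distr[OF mod] by (auto intro!: restrict_ext simp: PiE_iff)
    show "(a \<otimes>\<^bsub>ratfun_ring\<^esub> b) \<odot>\<^bsub>?S\<^esub> x = a \<odot>\<^bsub>?S\<^esub> (b \<odot>\<^bsub>?S\<^esub> x)" for a b
      using c module.smult_assoc1[OF mod] by (auto intro!: restrict_ext simp: PiE_iff)
    have "\<exists>n. \<forall>\<sigma>. (\<forall>i<n. \<sigma> \<langle>$\<rangle> i = i) \<longrightarrow>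
        (\<forall>j\<in>{j \<in> J. x j \<noteq> \<zero>\<^bsub>M j\<^esub>}. act (M j) \<sigma> (x j) = x j)"
    proof (rule fixing_finite)
      show "finite {j \<in> J. x j \<noteq> \<zero>\<^bsub>M j\<^esub>}" using c by simp
      show "\<exists>n. \<forall>\<sigma>. (\<forall>i<n. \<sigma> \<langle>$\<rangle> i = i) \<longrightarrow> act (M j) \<sigma> (x j) = x j"
        if "j \<in> {j \<in> J. x j \<noteq> \<zero>\<^bsub>M j\<^esub>}" for j
        using that c by (intro smooth_semilinear.smooth[OF obj]) auto
    qed
    then obtain n where n: "\<And>\<sigma> j. \<forall>i<n. \<sigma> \<langle>$\<rangle> i = i \<Longrightarrow> j \<in> J \<Longrightarrow> x j \<noteq> \<zero>\<^bsub>M j\<^esub> \<Longrightarrow>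
        act (M j) \<sigma> (x j) = x j"
      by blast
    have "act ?S \<sigma> x = x" if "\<forall>i<n. \<sigma> \<langle>$\<rangle> i = i" for \<sigma>
    proof
      fix j
      show "act ?S \<sigma> x j = x j"
        using c n[OF that, of j] obj[of j]
        by (cases "x j = \<zero>\<^bsub>M j\<^esub>") (auto simp: PiE_iff extensional_def smooth_semilinear.act_zero[OF obj])
    qed
    then show "\<exists>n. \<forall>\<sigma>. (\<forall>i<n. \<sigma> \<langle>$\<rangle> i = i) \<longrightarrow> act ?S \<sigma> x = x" by blast
  next
    fix x y assume c: "x \<in> carrier ?S" "y \<in> carrier ?S"
    show "act ?S \<sigma> (x \<oplus>\<^bsub>?S\<^esub> y) = act ?S \<sigma> x \<oplus>\<^bsub>?S\<^esub> act ?S \<sigma> y" for \<sigma>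
      using c by (auto intro!: restrict_ext simp: PiE_iff smooth_semilinear.act_add[OF obj])
    show "a \<odot>\<^bsub>?S\<^esub> (x \<oplus>\<^bsub>?S\<^esub> y) = a \<odot>\<^bsub>?S\<^esub> x \<oplus>\<^bsub>?S\<^esub> a \<odot>\<^bsub>?S\<^esub> y" for a
      using c module.smult_r_distr[OF mod] by (auto intro!: restrict_ext simp: PiE_iff)
  qed
qed

subsection \<open>The object \<open>Iobj r\<close> as a tensor product\<close>

definition const_ratfun :: "'k::field \<Rightarrow> 'k ratfun" where
  "const_ratfun c = Fract (Poly_Mapping.single 0 c) 1"

definition tens :: "'k::field ratfun \<Rightarrow> (nat set \<Rightarrow>\<^sub>0 'k) \<Rightarrow> (nat set \<Rightarrow>\<^sub>0 'k ratfun)" where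
  "tens a v = Poly_Mapping.map (\<lambda>c. a * const_ratfun c) v"

lemma const_ratfun_simps [simp]:
  "const_ratfun 0 = 0" "const_ratfun 1 = 1"
  "const_ratfun (c + d) = const_ratfun c + const_ratfun d"
  "const_ratfun (c * d) = const_ratfun c * const_ratfun d"
  "perm_ratfun \<sigma> (const_ratfun c) = const_ratfun c"
  by (simp_all add: const_ratfun_def Zero_fract_def One_fract_def single_add mult_single
        perm_ratfun_Fract perm_mpoly_single)

lemma lookup_tens [simp]:
  "Poly_Mapping.lookup (tens a v) S = a * const_ratfun (Poly_Mapping.lookup v S)"
  by (simp add: tens_def lookup_map_0)

lemma tens_closed: "v \<in> Vspace r \<Longrightarrow> tens a v \<in> carrier (Iobj r)"
  by (simp add: Vspace_iff)

lemma tens_add_left: "tens (a + b) v = tens a v + tens b v"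
  by (rule poly_mapping_eqI) (simp add: lookup_add distrib_right)

lemma tens_add_right: "tens a (v + w) = tens a v + tens a w"
  by (rule poly_mapping_eqI) (simp add: lookup_add distrib_left)

lemma tens_balanced: "tens (a * const_ratfun c) v = tens a (Poly_Mapping.map (\<lambda>d. c * d) v)"
  by (rule poly_mapping_eqI) (simp add: lookup_map_0 mult.assoc)

lemma smult_tens: "b \<odot>\<^bsub>Iobj r\<^esub> tens a v = tens (b * a) v"
  by (rule poly_mapping_eqI) (simp add: lookup_map_0 mult.assoc)

lemma act_tens: "act (Iobj r) \<sigma> (tens a v) = tens (perm_ratfun \<sigma> a) (perm_vec \<sigma> v)"
  by (rule poly_mapping_eqI) (simp add: lookup_map_0 perm_ratfun_mult)

lemma Vspace_induct [consumes 1, case_names zero add]: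
  assumes "v \<in> Vspace r" "P 0"
    "\<And>v S c. S \<in> subsets_of_card r \<Longrightarrow> v \<in> Vspace r \<Longrightarrow> P v \<Longrightarrow> P (Poly_Mapping.single S c + v)"
  shows "P (v :: nat set \<Rightarrow>\<^sub>0 'b::comm_monoid_add)"
  using assms(1)
proof (induction v rule: poly_mapping_add_induct)
  case (add p m c)
  have "Poly_Mapping.lookup (Poly_Mapping.single m c + p) S =
      (if S = m then c else Poly_Mapping.lookup p S)" for S
    using add.hyps by (auto simp: lookup_add lookup_single when_def in_keys_iff)
  then have "m \<in> subsets_of_card r" "p \<in> Vspace r"
    using add.prems add.hyps unfolding Vspace_iff in_keys_iff by metis+
  then show ?case using add.IH assms(3) by blast
qed (rule assms(2))

lemma tens_single: "tens a (Poly_Mapping.single S 1) = Poly_Mapping.single S a"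
  by (rule poly_mapping_eqI) (simp add: lookup_single when_def)

lemma single_in_Vspace: "S \<in> subsets_of_card r \<Longrightarrow> Poly_Mapping.single S c \<in> Vspace r"
  by (auto simp: Vspace_iff lookup_single when_def)

theorem tens_unique:
  fixes \<phi> \<psi> :: "(nat set \<Rightarrow>\<^sub>0 'k::field ratfun) \<Rightarrow> 'w::ab_group_add"
  assumes "\<And>x y. x \<in> carrier (Iobj r) \<Longrightarrow> y \<in> carrier (Iobj r) \<Longrightarrow> \<phi> (x + y) = \<phi> x + \<phi> y"
    and "\<And>x y. x \<in> carrier (Iobj r) \<Longrightarrow> y \<in> carrier (Iobj r) \<Longrightarrow> \<psi> (x + y) = \<psi> x + \<psi> y"
    and eq: "\<And>a v. v \<in> Vspace r \<Longrightarrow> \<phi> (tens a v) = \<psi> (tens a v)"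
    and "x \<in> carrier (Iobj r)"
  shows "\<phi> x = \<psi> x"
proof -
  have "x \<in> Vspace r" using assms(4) by simp
  then show ?thesis
  proof (induction x rule: Vspace_induct)
    case zero
    have "tens 0 0 = (0 :: nat set \<Rightarrow>\<^sub>0 'k ratfun)" by (rule poly_mapping_eqI) simp
    then show ?case using eq[of 0 0] by (simp add: Vspace_iff)
  next
    case (add v S c)
    then show ?case
      using assms(1,2) eq[of "Poly_Mapping.single S 1" c] by (simp add: single_in_Vspace tens_single)
  qed
qed

theorem tens_universal:
  fixes \<beta> :: "'k::field ratfun \<Rightarrow> (nat set \<Rightarrow>\<^sub>0 'k) \<Rightarrow> 'w::ab_group_add"
  assumes add1: "\<And>a b v. v \<in> Vspace r \<Longrightarrow> \<beta> (a + b) v = \<beta> a v + \<beta> b v"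
    and add2: "\<And>a v w. v \<in> Vspace r \<Longrightarrow> w \<in> Vspace r \<Longrightarrow> \<beta> a (v + w) = \<beta> a v + \<beta> a w"
    and bal: "\<And>a c v. v \<in> Vspace r \<Longrightarrow>
      \<beta> (a * const_ratfun c) v = \<beta> a (Poly_Mapping.map (\<lambda>d. c * d) v)"
  shows "\<exists>\<phi>. (\<forall>x\<in>carrier (Iobj r). \<forall>y\<in>carrier (Iobj r). \<phi> (x + y) = \<phi> x + \<phi> y) \<and>
    (\<forall>a. \<forall>v\<in>Vspace r. \<phi> (tens a v) = \<beta> a v)"
proof -
  define e :: "nat set \<Rightarrow> nat set \<Rightarrow>\<^sub>0 'k" where "e S = Poly_Mapping.single S 1" for S
  define \<phi> where "\<phi> x = (\<Sum>S\<in>Poly_Mapping.keys x. \<beta> (Poly_Mapping.lookup x S) (e S))" for x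
  have e: "e S \<in> Vspace r" if "S \<in> subsets_of_card r" for S
    unfolding e_def using that by (rule single_in_Vspace)
  have b0: "\<beta> 0 v = 0" if "v \<in> Vspace r" for v
    using add1[OF that, of 0 0] by simp
  have b00: "\<beta> a 0 = 0" for a
    using add2[of 0 0 a] by (simp add: Vspace_iff)
  have sup: "\<phi> x = (\<Sum>S\<in>T. \<beta> (Poly_Mapping.lookup x S) (e S))"
    if "finite T" "Poly_Mapping.keys x \<subseteq> T" "T \<subseteq> subsets_of_card r" for x T
    unfolding \<phi>_def using that
    by (intro sum.mono_neutral_left) (auto simp: in_keys_iff intro!: b0 e)
  have \<phi>_add: "\<phi> (x + y) = \<phi> x + \<phi> y" if "x \<in> Vspace r" "y \<in> Vspace r" for x y
  proof -
    let ?T = "Poly_Mapping.keys x \<union> Poly_Mapping.keys y"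
    have T: "finite ?T" "?T \<subseteq> subsets_of_card r" using that by (auto simp: Vspace_def)
    have "\<beta> (Poly_Mapping.lookup (x + y) S) (e S) =
        \<beta> (Poly_Mapping.lookup x S) (e S) + \<beta> (Poly_Mapping.lookup y S) (e S)" if "S \<in> ?T" for S
      using add1[OF e[OF subsetD[OF T(2) that]]] by (simp only: lookup_add)
    then have "(\<Sum>S\<in>?T. \<beta> (Poly_Mapping.lookup (x + y) S) (e S)) =
        (\<Sum>S\<in>?T. \<beta> (Poly_Mapping.lookup x S) (e S)) + (\<Sum>S\<in>?T. \<beta> (Poly_Mapping.lookup y S) (e S))"
      by (simp add: sum.distrib)
    moreover have "\<phi> (x + y) = (\<Sum>S\<in>?T. \<beta> (Poly_Mapping.lookup (x + y) S) (e S))"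
      by (rule sup[OF T(1) Poly_Mapping.keys_add T(2)])
    moreover have "\<phi> x = (\<Sum>S\<in>?T. \<beta> (Poly_Mapping.lookup x S) (e S))"
      by (rule sup[OF T(1) _ T(2)]) simp
    moreover have "\<phi> y = (\<Sum>S\<in>?T. \<beta> (Poly_Mapping.lookup y S) (e S))"
      by (rule sup[OF T(1) _ T(2)]) simp
    ultimately show ?thesis by simp
  qed
  have tens: "\<phi> (tens a v) = \<beta> a v" if "v \<in> Vspace r" for a v
    using that
  proof (induction v rule: Vspace_induct)
    case zero
    have "tens a 0 = 0" by (rule poly_mapping_eqI) simp
    then show ?case by (simp add: \<phi>_def b00)
  next
    case (add v S c)
    have "Poly_Mapping.map (\<lambda>d. c * d) (e S) = Poly_Mapping.single S c"
      by (rule poly_mapping_eqI) (simp add: e_def lookup_map_0 lookup_single when_def)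
    then have "\<beta> a (Poly_Mapping.single S c) = \<beta> (a * const_ratfun c) (e S)"
      using bal[OF e[OF add(1)], of a c] by simp
    moreover have "\<phi> (tens a (Poly_Mapping.single S c)) = \<beta> (a * const_ratfun c) (e S)"
    proof -
      have *: "tens a (Poly_Mapping.single S c) = Poly_Mapping.single S (a * const_ratfun c)"
        by (rule poly_mapping_eqI) (simp add: lookup_single when_def)
      show ?thesis
        by (subst sup[of "{S}"]) (use add(1) in \<open>auto simp: * lookup_single\<close>)
    qed
    ultimately show ?case
      using add tens_closed[of _ r a] single_in_Vspace[OF add(1), of c]
      by (simp add: tens_add_right \<phi>_add add2)
  qed
  show ?thesis using \<phi>_add tens by (intro exI[of _ \<phi>]) simp
qed

end

theory Submission
  imports Defs "HOL-Computational_Algebra.Polynomial" "HOL-Library.Nat_Bijection"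
begin

text \<open>
  Write a rational function of \<open>\<xi>\<^sub>i\<close> as polynomial part plus proper fraction. The constant coefficient of the
  polynomial part is a functional \<open>rho i\<close> that commutes with the permutations fixing \<open>i\<close>. Applied to
  variables outside a finite set \<open>C\<close>, it turns a map into \<open>\<^bold>I\<^sup>r\<close> that is equivariant only under the pointwise
  stabiliser of \<open>C\<close> into a fully equivariant one. Over a sufficiently small open subgroup every
  subrepresentation of a finitely generated representation has a complement, so maps into \<open>\<^bold>I\<^sup>r\<close> extend and standard
  objects are injective. A subrepresentation generated by as few elements of as small a size as
  possible embeds into a power of \<open>\<^bold>I\<^sup>r\<close>; hence every nonzero injective object contains a copy of some \<open>\<^bold>I\<^sup>r\<close>.
  By Zorn's lemma there is a maximal independent family of such copies; its sum is injective, thus a direct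
  summand, and its complement vanishes by maximality.
\<close>

section \<open>Finitary permutations\<close>

text \<open>The pointwise stabiliser of a nonempty finite set has infinite index, so equivariance
  cannot be restored by averaging over cosets. The substitute is \<open>rho i\<close>: it is the
  constant term of the expansion in descending powers of the variable with index \<open>i\<close>,
  hence involves no choice, is the identity on the functions free of that variable, and is linear
  over them. To evaluate the corrected map at a vector, \<open>i\<close> is first exchanged with an
  index that does not occur in the vector; all fresh indices give the same value, and this
  independence yields the equivariance. Two choices shape the rest. Generators are invariant under
  the setwise stabiliser of a finite set \<open>B\<close>, since the pointwise one would lead to
  injective tuples instead of subsets; a Galois descent argument supplies enough of them. And
  complements exist only after the group has been shrunk, which breaks orbits apart, so generators
  are measured by \<open>card B\<close>, which never grows under shrinking.\<close>

definition fixing :: "nat set \<Rightarrow> nat perm set" where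
  "fixing A = {\<sigma>. \<forall>i\<in>A. \<sigma> \<langle>$\<rangle> i = i}"

abbreviation img :: "nat perm \<Rightarrow> nat set \<Rightarrow> nat set" where
  "img \<sigma> S \<equiv> (\<lambda>i. \<sigma> \<langle>$\<rangle> i) ` S"

lemma one_in_fixing [simp]: "1 \<in> fixing A"
  by (simp add: fixing_def)

lemma mult_in_fixing: "\<sigma> \<in> fixing A \<Longrightarrow> \<tau> \<in> fixing A \<Longrightarrow> \<sigma> * \<tau> \<in> fixing A"
  by (simp add: fixing_def apply_times)

lemma inverse_in_fixing: "\<sigma> \<in> fixing A \<Longrightarrow> inverse \<sigma> \<in> fixing A"
  by (simp add: fixing_def inverse_fix)

lemma fixing_mono: "A \<subseteq> B \<Longrightarrow> fixing B \<subseteq> fixing A"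
  by (auto simp: fixing_def)

lemma fixing_Un: "\<sigma> \<in> fixing (A \<union> B) \<longleftrightarrow> \<sigma> \<in> fixing A \<and> \<sigma> \<in> fixing B"
  by (auto simp: fixing_def)

lemma fixing_insert: "\<sigma> \<in> fixing (insert i A) \<longleftrightarrow> \<sigma> \<langle>$\<rangle> i = i \<and> \<sigma> \<in> fixing A"
  by (auto simp: fixing_def)

lemma fixing_empty [simp]: "fixing {} = UNIV"
  by (simp add: fixing_def)

lemma swap_in_fixing: "a \<notin> A \<Longrightarrow> b \<notin> A \<Longrightarrow> \<langle>a \<leftrightarrow> b\<rangle> \<in> fixing A"
  unfolding fixing_def by (auto intro!: apply_swap_same)

lemma img_mult: "img (\<sigma> * \<tau>) S = img \<sigma> (img \<tau> S)"
  by (simp add: apply_times image_comp)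

lemma img_inverse [simp]: "img \<sigma> (img (inverse \<sigma>) S) = S" "img (inverse \<sigma>) (img \<sigma> S) = S"
  by (simp_all add: image_image)

lemma img_inverse_eq: "img (inverse \<sigma>) S = T \<longleftrightarrow> S = img \<sigma> T"
  by (metis img_inverse)

lemma img_fixing: "\<sigma> \<in> fixing A \<Longrightarrow> S \<subseteq> A \<Longrightarrow> img \<sigma> S = S"
  by (rule trans[OF image_cong[OF refl] image_ident]) (auto simp: fixing_def)

lemma card_img [simp]: "card (img \<sigma> S) = card S"
  by (simp add: card_image inj_on_subset[OF inj_perm])

lemma finite_img [simp]: "finite (img \<sigma> S) \<longleftrightarrow> finite S"
  by (simp add: finite_image_iff inj_on_subset[OF inj_perm])

lemma in_img_iff: "\<sigma> \<langle>$\<rangle> i \<in> img \<sigma> S \<longleftrightarrow> i \<in> S"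
  by (simp add: inj_image_mem_iff inj_perm)

lemma img_fixing_Int: "\<sigma> \<in> fixing A \<Longrightarrow> img \<sigma> S \<inter> A = S \<inter> A"
proof -
  assume "\<sigma> \<in> fixing A"
  then have "x \<in> img \<sigma> S \<longleftrightarrow> x \<in> S" if "x \<in> A" for x
    using in_img_iff[of \<sigma> x S] that by (simp add: fixing_def)
  then show ?thesis by blast
qed

lemma img_Un: "img \<sigma> (S \<union> T) = img \<sigma> S \<union> img \<sigma> T" by (rule image_Un)

lemma img_Int: "img \<sigma> (S \<inter> T) = img \<sigma> S \<inter> img \<sigma> T"
  by (simp add: image_Int inj_perm)

lemma fixing_conj: "\<tau> \<in> fixing (img \<sigma> A) \<Longrightarrow> inverse \<sigma> * \<tau> * \<sigma> \<in> fixing A"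
  by (auto simp: fixing_def apply_times)

text \<open>The image of \<open>f\<close> has as many points outside \<open>X\<close> as
  \<open>X\<close> has outside the image, so sending the former back to the latter closes
  \<open>f\<close> up to a permutation. The second conjunct confines the moved points, which is how
  later uses keep a prescribed set fixed.\<close>

lemma perm_extend:
  assumes "inj_on f X" "finite X"
  shows "\<exists>\<sigma>. (\<forall>x\<in>X. \<sigma> \<langle>$\<rangle> x = f x) \<and> (\<forall>i. i \<notin> X \<union> f ` X \<longrightarrow> \<sigma> \<langle>$\<rangle> i = i)"
proof -
  have "card (f ` X - X) = card (X - f ` X)"
    using assms by (simp add: card_Diff_subset_Int card_image Int_commute)
  then obtain g where g: "bij_betw g (f ` X - X) (X - f ` X)"
    using assms by (metis finite_same_card_bij finite_Diff finite_imageI)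
  define h where "h i = (if i \<in> X then f i else if i \<in> f ` X then g i else i)" for i
  have g1: "x \<in> f ` X \<Longrightarrow> x \<notin> X \<Longrightarrow> g x \<in> X \<and> g x \<notin> f ` X" for x
    using bij_betwE[OF g] by blast
  have g2: "x = y" if "x \<in> f ` X" "x \<notin> X" "y \<in> f ` X" "y \<notin> X" "g x = g y" for x y
    using g that unfolding bij_betw_def inj_on_def by blast
  have inj: "inj h"
  proof (rule injI)
    fix a b assume eq: "h a = h b"
    consider "a \<in> X" "b \<in> X" | "a \<in> X" "b \<notin> X" | "a \<notin> X" "b \<in> X" | "a \<notin> X" "b \<notin> X" by blast
    then show "a = b"
    proof cases
      case 1 then show ?thesis using eq assms(1) by (simp add: h_def inj_on_def)
    next
      case 2
      then have "h a \<in> f ` X" "h b \<notin> f ` X" using g1[of b] by (simp_all add: h_def)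
      then show ?thesis using eq by simp
    next
      case 3
      then have "h b \<in> f ` X" "h a \<notin> f ` X" using g1[of a] by (simp_all add: h_def)
      then show ?thesis using eq by simp
    next
      case 4 then show ?thesis
        using eq g1[of a] g1[of b] g2[of a b]
        by (cases "a \<in> f ` X"; cases "b \<in> f ` X") (simp_all add: h_def)
    qed
  qed
  have "h ` (X \<union> f ` X) \<subseteq> X \<union> f ` X"
    using g by (auto simp: h_def bij_betw_def)
  then have "h ` (X \<union> f ` X) = X \<union> f ` X"
    using assms inj by (intro endo_inj_surj) (auto intro: inj_on_subset)
  then have "y \<in> range h" for y
    by (cases "y \<in> X \<union> f ` X") (auto simp: h_def image_iff)
  then have "bij h" using inj by (auto simp: bij_def)
  moreover have "finite {a. h a \<noteq> a}"
    by (rule finite_subset[of _ "X \<union> f ` X"]) (use assms in \<open>auto simp: h_def\<close>)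
  ultimately have "apply (Perm h) = h" by (simp add: Perm_inverse)
  then show ?thesis by (intro exI[of _ "Perm h"]) (auto simp: h_def)
qed

text \<open>Shifting \<open>Y\<close> by a common bound of \<open>Z\<close> and \<open>A\<close>
  lands beyond both, and since \<open>Y\<close> misses \<open>A\<close>, no point of
  \<open>A\<close> is moved.\<close>

lemma ex_perm_avoid:
  assumes "finite Y" "finite Z" "Y \<inter> A = {}" "finite A"
  shows "\<exists>\<sigma>\<in>fixing A. img \<sigma> Y \<inter> Z = {}"
proof -
  obtain m where m: "\<And>i. i \<in> Z \<union> A \<Longrightarrow> i < m"
    using assms by (metis finite_Un finite_nat_set_iff_bounded)
  obtain \<sigma> where \<sigma>: "\<forall>x\<in>Y. \<sigma> \<langle>$\<rangle> x = x + m" "\<forall>i. i \<notin> Y \<union> (\<lambda>x. x + m) ` Y \<longrightarrow> \<sigma> \<langle>$\<rangle> i = i"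
    using perm_extend[of "\<lambda>x. x + m" Y] assms by auto
  have "\<sigma> \<langle>$\<rangle> i = i" if "i \<in> A" for i
    using \<sigma>(2) m[of i] that assms(3) by auto
  moreover have "img \<sigma> Y \<inter> Z = {}" using \<sigma>(1) m by force
  ultimately show ?thesis by (auto simp: fixing_def)
qed

text \<open>Any bijection from \<open>B\<close> to \<open>S\<close> extends without touching
  \<open>C\<close>. Through this transitivity the orbit of a setwise invariant vector is indexed by
  the subsets of one cardinality.\<close>

lemma ex_perm_onto:
  assumes "finite B" "finite S" "card B = card S" "B \<inter> C = {}" "S \<inter> C = {}"
  shows "\<exists>\<sigma>\<in>fixing C. img \<sigma> B = S"
proof -
  obtain f where f: "bij_betw f B S" using assms by (metis finite_same_card_bij)
  obtain \<sigma> where \<sigma>: "\<forall>x\<in>B. \<sigma> \<langle>$\<rangle> x = f x" "\<forall>i. i \<notin> B \<union> f ` B \<longrightarrow> \<sigma> \<langle>$\<rangle> i = i"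
    using perm_extend[of f B] f assms(1) by (auto simp: bij_betw_def)
  have "img \<sigma> B = S" using \<sigma>(1) f by (simp add: bij_betw_def)
  moreover have "\<sigma> \<langle>$\<rangle> i = i" if "i \<in> C" for i
    using \<sigma>(2) that assms f by (auto simp: bij_betw_def)
  ultimately show ?thesis by (auto simp: fixing_def)
qed

lemma ex_fresh: "finite (A :: nat set) \<Longrightarrow> \<exists>c. c \<notin> A"
  by (rule ex_new_if_finite) simp

section \<open>Semilinear representations on a type\<close>

text \<open>The vectors fill a whole type, which makes \<open>span\<close> and
  \<open>subspace\<close> of the vector space library available; the objects of the theorem, given
  by carriers, are embedded into this setting by \<open>realisation\<close>.\<close>

locale semirep = vector_space scale
  for scale :: "'k::field ratfun \<Rightarrow> 'v::ab_group_add \<Rightarrow> 'v" (infixr \<open>*s\<close> 75) +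
  fixes act :: "nat perm \<Rightarrow> 'v \<Rightarrow> 'v"
  assumes act_one [simp]: "act 1 v = v"
    and act_mult: "act (\<sigma> * \<tau>) v = act \<sigma> (act \<tau> v)"
    and act_add: "act \<sigma> (v + w) = act \<sigma> v + act \<sigma> w"
    and act_scale: "act \<sigma> (a *s v) = perm_ratfun \<sigma> a *s act \<sigma> v"
begin

lemma act_zero [simp]: "act \<sigma> 0 = 0"
  using act_add[of \<sigma> 0 0] by simp

lemma act_minus: "act \<sigma> (- v) = - act \<sigma> v"
  using act_add[of \<sigma> v "- v"] by (simp add: eq_neg_iff_add_eq_0 add.commute)

lemma act_diff: "act \<sigma> (v - w) = act \<sigma> v - act \<sigma> w"
  using act_add[of \<sigma> v "- w"] by (simp add: act_minus)

lemma act_sum: "act \<sigma> (sum f X) = (\<Sum>x\<in>X. act \<sigma> (f x))"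
  by (induction X rule: infinite_finite_induct) (simp_all add: act_add)

lemma act_inverse [simp]: "act \<sigma> (act (inverse \<sigma>) v) = v" "act (inverse \<sigma>) (act \<sigma> v) = v"
  by (simp_all flip: act_mult)

lemma act_swap_swap [simp]: "act \<langle>a \<leftrightarrow> b\<rangle> (act \<langle>a \<leftrightarrow> b\<rangle> v) = v"
  by (simp flip: act_mult)

lemma act_eq_iff [simp]: "act \<sigma> v = act \<sigma> w \<longleftrightarrow> v = w"
  by (metis act_inverse(2))

lemma act_eq_0_iff [simp]: "act \<sigma> v = 0 \<longleftrightarrow> v = 0"
  by (metis act_eq_iff act_zero)

section \<open>Supports of vectors\<close>

definition supports :: "nat set \<Rightarrow> 'v \<Rightarrow> bool" where
  "supports A x \<longleftrightarrow> (\<forall>\<sigma>\<in>fixing A. act \<sigma> x = x)"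

lemma supportsD: "supports A x \<Longrightarrow> \<sigma> \<in> fixing A \<Longrightarrow> act \<sigma> x = x"
  by (simp add: supports_def)

lemma supports_mono: "supports A x \<Longrightarrow> A \<subseteq> B \<Longrightarrow> supports B x"
  unfolding supports_def using fixing_mono by blast

lemma supports_zero [simp]: "supports A 0"
  by (simp add: supports_def)

lemma supports_add: "supports A x \<Longrightarrow> supports A y \<Longrightarrow> supports A (x + y)"
  by (simp add: supports_def act_add)

lemma supports_act: "supports A x \<Longrightarrow> supports (img \<sigma> A) (act \<sigma> x)"
  unfolding supports_def
proof
  fix \<tau> assume *: "\<forall>\<sigma>\<in>fixing A. act \<sigma> x = x" "\<tau> \<in> fixing (img \<sigma> A)"
  then have "act (inverse \<sigma> * \<tau> * \<sigma>) x = x" using fixing_conj by blast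
  then show "act \<tau> (act \<sigma> x) = act \<sigma> x" by (metis act_inverse(1) act_mult)
qed

text \<open>Move \<open>B - A\<close> away from \<open>\<sigma>\<close> by a permutation fixing \<open>A\<close>.\<close>

lemma supports_Int:
  assumes "supports A x" "supports B x" "finite A" "finite B"
  shows "supports (A \<inter> B) x"
  unfolding supports_def
proof
  fix \<sigma> assume \<sigma>: "\<sigma> \<in> fixing (A \<inter> B)"
  obtain \<pi> where \<pi>: "\<pi> \<in> fixing A" "img \<pi> (B - A) \<inter> affected \<sigma> = {}"
    using ex_perm_avoid[of "B - A" "affected \<sigma>" A] assms by auto
  have "supports (img \<pi> B) x"
    using supports_act[OF assms(2), of \<pi>] supportsD[OF assms(1) \<pi>(1)] by simp
  moreover have "\<sigma> \<langle>$\<rangle> i = i" if "i \<in> img \<pi> B" for i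
  proof -
    from that obtain b where b: "b \<in> B" "i = \<pi> \<langle>$\<rangle> b" by blast
    show ?thesis
    proof (cases "b \<in> A")
      case True then show ?thesis using b \<sigma> \<pi> by (auto simp: fixing_def)
    next
      case False then have "i \<notin> affected \<sigma>" using b \<pi>(2) by blast
      then show ?thesis by (simp add: in_affected)
    qed
  qed
  ultimately show "act \<sigma> x = x" by (auto simp: fixing_def supports_def)
qed

lemma act_cong_supports:
  assumes "supports A x" "\<And>i. i \<in> A \<Longrightarrow> \<sigma> \<langle>$\<rangle> i = \<tau> \<langle>$\<rangle> i"
  shows "act \<sigma> x = act \<tau> x"
proof -
  have "inverse \<tau> * \<sigma> \<in> fixing A" using assms(2) by (simp add: fixing_def apply_times)
  then have "act (inverse \<tau> * \<sigma>) x = x" using assms(1) by (simp add: supports_def)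
  then show ?thesis by (metis act_inverse(1) act_mult)
qed

end

hide_const (open) Rat.Fract

interpretation K: semirep "(*) :: 'k::field ratfun \<Rightarrow> 'k ratfun \<Rightarrow> 'k ratfun" perm_ratfun
  by unfold_locales (simp_all add: algebra_simps perm_ratfun_mult_perm perm_ratfun_add perm_ratfun_mult)

section \<open>Splitting off one variable\<close>

definition xi :: "nat \<Rightarrow> 'k::field ratfun" where
  "xi i = Fract (Poly_Mapping.single (Poly_Mapping.single i 1) 1) 1"

definition strip :: "nat \<Rightarrow> (nat \<Rightarrow>\<^sub>0 nat) \<Rightarrow> (nat \<Rightarrow>\<^sub>0 nat)" where
  "strip i m = Poly_Mapping.update i 0 m"

lemma lookup_strip [simp]: "Poly_Mapping.lookup (strip i m) j = (if j = i then 0 else Poly_Mapping.lookup m j)"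
  by (simp add: strip_def lookup_update)

text \<open>This rewrites \<open>p\<close> as a polynomial in the variable with index
  \<open>i\<close>. The coefficients are free of that variable but are placed in the whole field, so
  that division of polynomials over a field applies without a separate field of functions in the
  other variables.\<close>

definition uni :: "nat \<Rightarrow> 'k::field mpoly \<Rightarrow> 'k ratfun poly" where
  "uni i p = (\<Sum>m\<in>Poly_Mapping.keys p.
     monom (Fract (Poly_Mapping.single (strip i m) (Poly_Mapping.lookup p m)) 1) (Poly_Mapping.lookup m i))"

lemma Fract_add1: "Fract (a + b) 1 = Fract a 1 + Fract (b :: 'a::idom) 1"
  by simp

lemma uni_0 [simp]: "uni i 0 = 0"
  by (simp add: uni_def)

lemma uni_single: "uni i (Poly_Mapping.single m c) =
    monom (Fract (Poly_Mapping.single (strip i m) c) 1) (Poly_Mapping.lookup m i)"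
  by (cases "c = 0") (simp_all add: uni_def Zero_fract_def[symmetric])

lemma uni_add: "uni i (p + q) = uni i p + uni i q"
  unfolding uni_def
  by (rule setsum_keys_plus_distrib)
    (simp_all add: Zero_fract_def[symmetric] single_add Fract_add1 add_monom del: add_fract)

lemma strip_add: "strip i (m + m') = strip i m + strip i m'"
  by (rule poly_mapping_eqI) (simp add: lookup_add)

lemma uni_mult: "uni i (p * q) = uni i p * uni i q"
proof (induction p rule: poly_mapping_add_induct)
  case (add p m c)
  have "uni i (Poly_Mapping.single m c * q) = uni i (Poly_Mapping.single m c) * uni i q"
    by (induction q rule: poly_mapping_add_induct)
      (simp_all add: uni_add uni_single distrib_left mult_single mult_monom strip_add lookup_add)
  with add show ?case by (simp add: distrib_right uni_add)
qed simp

lemma strip_0 [simp]: "strip i 0 = 0"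
  by (rule poly_mapping_eqI) simp

lemma uni_1 [simp]: "uni i 1 = 1"
  using uni_single[of i 0 1] by (simp add: one_pCons monom_0 One_fract_def)

lemma xi_power: "(xi i :: 'k::field ratfun) ^ n = Fract (Poly_Mapping.single (Poly_Mapping.single i n) 1) 1"
proof (induction n)
  case 0 show ?case by (simp add: One_fract_def)
next
  case (Suc n)
  have "(xi i :: 'k ratfun) ^ Suc n = xi i * Fract (Poly_Mapping.single (Poly_Mapping.single i n) 1) 1"
    by (simp only: power_Suc Suc)
  also have "\<dots> = Fract (Poly_Mapping.single (Poly_Mapping.single i (Suc n)) 1) 1"
    by (simp add: xi_def mult_single flip: single_add)
  finally show ?case .
qed

text \<open>Substituting the variable back recovers \<open>p\<close>; this gives the injectivity of
  \<open>uni i\<close> and its value on polynomials in which \<open>i\<close> does not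
  occur.\<close>

lemma poly_uni: "poly (uni i p) (xi i) = Fract p 1"
proof (induction p rule: poly_mapping_add_induct)
  case zero show ?case by (simp add: Zero_fract_def)
next
  case (add p m c)
  have "strip i m + Poly_Mapping.single i (Poly_Mapping.lookup m i) = m"
    by (rule poly_mapping_eqI) (simp add: lookup_add lookup_single when_def)
  then have "poly (uni i (Poly_Mapping.single m c)) (xi i) = Fract (Poly_Mapping.single m c) 1"
    by (simp add: uni_single poly_monom xi_power mult_single)
  with add show ?case by (simp add: uni_add Fract_add1 del: add_fract)
qed

lemma uni_eq_0_iff [simp]: "uni i p = 0 \<longleftrightarrow> p = 0"
proof
  assume "uni i p = 0"
  then have "Fract p 1 = 0" using poly_uni[of i p] by simp
  then show "p = 0" by (simp add: Zero_fract_def eq_fract)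
qed simp

lemma map_poly_perm_add:
  "map_poly (perm_ratfun \<sigma>) (p + q) = map_poly (perm_ratfun \<sigma>) p + map_poly (perm_ratfun \<sigma>) q"
  by (rule poly_eqI) (simp add: coeff_map_poly perm_ratfun_add)

lemma map_poly_perm_mult:
  "map_poly (perm_ratfun \<sigma>) (p * q) = map_poly (perm_ratfun \<sigma>) p * map_poly (perm_ratfun \<sigma>) q"
  by (rule poly_eqI) (simp add: coeff_map_poly coeff_mult K.act_sum perm_ratfun_mult)

lemma map_poly_perm_sum:
  "map_poly (perm_ratfun \<sigma>) (sum f X) = (\<Sum>x\<in>X. map_poly (perm_ratfun \<sigma>) (f x))"
  by (induction X rule: infinite_finite_induct) (simp_all add: map_poly_perm_add)

lemma degree_map_poly_perm [simp]: "degree (map_poly (perm_ratfun \<sigma>) p) = degree p"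
  by (rule degree_map_poly) simp

text \<open>A field automorphism applied to the coefficients preserves degrees, so it maps a
  division with remainder to a division with remainder, and quotients are unique.\<close>

lemma map_poly_perm_div:
  "map_poly (perm_ratfun \<sigma>) (p div q) = map_poly (perm_ratfun \<sigma>) p div map_poly (perm_ratfun \<sigma>) q"
proof (cases "q = 0")
  case False
  let ?s = "map_poly (perm_ratfun \<sigma>)"
  have q: "?s q \<noteq> 0" using False by (simp add: map_poly_eq_0_iff)
  have "?s p = ?s q * ?s (p div q) + ?s (p mod q)"
    by (metis map_poly_perm_add map_poly_perm_mult mult_div_mod_eq)
  moreover have "?s (p mod q) div ?s q = 0"
    using degree_mod_less[OF False, of p] by (auto simp: div_poly_eq_0_iff)
  ultimately show ?thesis using q by (simp add: poly_div_add_left)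
qed simp

lemma strip_perm:
  assumes "\<sigma> \<langle>$\<rangle> i = i"
  shows "strip i (perm_monom \<sigma> m) = perm_monom \<sigma> (strip i m)"
proof (rule poly_mapping_eqI)
  fix j
  have "inverse \<sigma> \<langle>$\<rangle> j = i \<longleftrightarrow> j = i"
    using assms by (metis apply_inverse_simps)
  then show "Poly_Mapping.lookup (strip i (perm_monom \<sigma> m)) j = Poly_Mapping.lookup (perm_monom \<sigma> (strip i m)) j"
    by simp
qed

lemma uni_perm:
  assumes "\<sigma> \<langle>$\<rangle> i = i"
  shows "map_poly (perm_ratfun \<sigma>) (uni i p) = uni i (perm_mpoly \<sigma> p)"
  by (induction p rule: poly_mapping_add_induct)
    (simp_all add: uni_add map_poly_perm_add uni_single map_poly_monom perm_ratfun_Fract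
      perm_mpoly_add perm_mpoly_single strip_perm inverse_fix assms)

definition vars :: "'k::zero mpoly \<Rightarrow> nat set" where
  "vars p = \<Union> (Poly_Mapping.keys ` Poly_Mapping.keys p)"

lemma finite_vars [simp]: "finite (vars p)"
  by (simp add: vars_def)

lemma not_in_vars: "i \<notin> vars p \<longleftrightarrow> (\<forall>m\<in>Poly_Mapping.keys p. Poly_Mapping.lookup m i = 0)"
  by (auto simp: vars_def in_keys_iff)

lemma uni_const:
  assumes "i \<notin> vars p"
  shows "uni i p = [:Fract p 1:]"
proof -
  have "degree (uni i p) \<le> 0"
    unfolding uni_def using assms by (intro degree_sum_le) (auto simp: not_in_vars monom_0)
  then obtain c where "uni i p = [:c:]" using degree_eq_zeroE by blast
  then show ?thesis using poly_uni[of i p] by simp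
qed

text \<open>\<open>strip\<close> has removed the index \<open>i\<close> from the coefficients and
  \<open>c\<close> does not occur in \<open>p\<close>, so both exchanged indices are absent.\<close>

lemma uni_swap:
  assumes "c \<notin> vars p"
  shows "map_poly (perm_ratfun \<langle>i \<leftrightarrow> c\<rangle>) (uni i p) = uni i p"
  unfolding uni_def map_poly_perm_sum
proof (rule sum.cong[OF refl])
  fix m assume m: "m \<in> Poly_Mapping.keys p"
  have "perm_monom \<langle>i \<leftrightarrow> c\<rangle> (strip i m) = strip i m"
  proof (rule poly_mapping_eqI)
    fix j
    consider "j = i" | "j = c" | "j \<noteq> i" "j \<noteq> c" by blast
    then show "Poly_Mapping.lookup (perm_monom \<langle>i \<leftrightarrow> c\<rangle> (strip i m)) j = Poly_Mapping.lookup (strip i m) j"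
      using m assms by cases (auto simp: not_in_vars)
  qed
  then show "map_poly (perm_ratfun \<langle>i \<leftrightarrow> c\<rangle>)
      (monom (Fract (Poly_Mapping.single (strip i m) (Poly_Mapping.lookup p m)) 1) (Poly_Mapping.lookup m i)) =
      monom (Fract (Poly_Mapping.single (strip i m) (Poly_Mapping.lookup p m)) 1) (Poly_Mapping.lookup m i)"
    by (simp add: map_poly_monom perm_ratfun_Fract perm_mpoly_single)
qed

text \<open>The constant coefficient of the polynomial part of a rational function of \<open>\<xi>\<^sub>i\<close>.\<close>

lift_definition rho :: "nat \<Rightarrow> 'k::field ratfun \<Rightarrow> 'k ratfun"
  is "\<lambda>i (p, q). coeff (uni i p div uni i q) 0"
proof (clarsimp)
  fix i and p q p' q' :: "'k mpoly"
  assume *: "q \<noteq> 0" "q' \<noteq> 0" "p * q' = p' * q"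
  have "uni i p div uni i q = (uni i p * uni i q') div (uni i q * uni i q')"
    using * by simp
  also have "\<dots> = (uni i p' * uni i q) div (uni i q' * uni i q)"
    using *(3) by (metis uni_mult mult.commute)
  also have "\<dots> = uni i p' div uni i q'"
    using * by simp
  finally show "coeff (uni i p div uni i q) 0 = coeff (uni i p' div uni i q') 0" by simp
qed

section \<open>Linearity, equivariance and nonvanishing of the constant term\<close>

lemma rho_Fract: "q \<noteq> 0 \<Longrightarrow> rho i (Fract p q) = coeff (uni i p div uni i q) 0"
  by transfer simp

lemma rho_0 [simp]: "rho i 0 = 0"
  by (simp add: Zero_fract_def rho_Fract)

lemma rho_1 [simp]: "rho i 1 = 1"
  by (simp add: One_fract_def rho_Fract)

lemma rho_add: "rho i (a + b) = rho i a + rho i b"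
proof (cases a; cases b)
  fix p q p' q' assume *: "a = Fract p q" "q \<noteq> 0" "b = Fract p' q'" "q' \<noteq> 0"
  have "rho i (a + b) = coeff ((uni i p * uni i q' + uni i p' * uni i q) div (uni i q * uni i q')) 0"
    using * by (simp add: rho_Fract uni_add uni_mult)
  also have "\<dots> = coeff ((uni i p * uni i q') div (uni i q * uni i q') +
      (uni i p' * uni i q) div (uni i q' * uni i q)) 0"
    by (simp only: poly_div_add_left mult.commute)
  also have "\<dots> = rho i a + rho i b"
    using * by (simp add: rho_Fract)
  finally show ?thesis .
qed

lemma rho_perm: "\<sigma> \<langle>$\<rangle> i = i \<Longrightarrow> rho i (perm_ratfun \<sigma> a) = perm_ratfun \<sigma> (rho i a)"
  by (cases a) (simp add: perm_ratfun_Fract rho_Fract coeff_map_poly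
    flip: uni_perm map_poly_perm_div)

text \<open>Start from any fraction for \<open>a\<close> and exchange \<open>i\<close> with an index
  \<open>c\<close> that is fresh for the fraction and outside \<open>A\<close>. The value
  \<open>a\<close> is unchanged, while \<open>i\<close> has disappeared from numerator and
  denominator.\<close>

lemma Fract_avoiding:
  assumes "K.supports A a" "finite A" "i \<notin> A"
  shows "\<exists>p q. a = Fract p q \<and> q \<noteq> 0 \<and> i \<notin> vars p \<and> i \<notin> vars q"
proof (cases a)
  case (Fract p q)
  obtain c where c: "c \<notin> insert i (vars p \<union> vars q \<union> A)"
    using ex_fresh[of "insert i (vars p \<union> vars q \<union> A)"] assms by auto
  let ?s = "\<langle>i \<leftrightarrow> c\<rangle>"
  have v: "i \<notin> vars (perm_mpoly ?s p)" if "c \<notin> vars p" for p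
    unfolding not_in_vars
  proof
    fix m assume "m \<in> Poly_Mapping.keys (perm_mpoly ?s p)"
    then have "perm_monom ?s m \<in> Poly_Mapping.keys p" by (simp add: in_keys_iff)
    then have "Poly_Mapping.lookup (perm_monom ?s m) c = 0" using that unfolding not_in_vars by blast
    then show "Poly_Mapping.lookup m i = 0" by simp
  qed
  have "perm_ratfun ?s a = a"
    using assms c by (intro K.supportsD[OF assms(1)] swap_in_fixing) auto
  then have "a = Fract (perm_mpoly ?s p) (perm_mpoly ?s q)"
    using Fract by (simp add: perm_ratfun_Fract)
  then show ?thesis using v c Fract by (metis UnCI insertCI perm_mpoly_eq_0_iff)
qed

text \<open>An \<open>a\<close> free of the variable is a quotient of two constants of the
  polynomial ring, and constants can be pulled out of a polynomial division.\<close>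

lemma rho_linear:
  assumes "K.supports A a" "finite A" "i \<notin> A"
  shows "rho i (a * f) = a * rho i f"
proof -
  obtain p q where a: "a = Fract p q" "q \<noteq> 0" "i \<notin> vars p" "i \<notin> vars q"
    using Fract_avoiding[OF assms] by blast
  obtain p' q' where f: "f = Fract p' q'" "q' \<noteq> 0" by (cases f)
  have eq: "a * f = Fract (p * p') (q * q')" and nz: "q * q' \<noteq> 0" using a f by simp_all
  have "rho i (a * f) = coeff (smult (Fract p 1) (uni i p') div smult (Fract q 1) (uni i q')) 0"
    unfolding eq rho_Fract[OF nz] uni_mult uni_const[OF a(3)] uni_const[OF a(4)] by simp
  also have "\<dots> = (Fract p 1 * inverse (Fract q 1)) * rho i f"
    unfolding div_smult_left div_smult_right coeff_smult f(1) rho_Fract[OF f(2)] by (simp only: mult_ac)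
  also have "Fract p 1 * inverse (Fract q 1) = a"
    using a by simp
  finally show ?thesis .
qed

lemma rho_fixed: "K.supports A a \<Longrightarrow> finite A \<Longrightarrow> i \<notin> A \<Longrightarrow> rho i a = a"
  using rho_linear[of A a i 1] by simp

text \<open>The value no longer contains the variable with index \<open>i\<close>. The formulation
  by transpositions with almost all \<open>c\<close> is the one that, together with
  \<open>supports_Int\<close>, drops \<open>i\<close> from a support.\<close>

lemma rho_swap: "\<exists>V. finite V \<and> (\<forall>c. c \<notin> V \<longrightarrow> perm_ratfun \<langle>i \<leftrightarrow> c\<rangle> (rho i f) = rho i f)"
proof (cases f)
  case (Fract p q)
  have "perm_ratfun \<langle>i \<leftrightarrow> c\<rangle> (rho i f) = rho i f" if "c \<notin> vars p \<union> vars q" for c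
  proof -
    have "perm_ratfun \<langle>i \<leftrightarrow> c\<rangle> (rho i f) = coeff (map_poly (perm_ratfun \<langle>i \<leftrightarrow> c\<rangle>) (uni i p div uni i q)) 0"
      using Fract by (simp add: rho_Fract coeff_map_poly)
    also have "\<dots> = rho i f"
      using Fract that by (simp add: map_poly_perm_div uni_swap rho_Fract)
    finally show ?thesis .
  qed
  then show ?thesis by (intro exI[of _ "vars p \<union> vars q"]) simp
qed

lemma coeff_div_nonzero:
  fixes p q :: "'a::field poly"
  assumes "degree p = degree q" "p \<noteq> 0" "q \<noteq> 0"
  shows "coeff (p div q) 0 \<noteq> 0"
proof -
  have ne: "p div q \<noteq> 0" using assms by (simp add: div_poly_eq_0_iff)
  have eq: "p = q * (p div q) + p mod q" by simp
  have d: "degree (q * (p div q)) = degree q + degree (p div q)"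
    using ne assms by (simp add: degree_mult_eq)
  have "degree (p mod q) < degree q \<or> p mod q = 0" using degree_mod_less[OF assms(3), of p] by auto
  then have "degree p = degree q + degree (p div q)"
  proof
    assume "degree (p mod q) < degree q"
    then show ?thesis using eq d by (metis degree_add_eq_left trans_less_add1)
  qed (use eq d in simp)
  then have "degree (p div q) = 0" using assms by simp
  then show ?thesis using ne by (metis coeff_0 degree_0_id leading_coeff_0_iff)
qed

lemma uni_xi: "uni i (Poly_Mapping.single (Poly_Mapping.single i n) 1) = monom 1 n"
proof -
  have "strip i (Poly_Mapping.single i n) = 0"
    by (rule poly_mapping_eqI) (simp add: lookup_single)
  then show ?thesis by (simp add: uni_single One_fract_def)
qed

lemma perm_xi: "perm_ratfun \<sigma> (xi i) = xi (\<sigma> \<langle>$\<rangle> i)"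
proof -
  have "perm_monom \<sigma> (Poly_Mapping.single i 1) = Poly_Mapping.single (\<sigma> \<langle>$\<rangle> i) 1"
    by (rule poly_mapping_eqI) (auto simp: lookup_single when_def)
  then show ?thesis by (simp add: xi_def perm_ratfun_Fract perm_mpoly_single)
qed

lemma perm_power: "perm_ratfun \<sigma> (a ^ n) = perm_ratfun \<sigma> a ^ n"
  by (induction n) (simp_all add: perm_ratfun_mult)

lemma perm_inverse: "perm_ratfun \<sigma> (inverse a) = inverse (perm_ratfun \<sigma> a)"
proof (cases "a = 0")
  case False
  then have "perm_ratfun \<sigma> a * perm_ratfun \<sigma> (inverse a) = 1"
    by (simp flip: perm_ratfun_mult)
  then show ?thesis by (metis inverse_unique)
qed simp

text \<open>Multiplication by a power of the variable, possibly a negative one, makes numerator and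
  denominator equal in degree, so that the polynomial part is a nonzero constant. The multiplier
  contains no other variable, so scaling by it preserves equivariance under all permutations fixing
  \<open>i\<close>.\<close>

lemma rho_nonzero:
  assumes "f \<noteq> (0 :: 'k::field ratfun)"
  shows "\<exists>a. (\<forall>\<sigma>. \<sigma> \<langle>$\<rangle> i = i \<longrightarrow> perm_ratfun \<sigma> a = a) \<and> rho i (a * f) \<noteq> 0"
proof (cases f)
  case (Fract p q)
  then have ne: "uni i p \<noteq> 0" "uni i q \<noteq> 0" using assms by (auto simp: Zero_fract_def eq_fract)
  let ?x = "\<lambda>n. Poly_Mapping.single (Poly_Mapping.single i n) 1 :: 'k mpoly"
  have x0: "?x n \<noteq> 0" for n by (metis lookup_single_eq lookup_zero one_neq_zero)
  have inv: "perm_ratfun \<sigma> (Fract (?x n) 1) = Fract (?x n) 1" if "\<sigma> \<langle>$\<rangle> i = i" for \<sigma> n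
    using that by (simp add: perm_power perm_xi flip: xi_power)
  show ?thesis
  proof (cases "degree (uni i p) \<le> degree (uni i q)")
    case True
    let ?n = "degree (uni i q) - degree (uni i p)"
    have "rho i (Fract (?x ?n) 1 * f) = coeff ((monom 1 ?n * uni i p) div uni i q) 0"
      using Fract by (simp add: rho_Fract uni_mult uni_xi)
    also have "\<dots> \<noteq> 0"
      using ne True by (intro coeff_div_nonzero) (simp_all add: degree_mult_eq degree_monom_eq)
    finally show ?thesis using inv by blast
  next
    case False
    let ?n = "degree (uni i p) - degree (uni i q)"
    have "rho i (inverse (Fract (?x ?n) 1) * f) = coeff (uni i p div (monom 1 ?n * uni i q)) 0"
      using Fract x0[of ?n] by (simp add: rho_Fract uni_mult uni_xi)
    also have "\<dots> \<noteq> 0"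
      using ne False by (intro coeff_div_nonzero) (simp_all add: degree_mult_eq degree_monom_eq)
    finally show ?thesis using inv by (metis perm_inverse)
  qed
qed

lemma K_smooth: "\<exists>A. finite A \<and> K.supports A (a :: 'k::field ratfun)"
proof -
  obtain n where "\<forall>\<sigma>. (\<forall>i<n. \<sigma> \<langle>$\<rangle> i = i) \<longrightarrow> perm_ratfun \<sigma> a = a"
    using perm_ratfun_smooth[of a] by blast
  then show ?thesis by (intro exI[of _ "{..<n}"]) (simp add: K.supports_def fixing_def)
qed

section \<open>Standard representations\<close>

definition tscale :: "'k::field ratfun \<Rightarrow> ('w \<Rightarrow>\<^sub>0 'k ratfun) \<Rightarrow> ('w \<Rightarrow>\<^sub>0 'k ratfun)" where
  "tscale a z = Poly_Mapping.map (\<lambda>b. a * b) z"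

text \<open>The first component of an index labels the summand and is left alone, so one
  representation on \<open>'i \<times> nat set\<close> contains the direct sums of objects
  \<open>Iobj r\<close> labelled by \<open>'i\<close>.\<close>

definition tact :: "nat perm \<Rightarrow> ('i \<times> nat set \<Rightarrow>\<^sub>0 'k::field ratfun) \<Rightarrow> ('i \<times> nat set \<Rightarrow>\<^sub>0 'k ratfun)" where
  "tact \<sigma> z = Poly_Mapping.map (perm_ratfun \<sigma>) (Poly_Mapping.map_key (\<lambda>(b, S). (b, img (inverse \<sigma>) S)) z)"

lemma lookup_tscale [simp]: "Poly_Mapping.lookup (tscale a z) w = a * Poly_Mapping.lookup z w"
  by (simp add: tscale_def lookup_map_0)

lemma lookup_tact [simp]:
  fixes z :: "'i \<times> nat set \<Rightarrow>\<^sub>0 'k::field ratfun"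
  shows "Poly_Mapping.lookup (tact \<sigma> z) (b, S) =
    perm_ratfun \<sigma> (Poly_Mapping.lookup z (b, img (inverse \<sigma>) S))"
proof -
  let ?f = "\<lambda>(b :: 'i, S). (b, img (inverse \<sigma>) S)"
  have inj: "inj ?f"
    by (rule inj_on_inverseI[where g = "\<lambda>(b, S). (b, img \<sigma> S)"]) (simp add: case_prod_beta)
  have "Poly_Mapping.lookup (Poly_Mapping.map_key ?f z) (b, S) = Poly_Mapping.lookup z (b, img (inverse \<sigma>) S)"
    unfolding map_key.rep_eq[OF inj] o_def by (simp only: case_prod_conv)
  then show ?thesis
    unfolding tact_def using lookup_map_0[of "perm_ratfun \<sigma>" "Poly_Mapping.map_key ?f z" "(b, S)"] by simp
qed

lemma vector_space_tscale: "vector_space (tscale :: 'k::field ratfun \<Rightarrow> ('w \<Rightarrow>\<^sub>0 'k ratfun) \<Rightarrow> _)"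
proof
  fix a b :: "'k ratfun" and z w :: "'w \<Rightarrow>\<^sub>0 'k ratfun"
  show "tscale a (z + w) = tscale a z + tscale a w"
    by (rule poly_mapping_eqI) (simp add: lookup_add distrib_left)
  show "tscale (a + b) z = tscale a z + tscale b z"
    by (rule poly_mapping_eqI) (simp add: lookup_add distrib_right)
  show "tscale a (tscale b z) = tscale (a * b) z"
    by (rule poly_mapping_eqI) (simp only: lookup_tscale mult.assoc)
  show "tscale 1 z = z"
    by (rule poly_mapping_eqI) simp
qed

interpretation T: semirep tscale "tact :: _ \<Rightarrow> ('i \<times> nat set \<Rightarrow>\<^sub>0 'k::field ratfun) \<Rightarrow> _"
proof (intro semirep.intro semirep_axioms.intro vector_space_tscale)
  fix \<sigma> \<tau> and z w :: "'i \<times> nat set \<Rightarrow>\<^sub>0 'k ratfun" and a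
  show "tact (\<sigma> * \<tau>) z = tact \<sigma> (tact \<tau> z)"
    by (rule poly_mapping_eqI) (clarsimp simp: perm_ratfun_mult_perm apply_times image_comp)
  show "tact 1 z = z" by (rule poly_mapping_eqI) clarsimp
  show "tact \<sigma> (z + w) = tact \<sigma> z + tact \<sigma> w"
    by (rule poly_mapping_eqI) (clarsimp simp: lookup_add perm_ratfun_add)
  show "tact \<sigma> (tscale a z) = tscale (perm_ratfun \<sigma> a) (tact \<sigma> z)"
    by (rule poly_mapping_eqI) (clarsimp simp: perm_ratfun_mult)
qed

text \<open>Such a \<open>G\<close> consists, for each label, of full layers of all sets of one
  finite cardinality. Hence \<open>TW G\<close> is a direct sum of copies of the
  \<open>Iobj r\<close>, and the results on maps into standard representations are stated for these
  \<open>TW G\<close>.\<close>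

definition perm_closed :: "('i \<times> nat set) set \<Rightarrow> bool" where
  "perm_closed G \<longleftrightarrow> (\<forall>(b, S)\<in>G. finite S \<and> (\<forall>\<sigma>. (b, img \<sigma> S) \<in> G))"

definition TW :: "'w set \<Rightarrow> ('w \<Rightarrow>\<^sub>0 'k::zero) set" where
  "TW G = {z. Poly_Mapping.keys z \<subseteq> G}"

lemma TW_iff: "z \<in> TW G \<longleftrightarrow> (\<forall>w. w \<notin> G \<longrightarrow> Poly_Mapping.lookup z w = 0)"
  by (auto simp: TW_def in_keys_iff)

lemma subspace_TW: "T.subspace (TW G)"
  by (auto simp: T.subspace_def TW_iff lookup_add)

lemma tact_TW: "perm_closed G \<Longrightarrow> z \<in> TW G \<Longrightarrow> tact \<sigma> z \<in> TW G"
  unfolding TW_iff perm_closed_def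
  by (clarsimp, metis (no_types, lifting) case_prodD img_inverse(1))

lemma TW_finite: "perm_closed G \<Longrightarrow> z \<in> TW G \<Longrightarrow> (b, S) \<in> Poly_Mapping.keys z \<Longrightarrow> finite S"
  by (auto simp: perm_closed_def TW_def)

text \<open>If a point \<open>s\<close> of a key lay outside \<open>A\<close>, exchanging it with an
  index foreign to \<open>A\<close> and to all keys would fix \<open>z\<close> and yet produce a key
  containing the foreign index. Once the keys lie in \<open>A\<close>, the group
  \<open>fixing A\<close> acts on each coefficient separately.\<close>

lemma T_keys_supports:
  assumes z: "T.supports A z" "finite A" "perm_closed G" "z \<in> TW G" "(b, S) \<in> Poly_Mapping.keys z"
  shows "S \<subseteq> A" "K.supports A (Poly_Mapping.lookup z (b, S))"
proof -
  let ?U = "\<Union> (snd ` Poly_Mapping.keys z)"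
  have fin: "finite ?U" using TW_finite[OF z(3,4)] by force
  show sub: "S \<subseteq> A"
  proof
    fix s assume s: "s \<in> S"
    show "s \<in> A"
    proof (rule ccontr)
      assume sA: "s \<notin> A"
      obtain c where c: "c \<notin> A \<union> ?U" using ex_fresh[of "A \<union> ?U"] z(2) fin by blast
      have "tact \<langle>s \<leftrightarrow> c\<rangle> z = z"
        using c sA by (intro T.supportsD[OF z(1)] swap_in_fixing) auto
      then have "Poly_Mapping.lookup z (b, img \<langle>s \<leftrightarrow> c\<rangle> S) = perm_ratfun \<langle>s \<leftrightarrow> c\<rangle> (Poly_Mapping.lookup z (b, S))"
        by (metis lookup_tact img_inverse(2))
      then have "(b, img \<langle>s \<leftrightarrow> c\<rangle> S) \<in> Poly_Mapping.keys z"
        using z(5) by (simp add: in_keys_iff)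
      moreover have "c \<in> img \<langle>s \<leftrightarrow> c\<rangle> S" using s by (metis apply_swap_simp(1) imageI)
      ultimately show False using c by force
    qed
  qed
  show "K.supports A (Poly_Mapping.lookup z (b, S))"
    unfolding K.supports_def
  proof
    fix \<sigma> assume \<sigma>: "\<sigma> \<in> fixing A"
    then have "tact \<sigma> z = z" using z(1) by (simp add: T.supports_def)
    moreover have "img (inverse \<sigma>) S = S"
      using img_fixing[OF inverse_in_fixing[OF \<sigma>] sub] .
    ultimately show "perm_ratfun \<sigma> (Poly_Mapping.lookup z (b, S)) = Poly_Mapping.lookup z (b, S)"
      by (metis lookup_tact)
  qed
qed

text \<open>The analogue of \<open>rho i\<close> on vectors. Basis vectors whose set contains
  \<open>i\<close> are killed, because the result is meant to be free of \<open>i\<close>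
  altogether, in the coefficients and in the sets.\<close>

definition trho :: "nat \<Rightarrow> ('i \<times> nat set \<Rightarrow>\<^sub>0 'k::field ratfun) \<Rightarrow> ('i \<times> nat set \<Rightarrow>\<^sub>0 'k ratfun)" where
  "trho i z = Poly_Mapping.mapp (\<lambda>(b, S) a. if i \<in> S then 0 else rho i a) z"

lemma lookup_trho [simp]: "Poly_Mapping.lookup (trho i z) (b, S) =
    (if i \<in> S then 0 else rho i (Poly_Mapping.lookup z (b, S)))"
  by (simp add: trho_def lookup_mapp when_def in_keys_iff)

lemma trho_add: "trho i (z + w) = trho i z + trho i w"
  by (rule poly_mapping_eqI) (clarsimp simp: lookup_add rho_add)

lemma trho_TW: "z \<in> TW G \<Longrightarrow> trho i z \<in> TW G"
  by (auto simp: TW_iff)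

lemma trho_scale:
  "K.supports A a \<Longrightarrow> finite A \<Longrightarrow> i \<notin> A \<Longrightarrow> trho i (tscale a z) = tscale a (trho i z)"
  by (rule poly_mapping_eqI) (clarsimp simp: rho_linear)

lemma trho_act:
  assumes "\<sigma> \<langle>$\<rangle> i = i"
  shows "trho i (tact \<sigma> z) = tact \<sigma> (trho i z)"
proof (rule poly_mapping_eqI, clarify)
  fix b S
  have "i \<in> img (inverse \<sigma>) S \<longleftrightarrow> i \<in> S"
    using in_img_iff[of "inverse \<sigma>" i S] assms by (simp add: inverse_fix)
  then show "Poly_Mapping.lookup (trho i (tact \<sigma> z)) (b, S) = Poly_Mapping.lookup (tact \<sigma> (trho i z)) (b, S)"
    using assms by (simp add: rho_perm)
qed

lemma trho_fixed:
  assumes z: "T.supports A z" "finite A" "i \<notin> A" "perm_closed G" "z \<in> TW G"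
  shows "trho i z = z"
proof (rule poly_mapping_eqI, clarify)
  fix b S
  show "Poly_Mapping.lookup (trho i z) (b, S) = Poly_Mapping.lookup z (b, S)"
  proof (cases "(b, S) \<in> Poly_Mapping.keys z")
    case True
    then show ?thesis
      using T_keys_supports[OF z(1,2,4,5) True] z rho_fixed[OF _ z(2,3)] by auto
  qed (simp add: in_keys_iff)
qed

lemma img_swap_id: "i \<notin> S \<Longrightarrow> c \<notin> S \<Longrightarrow> img \<langle>i \<leftrightarrow> c\<rangle> S = S"
  by (intro img_fixing[of _ S] swap_in_fixing) auto

lemma in_img_swap: "i \<in> img \<langle>i \<leftrightarrow> c\<rangle> S \<longleftrightarrow> c \<in> S" "c \<in> img \<langle>i \<leftrightarrow> c\<rangle> S \<longleftrightarrow> i \<in> S"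
  using in_img_iff[of "\<langle>i \<leftrightarrow> c\<rangle>" c S] in_img_iff[of "\<langle>i \<leftrightarrow> c\<rangle>" i S] by simp_all

text \<open>The result is fixed by the transposition of \<open>i\<close> with a fresh
  \<open>c\<close>, so besides \<open>insert i A\<close> it has the support
  \<open>insert c A\<close>, and the two intersect in \<open>A\<close>.\<close>

lemma trho_supports:
  assumes z: "T.supports (insert i A) z" "finite A" "i \<notin> A" "perm_closed G" "z \<in> TW G"
  shows "T.supports A (trho i z)"
proof -
  let ?U = "\<Union> (snd ` Poly_Mapping.keys z)"
  have finU: "finite ?U" using TW_finite[OF z(4,5)] by force
  have "\<forall>w. \<exists>V. finite V \<and> (\<forall>c. c \<notin> V \<longrightarrow>
      perm_ratfun \<langle>i \<leftrightarrow> c\<rangle> (rho i (Poly_Mapping.lookup z w)) = rho i (Poly_Mapping.lookup z w))"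
    using rho_swap by blast
  from choice[OF this] obtain V where V: "\<And>w. finite (V w)"
    "\<And>w c. c \<notin> V w \<Longrightarrow> perm_ratfun \<langle>i \<leftrightarrow> c\<rangle> (rho i (Poly_Mapping.lookup z w)) = rho i (Poly_Mapping.lookup z w)"
    by blast
  let ?V = "\<Union> (V ` Poly_Mapping.keys z)"
  have "finite (insert i A \<union> ?U \<union> ?V)" using z(2) finU V(1) by simp
  from ex_fresh[OF this] obtain c where c: "c \<notin> insert i A \<union> ?U \<union> ?V" ..
  let ?s = "\<langle>i \<leftrightarrow> c\<rangle>"
  \<comment> \<open>A set containing the fresh index has coefficient zero in \<open>z\<close>, which
    matches, after the exchange, the value zero that \<open>trho i\<close> gives to sets containing
    \<open>i\<close>.\<close>
  have no: "Poly_Mapping.lookup z (b, S) = 0" if "c \<in> S" for b S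
    using c that by (force simp: in_keys_iff)
  have swap: "tact ?s (trho i z) = trho i z"
  proof (rule poly_mapping_eqI, clarify)
    fix b S
    show "Poly_Mapping.lookup (tact ?s (trho i z)) (b, S) = Poly_Mapping.lookup (trho i z) (b, S)"
    proof (cases "i \<in> S \<or> c \<in> S")
      case True
      have L: "Poly_Mapping.lookup (tact ?s (trho i z)) (b, S) = perm_ratfun ?s (Poly_Mapping.lookup (trho i z) (b, img ?s S))"
        by (simp only: lookup_tact inverse_swap)
      show ?thesis
      proof (cases "c \<in> S")
        case True
        then have "i \<in> img ?s S" by (simp only: in_img_swap)
        then show ?thesis unfolding L by (simp only: lookup_trho if_True no[OF True] rho_0 if_cancel perm_ratfun_0)
      next
        case False
        with True have i: "i \<in> S" by blast
        then have "c \<in> img ?s S" by (simp only: in_img_swap)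
        then show ?thesis unfolding L
          by (simp only: lookup_trho no i if_True rho_0 if_cancel perm_ratfun_0)
      qed
    next
      case False
      then have eq: "img ?s S = S" using img_swap_id by blast
      have "perm_ratfun ?s (rho i (Poly_Mapping.lookup z (b, S))) = rho i (Poly_Mapping.lookup z (b, S))"
      proof (cases "(b, S) \<in> Poly_Mapping.keys z")
        case True
        then show ?thesis using c by (intro V(2)) blast
      qed (simp add: in_keys_iff)
      then show ?thesis using False by (simp add: eq)
    qed
  qed
  have 1: "T.supports (insert i A) (trho i z)"
    unfolding T.supports_def
  proof
    fix \<sigma> assume "\<sigma> \<in> fixing (insert i A)"
    then show "tact \<sigma> (trho i z) = trho i z"
      using T.supportsD[OF z(1)] trho_act[of \<sigma> i z] by (metis fixing_insert)
  qed
  have "img ?s (insert i A) = insert c A"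
    using img_swap_id[of i A c] z(3) c by simp
  then have 2: "T.supports (insert c A) (trho i z)"
    using T.supports_act[OF 1, of ?s] swap by simp
  have "insert i A \<inter> insert c A = A" using c by auto
  then show ?thesis using T.supports_Int[OF 1 2] z(2) by simp
qed

section \<open>Equivariant maps into standard representations\<close>

text \<open>Equivariance is demanded only under \<open>fixing C\<close> and only on
  \<open>N\<close>, since maps are built for a small group first and repaired later. Both actions
  are parameters because maps run from abstract to standard representations, back, and between
  subspaces of one representation.\<close>

definition hom_on ::
  "('k::field ratfun \<Rightarrow> 'v::ab_group_add \<Rightarrow> 'v) \<Rightarrow> (nat perm \<Rightarrow> 'v \<Rightarrow> 'v) \<Rightarrow>
   ('k ratfun \<Rightarrow> 'w::ab_group_add \<Rightarrow> 'w) \<Rightarrow> (nat perm \<Rightarrow> 'w \<Rightarrow> 'w) \<Rightarrow>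
   nat set \<Rightarrow> 'v set \<Rightarrow> ('v \<Rightarrow> 'w) \<Rightarrow> bool" where
  "hom_on s1 a1 s2 a2 C N g \<longleftrightarrow> (\<forall>x\<in>N. \<forall>y\<in>N. g (x + y) = g x + g y) \<and>
     (\<forall>c. \<forall>x\<in>N. g (s1 c x) = s2 c (g x)) \<and> (\<forall>\<sigma>\<in>fixing C. \<forall>x\<in>N. g (a1 \<sigma> x) = a2 \<sigma> (g x))"

lemma hom_onD:
  assumes "hom_on s1 a1 s2 a2 C N g"
  shows "x \<in> N \<Longrightarrow> y \<in> N \<Longrightarrow> g (x + y) = g x + g y" "x \<in> N \<Longrightarrow> g (s1 c x) = s2 c (g x)"
    "x \<in> N \<Longrightarrow> \<sigma> \<in> fixing C \<Longrightarrow> g (a1 \<sigma> x) = a2 \<sigma> (g x)"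
  using assms by (auto simp: hom_on_def)

lemma hom_on_mono: "hom_on s1 a1 s2 a2 C N g \<Longrightarrow> C \<subseteq> C' \<Longrightarrow> N' \<subseteq> N \<Longrightarrow> hom_on s1 a1 s2 a2 C' N' g"
  unfolding hom_on_def using fixing_mono by blast

lemma hom_on_cong: "hom_on s1 a1 s2 a2 C N g \<Longrightarrow> (\<And>x. x \<in> N \<Longrightarrow> h x = g x) \<Longrightarrow>
   (\<And>x y. x \<in> N \<Longrightarrow> y \<in> N \<Longrightarrow> x + y \<in> N) \<Longrightarrow> (\<And>c x. x \<in> N \<Longrightarrow> s1 c x \<in> N) \<Longrightarrow>
   (\<And>\<sigma> x. \<sigma> \<in> fixing C \<Longrightarrow> x \<in> N \<Longrightarrow> a1 \<sigma> x \<in> N) \<Longrightarrow> hom_on s1 a1 s2 a2 C N h"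
  by (simp add: hom_on_def)

context semirep
begin

definition stab :: "nat set \<Rightarrow> 'v set \<Rightarrow> bool" where
  "stab C N \<longleftrightarrow> subspace N \<and> (\<forall>\<sigma>\<in>fixing C. \<forall>x\<in>N. act \<sigma> x \<in> N)"

lemma stab_subspace: "stab C N \<Longrightarrow> subspace N"
  by (simp add: stab_def)

lemma stab_act: "stab C N \<Longrightarrow> \<sigma> \<in> fixing C \<Longrightarrow> x \<in> N \<Longrightarrow> act \<sigma> x \<in> N"
  by (simp add: stab_def)

lemma stab_mono: "stab C N \<Longrightarrow> C \<subseteq> C' \<Longrightarrow> stab C' N"
  unfolding stab_def using fixing_mono by blast

abbreviation thom :: "nat set \<Rightarrow> 'v set \<Rightarrow> ('v \<Rightarrow> ('i \<times> nat set \<Rightarrow>\<^sub>0 'k ratfun)) \<Rightarrow> bool" where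
  "thom \<equiv> hom_on scale act tscale tact"

lemma thom_supports:
  assumes "thom C N g" "x \<in> N" "supports A x"
  shows "T.supports (C \<union> A) (g x)"
  unfolding T.supports_def
proof
  fix \<sigma> assume "\<sigma> \<in> fixing (C \<union> A)"
  then have "\<sigma> \<in> fixing C" "act \<sigma> x = x" using supportsD[OF assms(3)] by (simp_all add: fixing_Un)
  then show "tact \<sigma> (g x) = g x" using hom_onD(3)[OF assms(1,2)] by metis
qed

end

locale smooth_semirep = semirep scale act
  for scale :: "'k::field ratfun \<Rightarrow> 'v::ab_group_add \<Rightarrow> 'v" (infixr \<open>*s\<close> 75)
    and act :: "nat perm \<Rightarrow> 'v \<Rightarrow> 'v" +
  assumes smooth: "\<exists>A. finite A \<and> supports A x"
begin

text \<open>One index \<open>i\<close> is removed from the set that the group has to fix. The new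
  map is the conjugate of \<open>trho i\<close> after \<open>g\<close> by the transposition of
  \<open>i\<close> with an index \<open>c\<close> that is fresh for the argument: the role of
  \<open>i\<close> is played by an index that the argument does not see. The formula for
  \<open>h\<close> is exported because both uses compute with it.\<close>

lemma lift_core:
  fixes g :: "'v \<Rightarrow> ('i \<times> nat set \<Rightarrow>\<^sub>0 'k ratfun)"
  assumes g: "thom (insert i C) N g" and N: "stab C N" and C: "finite C" "i \<notin> C"
    and G: "perm_closed G" "g ` N \<subseteq> TW G"
  obtains h where "thom C N h" "h ` N \<subseteq> TW G"
    "\<And>x c A. x \<in> N \<Longrightarrow> supports A x \<Longrightarrow> finite A \<Longrightarrow> c \<notin> A \<Longrightarrow> c \<notin> insert i C \<Longrightarrow>
       h x = tact \<langle>i \<leftrightarrow> c\<rangle> (trho i (g (act \<langle>i \<leftrightarrow> c\<rangle> x)))"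
proof -
  define F where "F c x = tact \<langle>i \<leftrightarrow> c\<rangle> (trho i (g (act \<langle>i \<leftrightarrow> c\<rangle> x)))" for c x
  have sw: "\<langle>i \<leftrightarrow> c\<rangle> \<in> fixing C" if "c \<notin> insert i C" for c
    using that C by (intro swap_in_fixing) auto
  \<comment> \<open>On a support of \<open>x\<close>, exchanging \<open>i\<close> with
    \<open>c'\<close> equals exchanging \<open>i\<close> with \<open>c\<close> followed by
    \<open>c\<close> with \<open>c'\<close>. The second transposition commutes with \<open>g\<close>
    and \<open>trho i\<close>, as it fixes \<open>i\<close> and \<open>C\<close>, and is absorbed by
    the outer one on a support of the value, which \<open>trho i\<close> has freed of
    \<open>i\<close>.\<close>
  have indep: "F c' x = F c x"
    if x: "x \<in> N" "supports A x" "finite A" and c: "c \<notin> A" "c \<notin> insert i C"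
      and c': "c' \<notin> A" "c' \<notin> insert i C" for x A c c'
  proof (cases "c = c'")
    case ne: False
    let ?y = "act \<langle>i \<leftrightarrow> c\<rangle> x"
    let ?z = "trho i (g ?y)"
    let ?E = "(C \<union> img \<langle>i \<leftrightarrow> c\<rangle> A) - {i}"
    have y: "?y \<in> N" using N sw[OF c(2)] x(1) by (rule stab_act)
    have "T.supports (insert i C \<union> img \<langle>i \<leftrightarrow> c\<rangle> A) (g ?y)"
      by (rule thom_supports[OF g y supports_act[OF x(2)]])
    moreover have "insert i C \<union> img \<langle>i \<leftrightarrow> c\<rangle> A = insert i ?E" by auto
    ultimately have z: "T.supports ?E ?z"
      using trho_supports[of i ?E "g ?y" G] G y C x(3) by auto
    have "act \<langle>i \<leftrightarrow> c'\<rangle> x = act (\<langle>c \<leftrightarrow> c'\<rangle> * \<langle>i \<leftrightarrow> c\<rangle>) x"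
    proof (rule act_cong_supports[OF x(2)])
      fix j assume "j \<in> A"
      then show "\<langle>i \<leftrightarrow> c'\<rangle> \<langle>$\<rangle> j = (\<langle>c \<leftrightarrow> c'\<rangle> * \<langle>i \<leftrightarrow> c\<rangle>) \<langle>$\<rangle> j"
        using c c' by (cases "j = i"; cases "j = c"; cases "j = c'") (auto simp: apply_times)
    qed
    then have "F c' x = tact \<langle>i \<leftrightarrow> c'\<rangle> (trho i (g (act \<langle>c \<leftrightarrow> c'\<rangle> ?y)))"
      by (simp add: F_def act_mult)
    also have "g (act \<langle>c \<leftrightarrow> c'\<rangle> ?y) = tact \<langle>c \<leftrightarrow> c'\<rangle> (g ?y)"
      using c c' by (intro hom_onD(3)[OF g y] swap_in_fixing) auto
    also have "trho i (tact \<langle>c \<leftrightarrow> c'\<rangle> (g ?y)) = tact \<langle>c \<leftrightarrow> c'\<rangle> ?z"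
      using c c' by (intro trho_act) auto
    also have "tact \<langle>i \<leftrightarrow> c'\<rangle> (tact \<langle>c \<leftrightarrow> c'\<rangle> ?z) = tact \<langle>i \<leftrightarrow> c\<rangle> ?z"
      unfolding T.act_mult[symmetric]
    proof (rule T.act_cong_supports[OF z])
      fix j assume "j \<in> ?E"
      moreover have "c' \<notin> img \<langle>i \<leftrightarrow> c\<rangle> A"
        using in_img_iff[of "\<langle>i \<leftrightarrow> c\<rangle>" c' A] ne c' by auto
      ultimately have "j \<noteq> i" "j \<noteq> c'" using c' by auto
      then show "(\<langle>i \<leftrightarrow> c'\<rangle> * \<langle>c \<leftrightarrow> c'\<rangle>) \<langle>$\<rangle> j = \<langle>i \<leftrightarrow> c\<rangle> \<langle>$\<rangle> j"
        using c by (cases "j = c") (auto simp: apply_times)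
    qed
    finally show ?thesis by (simp add: F_def)
  qed simp
  define fr where "fr x = (SOME c. c \<notin> insert i C \<and> (\<exists>A. finite A \<and> supports A x \<and> c \<notin> A))" for x
  have fr: "fr x \<notin> insert i C \<and> (\<exists>A. finite A \<and> supports A x \<and> fr x \<notin> A)" for x
    unfolding fr_def
  proof (rule someI_ex)
    obtain A where A: "finite A" "supports A x" using smooth by blast
    obtain c where "c \<notin> insert i C \<union> A" using ex_fresh[of "insert i C \<union> A"] A C by auto
    then show "\<exists>c. c \<notin> insert i C \<and> (\<exists>A. finite A \<and> supports A x \<and> c \<notin> A)" using A by blast
  qed
  define h where "h x = F (fr x) x" for x
  have h: "h x = F c x" if "x \<in> N" "supports A x" "finite A" "c \<notin> A" "c \<notin> insert i C" for x c A
  proof -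
    obtain A' where A': "finite A'" "supports A' x" "fr x \<notin> A'" using fr by blast
    show ?thesis unfolding h_def
      by (rule indep[OF that(1) supports_Int[OF that(2) A'(2)]]) (use that A' fr in auto)
  qed
  have FTW: "F c x \<in> TW G" if "x \<in> N" "c \<notin> insert i C" for c x
    unfolding F_def using stab_act[OF N sw[OF that(2)] that(1)] G by (intro tact_TW trho_TW) auto
  have hom: "thom C N h"
    unfolding hom_on_def
  proof (intro conjI ballI allI)
    fix x y assume xy: "x \<in> N" "y \<in> N"
    obtain A where A: "finite A" "supports A x" using smooth by blast
    obtain B where B: "finite B" "supports B y" using smooth by blast
    obtain c where c: "c \<notin> insert i C \<union> A \<union> B" using ex_fresh[of "insert i C \<union> A \<union> B"] A B C by auto
    have "supports (A \<union> B) (x + y)"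
      using A B by (intro supports_add) (auto intro: supports_mono)
    then have "h (x + y) = F c (x + y)"
      using xy N c A B by (intro h[of _ "A \<union> B"]) (auto simp: stab_def subspace_add)
    also have "\<dots> = F c x + F c y"
      using c xy stab_act[OF N sw] by (simp add: F_def act_add hom_onD(1)[OF g] trho_add T.act_add)
    also have "\<dots> = h x + h y"
      using h[of x A c] h[of y B c] xy A B c by simp
    finally show "h (x + y) = h x + h y" .
  next
    fix a :: "'k ratfun" and x assume x: "x \<in> N"
    obtain A where A: "finite A" "supports A x" using smooth by blast
    obtain B where B: "finite B" "K.supports B a" using K_smooth by blast
    obtain c where c: "c \<notin> insert i C \<union> A \<union> B" using ex_fresh[of "insert i C \<union> A \<union> B"] A B C by auto
    have "supports (A \<union> B) (a *s x)"
      unfolding supports_def using supportsD[OF A(2)] K.supportsD[OF B(2)] by (simp add: fixing_Un act_scale)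
    then have "h (a *s x) = F c (a *s x)"
      using x N c A B by (intro h[of _ "A \<union> B"]) (auto simp: stab_def subspace_scale)
    also have "\<dots> = tact \<langle>i \<leftrightarrow> c\<rangle> (trho i (tscale (perm_ratfun \<langle>i \<leftrightarrow> c\<rangle> a) (g (act \<langle>i \<leftrightarrow> c\<rangle> x))))"
      using c x stab_act[OF N sw] by (simp add: F_def act_scale hom_onD(2)[OF g])
    \<comment> \<open>As \<open>c\<close> avoids a support of \<open>a\<close>, the exchanged scalar
      is free of \<open>i\<close>, and \<open>trho i\<close> is linear for it.\<close>
    also have "\<dots> = tact \<langle>i \<leftrightarrow> c\<rangle> (tscale (perm_ratfun \<langle>i \<leftrightarrow> c\<rangle> a) (trho i (g (act \<langle>i \<leftrightarrow> c\<rangle> x))))"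
      using trho_scale[OF K.supports_act[OF B(2)]] B c by (metis UnCI finite_imageI in_img_swap(1))
    also have "\<dots> = tscale a (F c x)"
      by (simp add: T.act_scale F_def)
    also have "\<dots> = tscale a (h x)"
      using h[of x A c] x A c by simp
    finally show "h (a *s x) = tscale a (h x)" .
  next
    fix \<sigma> x assume \<sigma>: "\<sigma> \<in> fixing C" and x: "x \<in> N"
    obtain A where A: "finite A" "supports A x" using smooth by blast
    let ?B = "insert i C \<union> A \<union> img \<sigma> A \<union> affected \<sigma>"
    obtain c where c: "c \<notin> ?B" using ex_fresh[of ?B] A C by auto
    \<comment> \<open>The permutation \<sigma> may move \<open>i\<close>, but \<open>c\<close> was
      chosen unaffected by it, so the conjugate fixes \<open>i\<close> and the equivariance of
      \<open>g\<close> applies to it.\<close>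
    let ?t = "\<langle>i \<leftrightarrow> c\<rangle> * \<sigma> * \<langle>i \<leftrightarrow> c\<rangle>"
    have t: "?t \<in> fixing (insert i C)"
    proof -
      have "\<sigma> \<langle>$\<rangle> c = c" using c by (simp add: in_affected)
      moreover have "\<langle>i \<leftrightarrow> c\<rangle> \<langle>$\<rangle> j = j" if "j \<in> C" for j
        using that c C by (intro apply_swap_same) auto
      ultimately show ?thesis using \<sigma> by (simp add: fixing_def apply_times)
    qed
    have y: "act \<langle>i \<leftrightarrow> c\<rangle> x \<in> N" using stab_act[OF N sw x] c by blast
    have "h (act \<sigma> x) = F c (act \<sigma> x)"
      using stab_act[OF N \<sigma> x] supports_act[OF A(2), of \<sigma>] A c by (intro h[of _ "img \<sigma> A"]) auto
    also have "act \<langle>i \<leftrightarrow> c\<rangle> (act \<sigma> x) = act ?t (act \<langle>i \<leftrightarrow> c\<rangle> x)"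
      by (simp add: act_mult)
    then have "F c (act \<sigma> x) = tact \<langle>i \<leftrightarrow> c\<rangle> (trho i (tact ?t (g (act \<langle>i \<leftrightarrow> c\<rangle> x))))"
      using hom_onD(3)[OF g y t] by (simp add: F_def)
    also have "\<dots> = tact \<langle>i \<leftrightarrow> c\<rangle> (tact ?t (trho i (g (act \<langle>i \<leftrightarrow> c\<rangle> x))))"
      by (subst trho_act) (use t in \<open>simp_all only: fixing_insert simp_thms\<close>)
    also have "\<dots> = tact \<sigma> (F c x)"
      by (simp add: T.act_mult F_def)
    also have "\<dots> = tact \<sigma> (h x)"
      using h[of x A c] x A c by simp
    finally show "h (act \<sigma> x) = tact \<sigma> (h x)" .
  qed
  show thesis
  proof (rule that[OF hom])
    show "h ` N \<subseteq> TW G" using FTW fr by (auto simp: h_def)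
  qed (use h in \<open>simp add: F_def\<close>)
qed

text \<open>The indices of \<open>D\<close> are removed one at a time. Where \<open>g\<close> is
  already fully equivariant, every support of the argument supports the value, so after the exchange
  the value is free of \<open>i\<close> and the retraction \<open>trho i\<close> changes
  nothing.\<close>

lemma lift_extend:
  fixes g :: "'v \<Rightarrow> ('i \<times> nat set \<Rightarrow>\<^sub>0 'k ratfun)"
  assumes "finite D" "thom D N g" and N: "stab {} N" "stab {} N0" "N0 \<subseteq> N"
    and G: "perm_closed G" and "g ` N \<subseteq> TW G" "thom {} N0 g"
  shows "\<exists>h. thom {} N h \<and> h ` N \<subseteq> TW G \<and> (\<forall>x\<in>N0. h x = g x)"
  using assms(1,2,7,8)
proof (induction D arbitrary: g rule: finite_induct)
  case (insert i D)
  obtain h where h: "thom D N h" "h ` N \<subseteq> TW G"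
    "\<And>x c A. x \<in> N \<Longrightarrow> supports A x \<Longrightarrow> finite A \<Longrightarrow> c \<notin> A \<Longrightarrow> c \<notin> insert i D \<Longrightarrow>
       h x = tact \<langle>i \<leftrightarrow> c\<rangle> (trho i (g (act \<langle>i \<leftrightarrow> c\<rangle> x)))"
    using lift_core[OF insert.prems(1) stab_mono[OF N(1)] insert.hyps(1,2) G insert.prems(2)] by blast
  have eq: "h x = g x" if "x \<in> N0" for x
  proof -
    obtain A where A: "finite A" "supports A x" using smooth by blast
    let ?B = "insert i D \<union> A"
    obtain c where c: "c \<notin> ?B" using ex_fresh[of ?B] A insert.hyps by auto
    have g: "g (act \<langle>i \<leftrightarrow> c\<rangle> x) = tact \<langle>i \<leftrightarrow> c\<rangle> (g x)"
      using hom_onD(3)[OF insert.prems(3) that] by simp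
    have "T.supports A (g x)" using thom_supports[OF insert.prems(3) that A(2)] by simp
    then have "T.supports (img \<langle>i \<leftrightarrow> c\<rangle> A) (tact \<langle>i \<leftrightarrow> c\<rangle> (g x))" by (rule T.supports_act)
    then have "trho i (tact \<langle>i \<leftrightarrow> c\<rangle> (g x)) = tact \<langle>i \<leftrightarrow> c\<rangle> (g x)"
      using A c G insert.prems(2) that N(3) in_img_swap(1)[of i c A]
      by (intro trho_fixed[of _ _ _ G] tact_TW) (auto simp del: apply_swap_eq_iff)
    then show ?thesis using h(3)[of x A c] that N(3) A c g by auto
  qed
  have "thom {} N0 h"
    using hom_on_cong[OF insert.prems(3) eq] N(2) by (auto simp: stab_def subspace_add subspace_scale)
  from insert.IH[OF h(1,2) this] show ?case using eq by metis
qed auto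

text \<open>Removing an index may kill a coefficient. Scaling \<open>g\<close> beforehand by the
  factor from \<open>rho_nonzero\<close> prevents this; \<open>x\<close> has a support off
  \<open>D\<close> and \<open>S\<close> avoids \<open>D\<close>, so the transposition fixes both and
  \<open>trho i\<close> keeps the component at \<open>S\<close>.\<close>

lemma lift_nonzero:
  fixes g :: "'v \<Rightarrow> ('i \<times> nat set \<Rightarrow>\<^sub>0 'k ratfun)"
  assumes "finite D" "thom D N g" and N: "stab {} N" "x \<in> N" "supports A x" "finite A"
    and G: "perm_closed G" and "g ` N \<subseteq> TW G" "Poly_Mapping.lookup (g x) (b, S) \<noteq> 0"
      "A \<inter> D = {}" "S \<inter> D = {}"
  shows "\<exists>h. thom {} N h \<and> h ` N \<subseteq> TW G \<and> Poly_Mapping.lookup (h x) (b, S) \<noteq> 0"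
  using assms(1,2,8-11)
proof (induction D arbitrary: g rule: finite_induct)
  case (insert i D)
  obtain a where a: "\<And>\<sigma>. \<sigma> \<langle>$\<rangle> i = i \<Longrightarrow> perm_ratfun \<sigma> a = a" "rho i (a * Poly_Mapping.lookup (g x) (b, S)) \<noteq> 0"
    using rho_nonzero[OF insert.prems(3)] by blast
  let ?g = "\<lambda>x. tscale a (g x)"
  have g: "thom (insert i D) N ?g"
    using insert.prems(1) a(1) by (auto simp: hom_on_def T.scale_right_distrib T.act_scale fixing_insert mult.commute)
  have "?g ` N \<subseteq> TW G" using insert.prems(2) T.subspace_scale[OF subspace_TW] by blast
  then obtain h where h: "thom D N h" "h ` N \<subseteq> TW G"
    "\<And>x c A. x \<in> N \<Longrightarrow> supports A x \<Longrightarrow> finite A \<Longrightarrow> c \<notin> A \<Longrightarrow> c \<notin> insert i D \<Longrightarrow>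
       h x = tact \<langle>i \<leftrightarrow> c\<rangle> (trho i (?g (act \<langle>i \<leftrightarrow> c\<rangle> x)))"
    using lift_core[OF g stab_mono[OF N(1)] insert.hyps(1,2) G] by blast
  have "finite S" using TW_finite[OF G, of "g x" b S] insert.prems(2,3) N(2) by (auto simp: in_keys_iff)
  then obtain c where c: "c \<notin> insert i D \<union> A \<union> S" using ex_fresh[of "insert i D \<union> A \<union> S"] N insert.hyps by auto
  have "act \<langle>i \<leftrightarrow> c\<rangle> x = x"
    using insert.prems(4) c by (intro supportsD[OF N(3)] swap_in_fixing) auto
  then have "h x = tact \<langle>i \<leftrightarrow> c\<rangle> (trho i (?g x))" using h(3)[OF N(2,3,4), of c] c by simp
  moreover have "img \<langle>i \<leftrightarrow> c\<rangle> S = S" using c insert.prems(5) by (intro img_swap_id) auto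
  ultimately have "Poly_Mapping.lookup (h x) (b, S) \<noteq> 0"
    using a(2) insert.prems(5) by simp
  from insert.IH[OF h(1,2) this] show ?case using insert.prems by auto
qed auto

end

text \<open>The trivial label in \<open>unit\<close> gives these index sets the same form as those
  of larger sums; for empty \<open>C\<close> the space \<open>TW (Gset C n)\<close> is a copy of
  \<open>Iobj n\<close>.\<close>

definition Gset :: "nat set \<Rightarrow> nat \<Rightarrow> (unit \<times> nat set) set" where
  "Gset C n = {(u, S). finite S \<and> card S = n \<and> S \<inter> C = {}}"

lemma Gset_imgE:
  assumes "(u, S) \<in> Gset C (card B)" "finite B" "B \<inter> C = {}"
  obtains \<sigma> where "\<sigma> \<in> fixing C" "S = img \<sigma> B"
  using assms ex_perm_onto[of B S C] by (auto simp: Gset_def)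

lemma img_Gset: "\<sigma> \<in> fixing C \<Longrightarrow> (u, S) \<in> Gset C n \<Longrightarrow> (u', img \<sigma> S) \<in> Gset C n"
  using img_fixing_Int[of \<sigma> C S] by (auto simp: Gset_def)

lemma perm_closed_Gset: "perm_closed (Gset {} n)"
  by (auto simp: perm_closed_def Gset_def)

section \<open>Invariant generators\<close>

context semirep
begin

text \<open>The stabiliser is setwise: the translates of \<open>x\<close> then depend only on the
  image of \<open>B\<close>, see \<open>invar_eq\<close>, so for empty \<open>C\<close> and finite
  \<open>B\<close> such an \<open>x\<close> amounts to a map from
  \<open>Iobj (card B)\<close>.\<close>

definition invar :: "nat set \<Rightarrow> nat set \<Rightarrow> 'v \<Rightarrow> bool" where
  "invar C B x \<longleftrightarrow> (\<forall>\<sigma>\<in>fixing C. img \<sigma> B = B \<longrightarrow> act \<sigma> x = x)"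

lemma invar_supports: "invar C B x \<Longrightarrow> supports (C \<union> B) x"
  unfolding supports_def
proof
  fix \<sigma> assume "invar C B x" "\<sigma> \<in> fixing (C \<union> B)"
  then show "act \<sigma> x = x"
    unfolding fixing_Un invar_def using img_fixing[of \<sigma> B B] by blast
qed

lemma invar_act:
  assumes "invar C B x" "\<sigma> \<in> fixing C"
  shows "invar C (img \<sigma> B) (act \<sigma> x)"
  unfolding invar_def
proof (intro ballI impI)
  fix \<tau> assume \<tau>: "\<tau> \<in> fixing C" "img \<tau> (img \<sigma> B) = img \<sigma> B"
  let ?\<rho> = "inverse \<sigma> * \<tau> * \<sigma>"
  have "?\<rho> \<in> fixing C" using \<tau>(1) assms(2) by (intro mult_in_fixing inverse_in_fixing)
  moreover have "img ?\<rho> B = B" using \<tau>(2) by (simp only: img_mult img_inverse)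
  ultimately have "act ?\<rho> x = x" using assms(1) by (simp add: invar_def)
  then show "act \<tau> (act \<sigma> x) = act \<sigma> x" by (metis act_inverse(1) act_mult)
qed

text \<open>Points of \<open>B\<close> that enter \<open>C'\<close> are fixed by the smaller group
  anyway, so only the remaining ones count. This is the mechanism by which sizes drop.\<close>

lemma invar_mono:
  assumes "invar C B x" "C \<subseteq> C'"
  shows "invar C' (B - C') x"
  unfolding invar_def
proof (intro ballI impI)
  fix \<sigma> assume \<sigma>: "\<sigma> \<in> fixing C'" "img \<sigma> (B - C') = B - C'"
  have "img \<sigma> B = img \<sigma> (B \<inter> C') \<union> img \<sigma> (B - C')" by (simp only: img_Un[symmetric] Int_Diff_Un)
  also have "img \<sigma> (B \<inter> C') = B \<inter> C'" using \<sigma>(1) by (rule img_fixing) blast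
  finally have "img \<sigma> B = B" using \<sigma>(2) by blast
  then show "act \<sigma> x = x" using assms(1) \<sigma>(1) fixing_mono[OF assms(2)] unfolding invar_def by blast
qed

lemma invar_eq:
  assumes "invar C B x" "\<sigma> \<in> fixing C" "\<tau> \<in> fixing C" "img \<sigma> B = img \<tau> B"
  shows "act \<sigma> x = act \<tau> x"
proof -
  have "inverse \<tau> * \<sigma> \<in> fixing C" using assms by (intro mult_in_fixing inverse_in_fixing)
  moreover have "img (inverse \<tau> * \<sigma>) B = B" by (simp only: img_mult assms(4) img_inverse)
  ultimately have "act (inverse \<tau> * \<sigma>) x = x" using assms(1) by (simp add: invar_def)
  then show ?thesis by (metis act_inverse(1) act_mult)
qed

section \<open>Orbits and the subrepresentations they generate\<close>

definition orb :: "nat set \<Rightarrow> 'v set \<Rightarrow> 'v set" where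
  "orb C Z = {act \<sigma> z | \<sigma> z. \<sigma> \<in> fixing C \<and> z \<in> Z}"

abbreviation genset :: "nat set \<Rightarrow> 'v set \<Rightarrow> 'v set" where
  "genset C Z \<equiv> span (orb C Z)"

lemma orbI: "\<sigma> \<in> fixing C \<Longrightarrow> z \<in> Z \<Longrightarrow> act \<sigma> z \<in> orb C Z"
  by (auto simp: orb_def)

lemma orb_base: "Z \<subseteq> orb C Z"
  unfolding orb_def by (metis (mono_tags, lifting) act_one mem_Collect_eq one_in_fixing subsetI)

lemma genset_base: "z \<in> Z \<Longrightarrow> z \<in> genset C Z"
  using orb_base span_base by blast

lemma orb_Un: "orb C (Z \<union> Z') = orb C Z \<union> orb C Z'"
  by (auto simp: orb_def)

lemma orb_mono: "Z \<subseteq> Z' \<Longrightarrow> orb C Z \<subseteq> orb C Z'"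
  by (auto simp: orb_def)

lemma orb_empty [simp]: "orb C {} = {}"
  by (simp add: orb_def)

lemma span_act:
  assumes "\<And>y. y \<in> X \<Longrightarrow> act \<sigma> y \<in> span Y" "x \<in> span X"
  shows "act \<sigma> x \<in> span Y"
  using assms(2)
proof (induction x rule: span_induct_alt)
  case (step c y z)
  then show ?case using assms(1) by (simp add: act_add act_scale span_add span_scale)
qed (simp add: span_zero)

lemma stab_span: "(\<And>\<sigma> x. \<sigma> \<in> fixing C \<Longrightarrow> x \<in> X \<Longrightarrow> act \<sigma> x \<in> span X) \<Longrightarrow> stab C (span X)"
  unfolding stab_def using span_act by blast

lemma orb_act: "\<sigma> \<in> fixing C \<Longrightarrow> x \<in> orb C Z \<Longrightarrow> act \<sigma> x \<in> orb C Z"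
  unfolding orb_def using mult_in_fixing by (clarsimp simp flip: act_mult) blast

lemma stab_genset: "stab C (genset C Z)"
  by (intro stab_span span_base orb_act)

lemma genset_minimal: "stab C N \<Longrightarrow> Z \<subseteq> N \<Longrightarrow> genset C Z \<subseteq> N"
  by (rule span_minimal) (auto simp: orb_def stab_def)

lemma stab_sum: "stab C N \<Longrightarrow> stab C D \<Longrightarrow> stab C (span (N \<union> D))"
  by (rule stab_span) (auto simp: stab_def intro: span_base)

lemma stab_zero [simp]: "stab C {0}"
  by (simp add: stab_def)

lemma span_absorb: "span (A \<union> span B) = span (A \<union> B)"
proof (rule antisym)
  show "span (A \<union> span B) \<subseteq> span (A \<union> B)"
    by (intro span_minimal) (auto intro: span_base span_mono[THEN subsetD])
  show "span (A \<union> B) \<subseteq> span (A \<union> span B)"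
    by (intro span_mono) (auto intro: span_base)
qed

lemma span_Un_cong: "span A = span A' \<Longrightarrow> span (A \<union> B) = span (A' \<union> B)"
  by (metis span_absorb Un_commute)

lemma subspace_span_Un:
  assumes "subspace N" "subspace D"
  shows "x \<in> span (N \<union> D) \<longleftrightarrow> (\<exists>n\<in>N. \<exists>d\<in>D. x = n + d)"
  using assms by (auto simp: span_Un span_eq_iff[THEN iffD2])

lemma finite_support_span:
  assumes "x \<in> span (N \<union> f ` I)"
  shows "\<exists>F. finite F \<and> F \<subseteq> I \<and> x \<in> span (N \<union> f ` F)"
  using assms
proof (induction x rule: span_induct_alt)
  case base show ?case by (intro exI[of _ "{}"]) (simp add: span_zero)
next
  case (step c x y)
  then obtain F where F: "finite F" "F \<subseteq> I" "y \<in> span (N \<union> f ` F)" by blast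
  from step.hyps consider "x \<in> N" | i where "i \<in> I" "x = f i" by blast
  then show ?case
  proof cases
    case 1
    then show ?thesis using F by (intro exI[of _ F]) (auto intro: span_add span_scale span_base)
  next
    case 2
    have "y \<in> span (N \<union> f ` insert i F)" using F(3) span_mono[of "N \<union> f ` F" "N \<union> f ` insert i F"] by blast
    then show ?thesis using F 2 by (intro exI[of _ "insert i F"]) (auto intro!: span_add span_scale intro: span_base)
  qed
qed

text \<open>\<open>m\<close> is a size of \<open>z\<close> relative to the group
  \<open>fixing C\<close>. It is a relation and not a function: a vector may have several sizes, and
  zero has all of them when \<open>C\<close> is finite.\<close>

definition lev :: "nat set \<Rightarrow> nat \<Rightarrow> 'v \<Rightarrow> bool" where
  "lev C m z \<longleftrightarrow> (\<exists>B. finite B \<and> B \<inter> C = {} \<and> card B = m \<and> invar C B z)"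

text \<open>The translates of \<open>z\<close> under \<open>fixing C\<close> are indexed by the
  images of \<open>B\<close>. Images with the same trace \<open>A\<close> on \<open>C'\<close>
  belong to one orbit of \<open>fixing C'\<close>, since their remaining points can be permuted
  freely. A trace lowers the size by its cardinality, so only the orbit with empty trace keeps the
  full size; \<open>z0\<close> represents it and \<open>Z'\<close> the others.\<close>

lemma refine:
  assumes C: "finite C'" "C \<subseteq> C'" and B: "finite B" "B \<inter> C = {}" and z: "invar C B z"
  obtains z0 Z' where "finite Z'" "orb C {z} \<subseteq> orb C' (insert z0 Z')" "insert z0 Z' \<subseteq> orb C {z}"
    "lev C' (card B) z0" "\<And>y. y \<in> Z' \<Longrightarrow> \<exists>m < card B. lev C' m y" "B \<inter> C' = {} \<Longrightarrow> z0 = z"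
    "\<And>\<sigma>. \<sigma> \<in> fixing C \<Longrightarrow> img \<sigma> B \<inter> C' \<noteq> {} \<Longrightarrow> act \<sigma> z \<in> orb C' Z'"
proof -
  define \<A> where "\<A> = {A. A \<subseteq> C' - C \<and> card A \<le> card B}"
  have "\<A> \<subseteq> Pow C'" by (auto simp: \<A>_def)
  then have fin: "finite \<A>" using C(1) by (simp add: finite_subset)
  \<comment> \<open>A trace is realised by padding it with points outside \<open>C'\<close>. If the
    trace is empty and \<open>B\<close> already avoids \<open>C'\<close>, the identity is chosen, so
    that \<open>z\<close> itself survives as \<open>z0\<close>.\<close>
  have "\<exists>\<sigma>\<in>fixing C. img \<sigma> B \<inter> C' = A \<and> (A = {} \<and> B \<inter> C' = {} \<longrightarrow> \<sigma> = 1)" if A: "A \<in> \<A>" for A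
  proof (cases "A = {} \<and> B \<inter> C' = {}")
    case False
    have finA: "finite A" using A C by (auto simp: \<A>_def intro: finite_subset)
    have "infinite (- C')" using C(1) by simp
    then obtain F where F: "F \<subseteq> - C'" "card F = card B - card A" "finite F"
      using infinite_arbitrarily_large by metis
    have "card (A \<union> F) = card B"
      using A F finA by (subst card_Un_disjoint) (auto simp: \<A>_def)
    moreover have "(A \<union> F) \<inter> C = {}" using A F(1) C(2) by (auto simp: \<A>_def)
    ultimately obtain \<sigma> where "\<sigma> \<in> fixing C" "img \<sigma> B = A \<union> F"
      using ex_perm_onto[of B "A \<union> F" C] B F(3) finA by auto
    then show ?thesis using False F by (intro bexI[of _ \<sigma>]) (use A in \<open>auto simp: \<A>_def\<close>)
  next
    case True
    then show ?thesis by (intro bexI[of _ 1]) simp_all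
  qed
  then have "\<forall>A\<in>\<A>. \<exists>\<sigma>. \<sigma> \<in> fixing C \<and> img \<sigma> B \<inter> C' = A \<and> (A = {} \<and> B \<inter> C' = {} \<longrightarrow> \<sigma> = 1)"
    by blast
  from bchoice[OF this] obtain s where s0:
    "\<forall>A\<in>\<A>. s A \<in> fixing C \<and> img (s A) B \<inter> C' = A \<and> (A = {} \<and> B \<inter> C' = {} \<longrightarrow> s A = 1)" ..
  have s: "s A \<in> fixing C" "img (s A) B \<inter> C' = A" "A = {} \<Longrightarrow> B \<inter> C' = {} \<Longrightarrow> s A = 1"
    if "A \<in> \<A>" for A
    using bspec[OF s0 that] by (blast, blast, blast)
  have e: "{} \<in> \<A>" by (simp add: \<A>_def)
  define Z' where "Z' = (\<lambda>A. act (s A) z) ` (\<A> - {{}})"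
  have lev: "lev C' (card B - card A) (act (s A) z)" if "A \<in> \<A>" for A
  proof -
    have "invar C' (img (s A) B - C') (act (s A) z)"
      by (rule invar_mono[OF invar_act[OF z s(1)[OF that]] C(2)])
    moreover have "card (img (s A) B - C') = card B - card A"
      using s(2)[OF that] B(1) card_Diff_subset_Int[of "img (s A) B" C'] by (metis card_img finite_Int finite_img)
    moreover have "finite (img (s A) B - C')" "(img (s A) B - C') \<inter> C' = {}" using B(1) by auto
    ultimately show ?thesis unfolding lev_def by blast
  qed
  \<comment> \<open>\<sigma> and \<open>s A\<close> give images of \<open>B\<close> with the same
    trace; some \<tau> in \<open>fixing C'\<close> matches the parts outside \<open>C'\<close>, and
    invariance turns equality of the images into equality of the translates.\<close>
  have *: "act \<sigma> z \<in> orb C' {act (s A) z} \<and> A \<in> \<A>" if \<sigma>: "\<sigma> \<in> fixing C" and A: "A = img \<sigma> B \<inter> C'" for \<sigma> A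
  proof -
    have "img \<sigma> B \<inter> C = {}" using img_fixing_Int[OF \<sigma>, of B] B by simp
    moreover have "card A \<le> card B"
      using A B by (metis card_img card_mono finite_img inf_le1)
    ultimately have mem: "A \<in> \<A>" using A by (auto simp: \<A>_def)
    have "card (img (s A) B - C') = card (img \<sigma> B - C')"
      using s(2)[OF mem] A B(1) by (simp add: card_Diff_subset_Int)
    then have "\<exists>\<tau>\<in>fixing C'. img \<tau> (img (s A) B - C') = img \<sigma> B - C'"
      by (intro ex_perm_onto) (use B(1) in \<open>simp_all add: Diff_disjoint Int_commute\<close>)
    then obtain \<tau> where \<tau>: "\<tau> \<in> fixing C'" "img \<tau> (img (s A) B - C') = img \<sigma> B - C'" by blast
    have "img (\<tau> * s A) B = img \<tau> (img (s A) B \<inter> C') \<union> img \<tau> (img (s A) B - C')"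
      by (simp only: img_mult img_Un[symmetric] Int_Diff_Un)
    also have "img \<tau> (img (s A) B \<inter> C') = A"
      unfolding s(2)[OF mem] by (rule img_fixing[OF \<tau>(1)]) (unfold A, rule Int_lower2)
    also have "img \<tau> (img (s A) B - C') = img \<sigma> B - C'" by (rule \<tau>(2))
    also have "A \<union> (img \<sigma> B - C') = img \<sigma> B" unfolding A by (rule Int_Diff_Un)
    finally have "img (\<tau> * s A) B = img \<sigma> B" .
    moreover have "\<tau> * s A \<in> fixing C"
      using \<tau>(1) s(1)[OF mem] fixing_mono[OF C(2)] by (intro mult_in_fixing) auto
    ultimately have "act \<sigma> z = act \<tau> (act (s A) z)"
      using invar_eq[OF z \<sigma>] by (metis act_mult)
    then show ?thesis using \<tau>(1) mem by (auto simp: orb_def)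
  qed
  show thesis
  proof (rule that[of Z' "act (s {}) z"])
    show "finite Z'" using fin by (simp add: Z'_def)
    show "orb C {z} \<subseteq> orb C' (insert (act (s {}) z) Z')"
    proof
      fix y assume "y \<in> orb C {z}"
      then obtain \<sigma> where \<sigma>: "\<sigma> \<in> fixing C" "y = act \<sigma> z" by (auto simp: orb_def)
      let ?A = "img \<sigma> B \<inter> C'"
      have 1: "y \<in> orb C' {act (s ?A) z}" "?A \<in> \<A>" using *[OF \<sigma>(1) refl] \<sigma>(2) by simp_all
      then have "act (s ?A) z \<in> insert (act (s {}) z) Z'" by (cases "?A = {}") (auto simp: Z'_def)
      then show "y \<in> orb C' (insert (act (s {}) z) Z')" using 1(1) by (auto simp: orb_def)
    qed
    show "insert (act (s {}) z) Z' \<subseteq> orb C {z}"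
      using s(1) e by (auto simp: Z'_def intro!: orbI)
    show "lev C' (card B) (act (s {}) z)" using lev[OF e] by simp
    show "\<exists>m < card B. lev C' m y" if y: "y \<in> Z'" for y
    proof -
      obtain A where A: "A \<in> \<A>" "A \<noteq> {}" "y = act (s A) z" using y by (auto simp: Z'_def)
      have "finite A" using A C by (auto simp: \<A>_def intro: finite_subset)
      then have "card A > 0" using A(2) by (simp add: card_gt_0_iff)
      then have "card B - card A < card B" using A(1) by (auto simp: \<A>_def)
      then show ?thesis using lev[OF A(1)] A(3) by blast
    qed
    show "act (s {}) z = z" if "B \<inter> C' = {}" using s(3)[OF e refl that] by simp
    show "act \<sigma> z \<in> orb C' Z'" if \<sigma>: "\<sigma> \<in> fixing C" "img \<sigma> B \<inter> C' \<noteq> {}" for \<sigma>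
    proof -
      have "act (s (img \<sigma> B \<inter> C')) z \<in> Z'"
        using *[OF \<sigma>(1) refl] \<sigma>(2) by (auto simp: Z'_def)
      then show ?thesis using *[OF \<sigma>(1) refl] by (auto simp: orb_def)
    qed
  qed
qed

text \<open>Traces of the powers of a monomial \<open>\<theta>\<close> with distinct conjugates, combined by Lagrange interpolation.\<close>

lemma hilbert90:
  assumes X: "finite X" and x: "supports X x"
  shows "x \<in> span {y. invar {} X y \<and> y \<in> genset {} {x}}"
proof -
  \<comment> \<open>The permutations moving only points of \<open>X\<close>: a finite group, over
    which traces can be formed.\<close>
  define H where "H = fixing (- X)"
  have finH: "finite H"
  proof (rule finite_imageD)
    show "finite ((\<lambda>\<sigma>. restrict (apply \<sigma>) X) ` H)"
    proof (rule finite_subset)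
      show "(\<lambda>\<sigma>. restrict (apply \<sigma>) X) ` H \<subseteq> X \<rightarrow>\<^sub>E X"
      proof (clarsimp simp: H_def)
        fix \<sigma> i assume "\<sigma> \<in> fixing (- X)" "i \<in> X"
        then show "\<sigma> \<langle>$\<rangle> i \<in> X"
          using apply_inj[of \<sigma> "\<sigma> \<langle>$\<rangle> i" i] by (auto simp: fixing_def)
      qed
      show "finite (X \<rightarrow>\<^sub>E X)" using X by (intro finite_PiE) auto
    qed
    show "inj_on (\<lambda>\<sigma>. restrict (apply \<sigma>) X) H"
    proof (rule inj_onI, rule perm_eqI)
      fix \<sigma> \<tau> i assume *: "\<sigma> \<in> H" "\<tau> \<in> H" "restrict (apply \<sigma>) X = restrict (apply \<tau>) X"
      show "\<sigma> \<langle>$\<rangle> i = \<tau> \<langle>$\<rangle> i"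
      proof (cases "i \<in> X")
        case True then show ?thesis using fun_cong[OF *(3), of i] by simp
      next
        case False then show ?thesis using *(1,2) by (simp add: H_def fixing_def)
      qed
    qed
  qed
  have imgH: "img \<sigma> X = X" if "\<sigma> \<in> H" for \<sigma>
  proof -
    have "img \<sigma> (- X) = - X" using that img_fixing[OF _ subset_refl] by (simp add: H_def)
    then show ?thesis by (metis bij_apply bij_image_Compl_eq double_complement)
  qed
  \<comment> \<open>The exponent of each variable is its own index, so the exponents on
    \<open>X\<close> are distinct and no element of \<open>H\<close> but the identity fixes the
    monomial. The exponent 0 does no harm, as at most one index in \<open>X\<close> has it.\<close>
  define m where "m = (\<Sum>i\<in>X. Poly_Mapping.single i i)"
  have lm: "Poly_Mapping.lookup m i = (if i \<in> X then i else 0)" for i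
    using X by (simp add: m_def lookup_sum lookup_single when_def)
  define \<theta> :: "'k ratfun" where "\<theta> = Fract (Poly_Mapping.single m 1) 1"
  have act\<theta>: "perm_ratfun \<sigma> \<theta> = Fract (Poly_Mapping.single (perm_monom \<sigma> m) 1) 1" for \<sigma>
    by (simp add: \<theta>_def perm_ratfun_Fract perm_mpoly_single)
  have dist: "\<sigma> = 1" if \<sigma>: "\<sigma> \<in> H" "perm_ratfun \<sigma> \<theta> = \<theta>" for \<sigma>
  proof (rule perm_eqI)
    fix i
    have "Poly_Mapping.single (perm_monom \<sigma> m) 1 = Poly_Mapping.single m (1 :: 'k)"
      using \<sigma>(2) unfolding act\<theta> unfolding \<theta>_def by (simp add: eq_fract)
    then have "perm_monom \<sigma> m = m"
      by (metis lookup_single_eq lookup_single_not_eq one_neq_zero)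
    then have eq: "Poly_Mapping.lookup m (inverse \<sigma> \<langle>$\<rangle> j) = Poly_Mapping.lookup m j" for j
      by (metis lookup_perm_monom)
    show "\<sigma> \<langle>$\<rangle> i = 1 \<langle>$\<rangle> i"
    proof (cases "i \<in> X")
      case True
      then have "\<sigma> \<langle>$\<rangle> i \<in> X" using imgH[OF \<sigma>(1)] by blast
      then show ?thesis using eq[of "\<sigma> \<langle>$\<rangle> i"] True by (simp add: lm)
    next
      case False then show ?thesis using \<sigma>(1) by (simp add: H_def fixing_def)
    qed
  qed
  \<comment> \<open>A Lagrange polynomial: zero at every conjugate of \<theta> but not at \<theta>,
    so that its coefficients extract the term of the identity from the traces
    \<open>y j\<close>.\<close>
  define P where "P = (\<Prod>\<sigma>\<in>H - {1}. [:- perm_ratfun \<sigma> \<theta>, 1:])"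
  have P0: "poly P (perm_ratfun \<sigma> \<theta>) = 0" if "\<sigma> \<in> H - {1}" for \<sigma>
    unfolding P_def poly_prod using that finH by (intro prod_zero) (auto intro!: bexI[of _ \<sigma>])
  have P1: "poly P \<theta> \<noteq> 0"
    unfolding P_def poly_prod using finH dist by (auto simp: prod_zero_iff)
  define y where "y j = (\<Sum>\<sigma>\<in>H. act \<sigma> (\<theta> ^ j *s x))" for j
  have oneH: "1 \<in> H" by (simp add: H_def)
  have "(\<Sum>j\<le>degree P. (coeff P j / poly P \<theta>) *s y j) =
      (\<Sum>\<sigma>\<in>H. (\<Sum>j\<le>degree P. (coeff P j / poly P \<theta>) * perm_ratfun \<sigma> \<theta> ^ j) *s act \<sigma> x)"
    unfolding y_def scale_sum_right scale_sum_left
    by (subst sum.swap) (simp add: act_scale perm_power)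
  also have "\<dots> = (\<Sum>\<sigma>\<in>H. (poly P (perm_ratfun \<sigma> \<theta>) / poly P \<theta>) *s act \<sigma> x)"
    by (simp add: poly_altdef sum_divide_distrib)
  also have "\<dots> = (\<Sum>\<sigma>\<in>H. if \<sigma> = 1 then x else 0)"
    using P0 P1 by (intro sum.cong) auto
  also have "\<dots> = x" using finH oneH by simp
  finally have sum: "x = (\<Sum>j\<le>degree P. (coeff P j / poly P \<theta>) *s y j)" ..
  have inv\<theta>: "perm_ratfun \<sigma> \<theta> = \<theta>" if "\<sigma> \<in> fixing X" for \<sigma>
  proof -
    have "perm_monom \<sigma> m = m"
    proof (rule poly_mapping_eqI)
      fix i
      have "inverse \<sigma> \<langle>$\<rangle> i \<in> X \<longleftrightarrow> i \<in> X" "i \<in> X \<Longrightarrow> inverse \<sigma> \<langle>$\<rangle> i = i"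
        using that inverse_in_fixing[OF that] apply_inverse_simps(1)[of \<sigma> i] unfolding fixing_def by auto
      then show "Poly_Mapping.lookup (perm_monom \<sigma> m) i = Poly_Mapping.lookup m i" by (simp add: lm)
    qed
    then show ?thesis unfolding act\<theta> by (simp add: \<theta>_def)
  qed
  have "invar {} X (y j)" for j
    unfolding invar_def
  proof (intro ballI impI)
    fix \<tau> assume \<tau>: "img \<tau> X = X"
    \<comment> \<open>On vectors supported by \<open>X\<close> only the restriction of \<tau> to
      \<open>X\<close> matters, and this restriction extends to an element of the finite group
      \<open>H\<close>, by which the trace is reindexed.\<close>
    have "inj_on (apply \<tau>) X" by (rule inj_on_subset[OF inj_perm]) simp
    then obtain \<tau>' where \<tau>': "\<forall>i\<in>X. \<tau>' \<langle>$\<rangle> i = \<tau> \<langle>$\<rangle> i" "\<forall>i. i \<notin> X \<union> img \<tau> X \<longrightarrow> \<tau>' \<langle>$\<rangle> i = i"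
      using perm_extend[of "apply \<tau>" X] X by auto
    have \<tau>'H: "\<tau>' \<in> H" using \<tau>'(2) \<tau> by (auto simp: H_def fixing_def)
    have "act \<tau> (act \<sigma> (\<theta> ^ j *s x)) = act (\<tau>' * \<sigma>) (\<theta> ^ j *s x)" if "\<sigma> \<in> H" for \<sigma>
    proof -
      have "supports X (\<theta> ^ j *s x)"
        using supportsD[OF x] inv\<theta> by (simp add: supports_def act_scale perm_power)
      then have "supports X (act \<sigma> (\<theta> ^ j *s x))" using supports_act imgH[OF that] by metis
      then show ?thesis unfolding act_mult by (rule act_cong_supports) (use \<tau>' in simp)
    qed
    then have "act \<tau> (y j) = (\<Sum>\<sigma>\<in>H. act (\<tau>' * \<sigma>) (\<theta> ^ j *s x))"
      by (simp add: y_def act_sum)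
    also have "\<dots> = y j"
      unfolding y_def
      by (rule sum.reindex_bij_witness[of _ "\<lambda>\<sigma>. inverse \<tau>' * \<sigma>" "\<lambda>\<sigma>. \<tau>' * \<sigma>"])
        (use \<tau>'H in \<open>auto simp: H_def mult.assoc[symmetric] intro!: mult_in_fixing inverse_in_fixing\<close>)
    finally show "act \<tau> (y j) = y j" .
  qed
  moreover have "y j \<in> genset {} {x}" for j
    unfolding y_def act_scale by (intro span_sum span_scale span_base orbI) auto
  ultimately show ?thesis
    by (subst sum, intro span_sum span_scale, intro span_base) simp
qed

section \<open>Linear combinations of orbits\<close>

definition lincomb :: "('w \<Rightarrow> 'v) \<Rightarrow> ('w \<Rightarrow>\<^sub>0 'k ratfun) \<Rightarrow> 'v" where
  "lincomb e z = (\<Sum>w\<in>Poly_Mapping.keys z. Poly_Mapping.lookup z w *s e w)"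

lemma lincomb_superset:
  "finite F \<Longrightarrow> Poly_Mapping.keys z \<subseteq> F \<Longrightarrow> lincomb e z = (\<Sum>w\<in>F. Poly_Mapping.lookup z w *s e w)"
  unfolding lincomb_def by (rule sum.mono_neutral_left) (auto simp: in_keys_iff)

lemma lincomb_add: "lincomb e (z + z') = lincomb e z + lincomb e z'"
proof -
  let ?F = "Poly_Mapping.keys z \<union> Poly_Mapping.keys z'"
  have "lincomb e (z + z') = (\<Sum>w\<in>?F. Poly_Mapping.lookup (z + z') w *s e w)"
    by (rule lincomb_superset) (use Poly_Mapping.keys_add[of z z'] in simp_all)
  then show ?thesis
    by (simp add: lincomb_superset[of ?F] lookup_add scale_left_distrib sum.distrib)
qed

lemma lincomb_scale: "lincomb e (tscale a z) = a *s lincomb e z"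
proof -
  have "Poly_Mapping.keys (tscale a z) \<subseteq> Poly_Mapping.keys z" by (auto simp: in_keys_iff)
  then show ?thesis by (simp add: lincomb_superset[of "Poly_Mapping.keys z"] scale_sum_right)
qed

lemma lincomb_0 [simp]: "lincomb e 0 = 0"
  by (simp add: lincomb_def)

lemma lincomb_minus: "lincomb e (- z) = - lincomb e z"
  using lincomb_add[of e z "- z"] by (simp add: eq_neg_iff_add_eq_0 add.commute)

lemma lincomb_diff: "lincomb e (z - z') = lincomb e z - lincomb e z'"
  using lincomb_add[of e z "- z'"] by (simp add: lincomb_minus)

lemma lincomb_single [simp]: "lincomb e (Poly_Mapping.single w a) = a *s e w"
  by (cases "a = 0") (simp_all add: lincomb_def)

lemma lincomb_in_span: "z \<in> TW G \<Longrightarrow> lincomb e z \<in> span (e ` G)"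
  unfolding lincomb_def by (intro span_sum span_scale span_base) (auto simp: TW_def)

lemma span_lincomb:
  assumes "x \<in> span (e ` G)"
  shows "\<exists>z\<in>TW G. x = lincomb e z"
  using assms
proof (induction x rule: span_induct_alt)
  case base show ?case by (intro bexI[of _ 0]) (simp_all add: TW_iff)
next
  case (step c x y)
  then obtain z w where z: "z \<in> TW G" "y = lincomb e z" "w \<in> G" "x = e w" by blast
  then have "Poly_Mapping.single w c + z \<in> TW G"
    by (auto simp: TW_iff lookup_add lookup_single when_def)
  then show ?case using z by (intro bexI[of _ "Poly_Mapping.single w c + z"]) (simp_all add: lincomb_add)
qed

lemma lincomb_act:
  assumes "\<And>b S. (b, S) \<in> G \<Longrightarrow> e (b, img \<sigma> S) = act \<sigma> (e (b, S))" "z \<in> TW G"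
  shows "lincomb e (tact \<sigma> z) = act \<sigma> (lincomb e z)"
proof -
  have "lincomb e (tact \<sigma> z) =
      (\<Sum>w\<in>Poly_Mapping.keys z. act \<sigma> (Poly_Mapping.lookup z w *s e w))"
    unfolding lincomb_def
  proof (rule sum.reindex_bij_witness[of _ "\<lambda>(b, S). (b, img \<sigma> S)" "\<lambda>(b, S). (b, img (inverse \<sigma>) S)"], goal_cases)
    case (5 w)
    obtain b S where w: "w = (b, S)" by fastforce
    have "(b, img (inverse \<sigma>) S) \<in> G" using 5 assms(2) w by (auto simp: TW_def in_keys_iff)
    then have "e (b, S) = act \<sigma> (e (b, img (inverse \<sigma>) S))" using assms(1) by (metis img_inverse(1))
    then show ?case by (simp add: w act_scale)
  qed (clarsimp simp: in_keys_iff image_image)+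
  then show ?thesis by (simp add: lincomb_def act_sum)
qed

text \<open>For invariant \<open>p\<close> the choice of the permutation is immaterial, by
  \<open>ptrans_eq\<close>; the orbit of \<open>p\<close> thus becomes a family indexed by
  \<open>Gset C (card B)\<close>.\<close>

definition ptrans :: "nat set \<Rightarrow> nat set \<Rightarrow> 'v \<Rightarrow> nat set \<Rightarrow> 'v" where
  "ptrans C B p S = act (SOME \<sigma>. \<sigma> \<in> fixing C \<and> img \<sigma> B = S) p"

lemma ptrans_eq:
  assumes "invar C B p" "\<sigma> \<in> fixing C"
  shows "ptrans C B p (img \<sigma> B) = act \<sigma> p"
proof -
  let ?\<tau> = "SOME \<tau>. \<tau> \<in> fixing C \<and> img \<tau> B = img \<sigma> B"
  have "?\<tau> \<in> fixing C \<and> img ?\<tau> B = img \<sigma> B"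
    by (rule someI[of "\<lambda>\<tau>. \<tau> \<in> fixing C \<and> img \<tau> B = img \<sigma> B" \<sigma>]) (use assms in simp)
  then show ?thesis unfolding ptrans_def using invar_eq[OF assms(1) _ assms(2)] by blast
qed

text \<open>Only \<open>p\<close> itself has to be expressed by the others: by transitivity a
  relation among any translates can be moved so that it involves \<open>p\<close>, see
  \<open>lincomb_indep\<close>.\<close>

definition depends :: "nat set \<Rightarrow> nat set \<Rightarrow> 'v \<Rightarrow> 'v set \<Rightarrow> bool" where
  "depends C B p N \<longleftrightarrow> p \<in> span (N \<union> (\<lambda>\<sigma>. act \<sigma> p) ` {\<sigma>\<in>fixing C. img \<sigma> B \<noteq> B})"

lemma ptrans_image:
  assumes "invar C B p" "finite B" "B \<inter> C = {}"
  shows "(\<lambda>(u, S). ptrans C B p S) ` Gset C (card B) = orb C {p}"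
proof (intro Set.set_eqI iffI)
  fix x assume "x \<in> (\<lambda>(u, S). ptrans C B p S) ` Gset C (card B)"
  then obtain u S where "x = ptrans C B p S" "(u, S) \<in> Gset C (card B)" by auto
  then show "x \<in> orb C {p}"
    using Gset_imgE[OF _ assms(2,3)] ptrans_eq[OF assms(1)] by (metis orbI singletonI)
next
  fix x assume "x \<in> orb C {p}"
  then obtain \<sigma> where \<sigma>: "\<sigma> \<in> fixing C" "x = act \<sigma> p" by (auto simp: orb_def)
  have "((), img \<sigma> B) \<in> Gset C (card B)"
    using img_Gset[OF \<sigma>(1), of "()" B] assms by (simp add: Gset_def)
  then show "x \<in> (\<lambda>(u, S). ptrans C B p S) ` Gset C (card B)"
    using ptrans_eq[OF assms(1) \<sigma>(1)] \<sigma>(2) by force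
qed

lemma ptrans_act:
  assumes "invar C B p" "finite B" "B \<inter> C = {}" "(u, S) \<in> Gset C (card B)" "\<sigma> \<in> fixing C"
  shows "ptrans C B p (img \<sigma> S) = act \<sigma> (ptrans C B p S)"
proof -
  obtain \<tau> where \<tau>: "\<tau> \<in> fixing C" "S = img \<tau> B" using Gset_imgE[OF assms(4,2,3)] .
  have "ptrans C B p (img (\<sigma> * \<tau>) B) = act (\<sigma> * \<tau>) p"
    by (rule ptrans_eq[OF assms(1) mult_in_fixing[OF assms(5) \<tau>(1)]])
  then show ?thesis using ptrans_eq[OF assms(1) \<tau>(1)] \<tau>(2) by (simp only: img_mult act_mult)
qed

text \<open>A nontrivial relation modulo \<open>N\<close> can be solved for a translate of
  \<open>p\<close> with nonzero coefficient. Moving that translate back to \<open>p\<close>, which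
  preserves \<open>N\<close>, expresses \<open>p\<close> by its other translates, the dependency
  that is excluded.\<close>

lemma lincomb_indep:
  assumes N: "stab C N" and p: "invar C B p" "finite B" "B \<inter> C = {}" "\<not> depends C B p N"
    and z: "z \<in> TW (Gset C (card B))" "lincomb (\<lambda>(u, S). ptrans C B p S) z \<in> N"
  shows "z = 0"
proof (rule ccontr)
  let ?e = "\<lambda>(u, S). ptrans C B p S"
  assume "z \<noteq> 0"
  then obtain u S where S: "Poly_Mapping.lookup z (u, S) \<noteq> 0"
    by (metis lookup_zero poly_mapping_eqI surj_pair)
  let ?a = "Poly_Mapping.lookup z (u, S)"
  have G: "(u, S) \<in> Gset C (card B)" using S z(1) by (auto simp: TW_iff)
  obtain \<sigma> where \<sigma>: "\<sigma> \<in> fixing C" "S = img \<sigma> B" using Gset_imgE[OF G p(2,3)] .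
  define z' where "z' = z - Poly_Mapping.single (u, S) ?a"
  let ?O = "(\<lambda>\<tau>. act \<tau> p) ` {\<tau>\<in>fixing C. img \<tau> B \<noteq> S}"
  have "z' \<in> TW (Gset C (card B) - {(u, S)})"
    using z(1) by (auto simp: z'_def TW_iff lookup_minus lookup_single when_def)
  then have "lincomb ?e z' \<in> span (?e ` (Gset C (card B) - {(u, S)}))" by (rule lincomb_in_span)
  also have "?e ` (Gset C (card B) - {(u, S)}) \<subseteq> ?O"
  proof (rule image_subsetI)
    fix w assume w: "w \<in> Gset C (card B) - {(u, S)}"
    obtain u' S' where uS: "w = (u', S')" by (rule prod.exhaust)
    have S': "(u', S') \<in> Gset C (card B)" "S' \<noteq> S" using w uS by auto
    obtain \<tau> where \<tau>: "\<tau> \<in> fixing C" "S' = img \<tau> B" using Gset_imgE[OF S'(1) p(2,3)] .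
    then show "?e w \<in> ?O" using S'(2) ptrans_eq[OF p(1) \<tau>(1)] uS by auto
  qed
  then have "span (?e ` (Gset C (card B) - {(u, S)})) \<subseteq> span (N \<union> ?O)" by (intro span_mono) auto
  finally have "lincomb ?e z' \<in> span (N \<union> ?O)" .
  moreover have "?a *s act \<sigma> p = lincomb ?e z - lincomb ?e z'"
    using ptrans_eq[OF p(1) \<sigma>(1)] \<sigma>(2) by (simp add: z'_def lincomb_diff)
  ultimately have "?a *s act \<sigma> p \<in> span (N \<union> ?O)" using z(2) by (auto intro: span_diff span_base)
  then have "inverse ?a *s ?a *s act \<sigma> p \<in> span (N \<union> ?O)" by (rule span_scale)
  then have "act \<sigma> p \<in> span (N \<union> ?O)" using S by simp
  then have "act (inverse \<sigma>) (act \<sigma> p) \<in> span (N \<union> (\<lambda>\<tau>. act \<tau> p) ` {\<tau>\<in>fixing C. img \<tau> B \<noteq> B})"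
  proof (rule span_act[rotated])
    fix y assume "y \<in> N \<union> ?O"
    then consider "y \<in> N" | \<tau> where "\<tau> \<in> fixing C" "img \<tau> B \<noteq> S" "y = act \<tau> p" by auto
    then have "act (inverse \<sigma>) y \<in> N \<union> (\<lambda>\<tau>. act \<tau> p) ` {\<tau>\<in>fixing C. img \<tau> B \<noteq> B}"
    proof cases
      case 1 then show ?thesis using stab_act[OF N inverse_in_fixing[OF \<sigma>(1)]] by blast
    next
      case 2
      have "img (inverse \<sigma> * \<tau>) B \<noteq> B"
        using 2(2) \<sigma>(2) by (simp only: img_mult img_inverse_eq not_False_eq_True)
      moreover have "inverse \<sigma> * \<tau> \<in> fixing C" using 2(1) \<sigma>(1) by (intro mult_in_fixing inverse_in_fixing)
      ultimately show ?thesis using 2(3) by (auto simp flip: act_mult)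
    qed
    then show "act (inverse \<sigma>) y \<in> span (N \<union> (\<lambda>\<tau>. act \<tau> p) ` {\<tau>\<in>fixing C. img \<tau> B \<noteq> B})"
      by (rule span_base)
  qed
  then show False using p(4) by (simp add: depends_def)
qed

end

section \<open>Complements over a smaller group\<close>

context semirep
begin

definition pr :: "'v set \<Rightarrow> 'v set \<Rightarrow> 'v \<Rightarrow> 'v" where
  "pr N D x = (THE n. n \<in> N \<and> x - n \<in> D)"

lemma pr_eq:
  assumes "subspace N" "subspace D" "N \<inter> D = {0}" "n \<in> N" "x - n \<in> D"
  shows "pr N D x = n"
  unfolding pr_def
proof (rule the_equality)
  fix m assume m: "m \<in> N \<and> x - m \<in> D"
  have "(x - n) - (x - m) \<in> D" using m assms by (blast intro: subspace_diff)
  then have "m - n \<in> D" by simp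
  moreover have "m - n \<in> N" using m assms by (blast intro: subspace_diff)
  ultimately have "m - n \<in> {0}" unfolding assms(3)[symmetric] by blast
  then show "m = n" by simp
qed (use assms in simp)

lemma pr_in:
  assumes "subspace N" "subspace D" "N \<inter> D = {0}" "x \<in> span (N \<union> D)"
  shows "pr N D x \<in> N" "x - pr N D x \<in> D"
proof -
  obtain n d where "n \<in> N" "d \<in> D" "x = n + d"
    using assms subspace_span_Un by blast
  moreover from this have "pr N D x = n" using assms by (intro pr_eq) auto
  ultimately show "pr N D x \<in> N" "x - pr N D x \<in> D" by simp_all
qed

lemma pr_id: "subspace N \<Longrightarrow> subspace D \<Longrightarrow> N \<inter> D = {0} \<Longrightarrow> x \<in> N \<Longrightarrow> pr N D x = x"
  by (rule pr_eq) (simp_all add: subspace_0)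

lemma pr_zero: "subspace N \<Longrightarrow> subspace D \<Longrightarrow> N \<inter> D = {0} \<Longrightarrow> x \<in> D \<Longrightarrow> pr N D x = 0"
  by (rule pr_eq) (simp_all add: subspace_0)

text \<open>Uniqueness of the decomposition turns the stability of both summands into equivariance
  of the projection.\<close>

lemma pr_hom:
  assumes "stab C N" "stab C D" "N \<inter> D = {0}"
  shows "hom_on scale act scale act C (span (N \<union> D)) (pr N D)"
proof -
  have s: "subspace N" "subspace D" using assms by (simp_all add: stab_def)
  note in_N = pr_in(1)[OF s assms(3)] and in_D = pr_in(2)[OF s assms(3)]
  show ?thesis
    unfolding hom_on_def
  proof (intro conjI ballI allI)
    fix x y assume xy: "x \<in> span (N \<union> D)" "y \<in> span (N \<union> D)"
    have "(x - pr N D x) + (y - pr N D y) \<in> D" using in_D xy s by (intro subspace_add)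
    then show "pr N D (x + y) = pr N D x + pr N D y"
      using in_N xy s by (intro pr_eq[OF s assms(3)] subspace_add) (simp_all add: algebra_simps)
  next
    fix c x assume x: "x \<in> span (N \<union> D)"
    have "c *s (x - pr N D x) \<in> D" using in_D x s by (intro subspace_scale)
    then show "pr N D (c *s x) = c *s pr N D x"
      using in_N x s by (intro pr_eq[OF s assms(3)] subspace_scale) (simp_all add: scale_right_diff_distrib)
  next
    fix \<sigma> x assume x: "\<sigma> \<in> fixing C" "x \<in> span (N \<union> D)"
    have "act \<sigma> (x - pr N D x) \<in> D" using in_D x assms by (intro stab_act)
    then show "pr N D (act \<sigma> x) = act \<sigma> (pr N D x)"
      using in_N[OF x(2)] x assms by (intro pr_eq[OF s assms(3)] stab_act[OF assms(1) x(1)]) (simp_all add: act_diff)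
  qed
qed

text \<open>A complement of \<open>N\<close> in its sum with \<open>Q\<close>, stable under some
  smaller group. \<open>Q\<close> need not contain \<open>N\<close>, so that generators can be added
  one by one.\<close>

definition splits :: "nat set \<Rightarrow> 'v set \<Rightarrow> 'v set \<Rightarrow> bool" where
  "splits C N Q \<longleftrightarrow> (\<exists>C' D. finite C' \<and> C \<subseteq> C' \<and> stab C' D \<and> N \<inter> D = {0} \<and> span (N \<union> D) = span (N \<union> Q))"

lemma splits_empty: "finite C \<Longrightarrow> stab C N \<Longrightarrow> splits C N {}"
  unfolding splits_def
proof (intro exI conjI)
  assume "finite C" then show "finite C" .
  assume N: "stab C N"
  then show "N \<inter> {0} = {0}" by (auto simp: stab_def subspace_0)
  show "span (N \<union> {0}) = span (N \<union> {})" by simp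
qed (rule subset_refl stab_zero)+

lemma splits_mono: "splits C' N Q \<Longrightarrow> C \<subseteq> C' \<Longrightarrow> splits C N Q"
  unfolding splits_def by (meson subset_trans)

lemma splits_cong: "splits C N Q \<Longrightarrow> span (N \<union> Q) = span (N \<union> Q') \<Longrightarrow> splits C N Q'"
  by (simp add: splits_def)

text \<open>A complement \<open>D1\<close> of \<open>N\<close> in the first sum and a complement
  \<open>D2\<close> of that sum in the larger one add up to a complement of \<open>N\<close>. Each
  is stable under its own group, so their sum is stable under the group fixing both finite
  sets.\<close>

lemma splits_Un:
  assumes N: "stab C N" and "splits C N Q1" "splits C (span (N \<union> Q1)) Q2"
  shows "splits C N (Q1 \<union> Q2)"
proof -
  obtain C1 D1 where 1: "finite C1" "C \<subseteq> C1" "stab C1 D1" "N \<inter> D1 = {0}" "span (N \<union> D1) = span (N \<union> Q1)"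
    using assms(2) by (auto simp: splits_def)
  obtain C2 D2 where 2: "finite C2" "C \<subseteq> C2" "stab C2 D2" "span (N \<union> Q1) \<inter> D2 = {0}"
    "span (span (N \<union> Q1) \<union> D2) = span (span (N \<union> Q1) \<union> Q2)"
    using assms(3) by (auto simp: splits_def)
  let ?D = "span (D1 \<union> D2)"
  have s: "subspace N" "subspace D1" "subspace D2" using N 1(3) 2(3) by (simp_all add: stab_def)
  have "stab (C1 \<union> C2) ?D" using 1(3) 2(3) by (intro stab_sum) (auto intro: stab_mono)
  moreover have "N \<inter> ?D = {0}"
  proof -
    have "x = 0" if x: "x \<in> N" "x \<in> ?D" for x
    proof -
      obtain d1 d2 where d: "d1 \<in> D1" "d2 \<in> D2" "x = d1 + d2" using x(2) s subspace_span_Un by blast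
      have "x - d1 \<in> span (N \<union> D1)" using x(1) d(1) by (intro span_diff span_base) auto
      then have "d2 \<in> span (N \<union> Q1)" using d(3) 1(5) by simp
      then have "d2 = 0" using 2(4) d(2) by blast
      then show ?thesis using 1(4) x(1) d by auto
    qed
    then show ?thesis using s(1) by (auto simp: subspace_0 span_zero)
  qed
  moreover have "span (N \<union> ?D) = span (N \<union> (Q1 \<union> Q2))"
  proof -
    have "span (N \<union> ?D) = span ((N \<union> D1) \<union> D2)" by (simp only: span_absorb Un_assoc)
    also have "\<dots> = span (span (N \<union> Q1) \<union> D2)" using span_Un_cong[of "N \<union> D1" "span (N \<union> Q1)" D2] 1(5) by (simp add: span_span)
    also have "\<dots> = span (span (N \<union> Q1) \<union> Q2)" by (rule 2(5))
    also have "\<dots> = span ((N \<union> Q1) \<union> Q2)" by (rule span_Un_cong) (rule span_span)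
    finally show ?thesis by (simp only: Un_assoc)
  qed
  ultimately show ?thesis unfolding splits_def using 1(1,2) 2(1) by (intro exI[of _ "C1 \<union> C2"] exI[of _ ?D]) auto
qed

lemma genset_Un: "genset C (A \<union> B) = span (genset C A \<union> genset C B)"
  by (metis orb_Un span_absorb Un_commute)

text \<open>The hypothesis ranges over all \<open>N\<close> because \<open>N\<close> is enlarged by
  the generators already treated.\<close>

lemma splits_finite:
  assumes "finite C" "finite Z" "\<And>N z. stab C N \<Longrightarrow> z \<in> Z \<Longrightarrow> splits C N (genset C {z})" "stab C N"
  shows "splits C N (genset C Z)"
  using assms(2,3)
proof (induction Z rule: finite_induct)
  case empty
  have "splits C N {}" using assms by (intro splits_empty)
  then show ?case by (rule splits_cong) simp
next
  case (insert z Z)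
  have "splits C N (genset C Z)" using insert.IH insert.prems by blast
  moreover have "splits C (span (N \<union> genset C Z)) (genset C {z})"
    using insert.prems assms(4) by (intro insert.prems stab_sum stab_genset) auto
  ultimately have "splits C N (genset C Z \<union> genset C {z})" by (rule splits_Un[OF assms(4)])
  moreover have "span (N \<union> (genset C Z \<union> genset C {z})) = span (N \<union> genset C (insert z Z))"
    using genset_Un[of C Z "{z}"] by (metis span_absorb insert_is_Un Un_commute)
  ultimately show ?case by (rule splits_cong)
qed

text \<open>
  If the translates of \<open>p\<close> are linearly dependent modulo \<open>N\<close>, then fixing the finitely many indices
  that occur in a dependency, except those of \<open>p\<close> itself, expresses \<open>p\<close> by generators of smaller size.
\<close>

lemma depends_smaller:
  assumes C: "finite C" and N: "stab C N" and p: "finite B" "B \<inter> C = {}" "invar C B p"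
    and dep: "depends C B p N"
  obtains C' Z' where "finite C'" "C \<subseteq> C'" "finite Z'" "\<And>y. y \<in> Z' \<Longrightarrow> \<exists>m < card B. lev C' m y"
    "Z' \<subseteq> orb C {p}" "span (N \<union> genset C {p}) = span (N \<union> genset C' Z')"
proof -
  obtain F where F: "finite F" "F \<subseteq> {\<sigma>\<in>fixing C. img \<sigma> B \<noteq> B}" "p \<in> span (N \<union> (\<lambda>\<sigma>. act \<sigma> p) ` F)"
    using finite_support_span[OF dep[unfolded depends_def]] by (elim exE conjE) (rule that)
  let ?C = "C \<union> ((\<Union>\<sigma>\<in>F. img \<sigma> B) - B)"
  have C': "finite ?C" "C \<subseteq> ?C" "B \<inter> ?C = {}" using C F(1) p by auto
  obtain z0 Z' where Z: "finite Z'" "orb C {p} \<subseteq> orb ?C (insert z0 Z')" "insert z0 Z' \<subseteq> orb C {p}"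
    "\<And>y. y \<in> Z' \<Longrightarrow> \<exists>m < card B. lev ?C m y" "z0 = p"
    "\<And>\<sigma>. \<sigma> \<in> fixing C \<Longrightarrow> img \<sigma> B \<inter> ?C \<noteq> {} \<Longrightarrow> act \<sigma> p \<in> orb ?C Z'"
    using refine[OF C'(1,2) p] C'(3) by metis
  let ?L = "span (N \<union> genset ?C Z')"
  have L: "stab ?C ?L" by (intro stab_sum stab_genset stab_mono[OF N C'(2)])
  have "(\<lambda>\<sigma>. act \<sigma> p) ` F \<subseteq> genset ?C Z'"
  proof (rule image_subsetI)
    fix \<sigma> assume \<sigma>: "\<sigma> \<in> F"
    then have "img \<sigma> B \<noteq> B" using F(2) by blast
    \<comment> \<open>Equal cardinality forces a point of the image outside \<open>B\<close>, and
      that point belongs to the enlarged set \<open>?C\<close>.\<close>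
    then have "\<not> img \<sigma> B \<subseteq> B" using p(1) by (metis card_img card_subset_eq)
    then have "img \<sigma> B \<inter> ?C \<noteq> {}" using \<sigma> by blast
    then show "act \<sigma> p \<in> genset ?C Z'" using Z(6) F(2) \<sigma> by (blast intro: span_base)
  qed
  then have "p \<in> ?L" using F(3) span_mono[of "N \<union> (\<lambda>\<sigma>. act \<sigma> p) ` F" "N \<union> genset ?C Z'"] by blast
  then have "insert z0 Z' \<subseteq> ?L" using Z(5) by (auto intro!: span_base genset_base)
  then have "genset ?C (insert z0 Z') \<subseteq> ?L" by (rule genset_minimal[OF L])
  then have 1: "genset C {p} \<subseteq> ?L" using span_mono[OF Z(2)] by blast
  have "genset ?C Z' \<subseteq> genset C {p}"
    using Z(3) by (intro genset_minimal[OF stab_mono[OF stab_genset C'(2)]]) (auto intro: span_base)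
  then have "span (N \<union> genset C {p}) = ?L"
    using 1 by (intro antisym span_minimal) (auto intro: span_base)
  then show thesis using that[OF C'(1,2) Z(1,4)] Z(3) by blast
qed

text \<open>Induction on the size. If \<open>p\<close> depends on its other translates modulo
  \<open>N\<close>, it is traded for generators of smaller size over a smaller group; otherwise its
  translates are independent modulo \<open>N\<close>, and the subrepresentation generated by
  \<open>p\<close> is itself the complement.\<close>

lemma splits_lev:
  assumes "finite C" "stab C N" "lev C n p"
  shows "splits C N (genset C {p})"
  using assms
proof (induction n arbitrary: C N p rule: less_induct)
  case (less n)
  obtain B where B: "finite B" "B \<inter> C = {}" "card B = n" "invar C B p"
    using less.prems(3) by (auto simp: lev_def)
  show ?case
  proof (cases "depends C B p N")
    case True
    obtain C' Z' where C': "finite C'" "C \<subseteq> C'" "finite Z'" "\<And>y. y \<in> Z' \<Longrightarrow> \<exists>m < card B. lev C' m y"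
      "span (N \<union> genset C {p}) = span (N \<union> genset C' Z')"
      using depends_smaller[OF less.prems(1,2) B(1,2,4) True] by metis
    have "splits C' N (genset C' Z')"
    proof (rule splits_finite[OF C'(1,3)])
      fix N z assume "stab C' N" "z \<in> Z'"
      then show "splits C' N (genset C' {z})" using less.IH C'(1,4) B(3) by blast
    qed (rule stab_mono[OF less.prems(2) C'(2)])
    then show ?thesis using C'(2,5) splits_mono splits_cong by metis
  next
    case False
    have "N \<inter> genset C {p} = {0}"
    proof -
      have "x = 0" if x: "x \<in> N" "x \<in> genset C {p}" for x
      proof -
        obtain z where z: "z \<in> TW (Gset C (card B))" "x = lincomb (\<lambda>(u, S). ptrans C B p S) z"
          using x(2) span_lincomb unfolding ptrans_image[OF B(4,1,2), symmetric] by blast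
        then have "z = 0" using lincomb_indep[OF less.prems(2) B(4,1,2) False z(1)] x(1) by simp
        then show ?thesis using z(2) by simp
      qed
      then show ?thesis using less.prems(2) by (auto simp: stab_def subspace_0 span_zero)
    qed
    then show ?thesis unfolding splits_def using less.prems(1) stab_genset by blast
  qed
qed

lemma splits_genset:
  assumes "finite C" "stab C N" "finite Z" "\<And>z. z \<in> Z \<Longrightarrow> \<exists>m. lev C m z"
  shows "splits C N (genset C Z)"
proof (rule splits_finite[OF assms(1,3) _ assms(2)])
  fix N z assume "stab C N" "z \<in> Z"
  then show "splits C N (genset C {z})" using splits_lev[OF assms(1)] assms(4) by blast
qed

text \<open>The translates of \<open>p\<close> form a basis of the sum modulo \<open>N\<close>, and
  \<open>g\<close> reads off the coordinates. Independence makes the coordinates unique, hence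
  equivariant under \<open>fixing C\<close>, and the kernel is \<open>N\<close>.\<close>

lemma free_coordinates:
  assumes N: "stab C N" and p: "invar C B p" "finite B" "B \<inter> C = {}" "\<not> depends C B p N"
  obtains g where "thom C (span (N \<union> genset C {p})) g" "g ` span (N \<union> genset C {p}) \<subseteq> TW (Gset C (card B))"
    "\<And>x. x \<in> span (N \<union> genset C {p}) \<Longrightarrow> g x = 0 \<Longrightarrow> x \<in> N" "\<And>x. x \<in> N \<Longrightarrow> g x = 0"
    "g p = Poly_Mapping.single ((), B) 1"
proof -
  let ?e = "\<lambda>(u :: unit, S). ptrans C B p S"
  let ?W = "TW (Gset C (card B)) :: (unit \<times> nat set \<Rightarrow>\<^sub>0 'k ratfun) set"
  let ?Q = "span (N \<union> genset C {p})"
  define g where "g x = (THE z. z \<in> ?W \<and> x - lincomb ?e z \<in> N)" for x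
  have sN: "subspace N" using N by (rule stab_subspace)
  have sW: "T.subspace ?W" by (rule subspace_TW)
  have gI: "g x = z" if "z \<in> ?W" "x - lincomb ?e z \<in> N" for x z
    unfolding g_def
  proof (rule the_equality)
    fix z' assume z': "z' \<in> ?W \<and> x - lincomb ?e z' \<in> N"
    have "(x - lincomb ?e z) - (x - lincomb ?e z') \<in> N"
      by (rule subspace_diff[OF sN]) (use that(2) z' in simp_all)
    then have "lincomb ?e (z' - z) \<in> N" by (simp add: lincomb_diff)
    moreover have "z' - z \<in> ?W" using that(1) z' by (intro T.subspace_diff[OF sW]) auto
    ultimately have "z' - z = 0" by (rule lincomb_indep[OF N p, rotated])
    then show "z' = z" by simp
  qed (use that in simp)
  have ex: "g x \<in> ?W" "x - lincomb ?e (g x) \<in> N" if "x \<in> ?Q" for x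
  proof -
    from iffD1[OF subspace_span_Un[OF sN subspace_span] that]
    obtain n d where nd: "n \<in> N" "d \<in> genset C {p}" "x = n + d" by (elim bexE) (rule that)
    obtain z where z: "z \<in> ?W" "d = lincomb ?e z"
      using span_lincomb[OF nd(2)[folded ptrans_image[OF p(1-3)]]] by (elim bexE) (rule that)
    have "g x = z" using z nd by (intro gI) auto
    then show "g x \<in> ?W" "x - lincomb ?e (g x) \<in> N" using z nd by auto
  qed
  have W_act: "tact \<sigma> z \<in> ?W" if "z \<in> ?W" "\<sigma> \<in> fixing C" for \<sigma> z
    unfolding TW_iff
  proof (intro allI impI)
    fix w assume w: "w \<notin> Gset C (card B)"
    obtain u S where uS: "w = (u, S)" by (rule prod.exhaust)
    have "(u, img (inverse \<sigma>) S) \<notin> Gset C (card B)"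
      using w uS img_Gset[OF that(2), of u "img (inverse \<sigma>) S" "card B" u] by (auto simp only: img_inverse)
    then show "Poly_Mapping.lookup (tact \<sigma> z) w = 0" using that(1) uS by (simp add: TW_iff)
  qed
  have e_act: "?e (u, img \<sigma> S) = act \<sigma> (?e (u, S))" if "(u, S) \<in> Gset C (card B)" "\<sigma> \<in> fixing C" for u S \<sigma>
    using ptrans_act[OF p(1-3) that] by simp
  have hom: "thom C ?Q g"
    unfolding hom_on_def
  proof (intro conjI ballI allI)
    fix x y assume xy: "x \<in> ?Q" "y \<in> ?Q"
    show "g (x + y) = g x + g y"
    proof (rule gI)
      show "g x + g y \<in> ?W" using ex(1) xy by (intro T.subspace_add[OF sW])
      have "(x - lincomb ?e (g x)) + (y - lincomb ?e (g y)) \<in> N" using ex(2) xy by (intro subspace_add[OF sN])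
      then show "x + y - lincomb ?e (g x + g y) \<in> N" by (simp add: lincomb_add algebra_simps)
    qed
  next
    fix c x assume x: "x \<in> ?Q"
    show "g (c *s x) = tscale c (g x)"
    proof (rule gI)
      show "tscale c (g x) \<in> ?W" using ex(1)[OF x] by (intro T.subspace_scale[OF sW])
      have "c *s (x - lincomb ?e (g x)) \<in> N" using ex(2)[OF x] by (intro subspace_scale[OF sN])
      then show "c *s x - lincomb ?e (tscale c (g x)) \<in> N" by (simp add: lincomb_scale scale_right_diff_distrib)
    qed
  next
    fix \<sigma> x assume \<sigma>: "\<sigma> \<in> fixing C" and x: "x \<in> ?Q"
    show "g (act \<sigma> x) = tact \<sigma> (g x)"
    proof (rule gI)
      show "tact \<sigma> (g x) \<in> ?W" using ex(1)[OF x] \<sigma> by (rule W_act)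
      have "act \<sigma> (x - lincomb ?e (g x)) \<in> N" using ex(2)[OF x] \<sigma> by (intro stab_act[OF N])
      moreover have "lincomb ?e (tact \<sigma> (g x)) = act \<sigma> (lincomb ?e (g x))"
        using e_act \<sigma> by (intro lincomb_act[OF _ ex(1)[OF x]]) blast
      ultimately show "act \<sigma> x - lincomb ?e (tact \<sigma> (g x)) \<in> N" by (simp add: act_diff)
    qed
  qed
  show thesis
  proof (rule that[OF hom])
    show "g ` ?Q \<subseteq> ?W" using ex(1) by blast
    show "x \<in> N" if "x \<in> ?Q" "g x = 0" for x using ex(2)[OF that(1)] that(2) by simp
    show "g x = 0" if "x \<in> N" for x using that by (intro gI) (simp_all add: T.subspace_0[OF sW])
    have "ptrans C B p (img 1 B) = act 1 p" by (rule ptrans_eq[OF p(1)]) simp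
    then have "ptrans C B p B = p" by simp
    then show "g p = Poly_Mapping.single ((), B) 1"
      using p(2,3) by (intro gI) (auto simp: TW_iff lookup_single when_def Gset_def subspace_0[OF sN])
  qed
qed

end

section \<open>Standard representations are injective\<close>

context smooth_semirep
begin

text \<open>The complement of \<open>N\<close> is stable only under a smaller group. Composing
  \<open>f\<close> with the projection along it extends \<open>f\<close> with too little
  equivariance, and \<open>lift_extend\<close> repairs this without changing the values on
  \<open>N\<close>.\<close>

lemma extend_step:
  fixes f :: "'v \<Rightarrow> ('i \<times> nat set \<Rightarrow>\<^sub>0 'k ratfun)"
  assumes N: "stab {} N" and f: "thom {} N f" "f ` N \<subseteq> TW G" and G: "perm_closed G"
    and p: "finite B" "invar {} B p"
  shows "\<exists>N1 h. stab {} N1 \<and> N \<subseteq> N1 \<and> p \<in> N1 \<and> thom {} N1 h \<and> h ` N1 \<subseteq> TW G \<and> (\<forall>x\<in>N. h x = f x)"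
proof -
  let ?N1 = "span (N \<union> genset {} {p})"
  have "lev {} (card B) p" using p by (auto simp: lev_def)
  then have "splits {} N (genset {} {p})" by (intro splits_lev N finite.emptyI)
  then obtain C D where D: "finite C" "stab C D" "N \<inter> D = {0}" "span (N \<union> D) = ?N1"
    unfolding splits_def by (elim exE conjE) (rule that)
  have N1: "stab {} ?N1" by (intro stab_sum stab_genset N)
  have NC: "stab C N" using N by (rule stab_mono) simp
  have s: "subspace N" "subspace D" using N D(2) by (simp_all add: stab_def)
  note pr = pr_hom[OF NC D(2,3), unfolded D(4)]
  have prN: "pr N D x \<in> N" if "x \<in> ?N1" for x using pr_in(1)[OF s D(3)] that D(4) by simp
  let ?g = "\<lambda>x. f (pr N D x)"
  have "thom C ?N1 ?g"
    unfolding hom_on_def using prN hom_onD[OF pr] hom_onD[OF f(1)] by simp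
  moreover have sub: "N \<subseteq> ?N1" by (auto intro: span_base)
  moreover have id: "?g x = f x" if "x \<in> N" for x using pr_id[OF s D(3) that] by simp
  moreover have "thom {} N ?g"
    by (rule hom_on_cong[OF f(1) id]) (use N in \<open>auto simp: stab_def subspace_add subspace_scale\<close>)
  moreover have "?g ` ?N1 \<subseteq> TW G" using prN f(2) by blast
  ultimately obtain h where "thom {} ?N1 h" "h ` ?N1 \<subseteq> TW G" "\<forall>x\<in>N. h x = ?g x"
    using lift_extend[OF D(1) _ N1 N sub G] by blast
  moreover have "p \<in> ?N1" by (intro span_base) (auto intro: genset_base)
  ultimately show ?thesis using N1 sub id by (intro exI[of _ ?N1] exI[of _ h]) simp
qed

text \<open>Partial maps are represented by their graphs, so that extension is inclusion and a chain
  is bounded by its union.\<close>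

definition partial_hom :: "('i \<times> nat set) set \<Rightarrow> ('v \<times> ('i \<times> nat set \<Rightarrow>\<^sub>0 'k ratfun)) set \<Rightarrow> bool" where
  "partial_hom G \<Gamma> \<longleftrightarrow> (\<forall>x y y'. (x, y) \<in> \<Gamma> \<longrightarrow> (x, y') \<in> \<Gamma> \<longrightarrow> y = y') \<and>
     (0, 0) \<in> \<Gamma> \<and> (\<forall>x y x' y'. (x, y) \<in> \<Gamma> \<longrightarrow> (x', y') \<in> \<Gamma> \<longrightarrow> (x + x', y + y') \<in> \<Gamma>) \<and>
     (\<forall>c x y. (x, y) \<in> \<Gamma> \<longrightarrow> (c *s x, tscale c y) \<in> \<Gamma>) \<and>
     (\<forall>\<sigma> x y. (x, y) \<in> \<Gamma> \<longrightarrow> (act \<sigma> x, tact \<sigma> y) \<in> \<Gamma>) \<and> snd ` \<Gamma> \<subseteq> TW G"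

lemma partial_homD:
  assumes "partial_hom G \<Gamma>"
  shows "(x, y) \<in> \<Gamma> \<Longrightarrow> (x, y') \<in> \<Gamma> \<Longrightarrow> y = y'" "(0, 0) \<in> \<Gamma>"
    "(x, y) \<in> \<Gamma> \<Longrightarrow> (x', y') \<in> \<Gamma> \<Longrightarrow> (x + x', y + y') \<in> \<Gamma>"
    "(x, y) \<in> \<Gamma> \<Longrightarrow> (c *s x, tscale c y) \<in> \<Gamma>"
    "(x, y) \<in> \<Gamma> \<Longrightarrow> (act \<sigma> x, tact \<sigma> y) \<in> \<Gamma>" "snd ` \<Gamma> \<subseteq> TW G"
proof -
  note a = assms[unfolded partial_hom_def]
  note b = a[THEN conjunct2, THEN conjunct2]
  show "(x, y) \<in> \<Gamma> \<Longrightarrow> (x, y') \<in> \<Gamma> \<Longrightarrow> y = y'" using a[THEN conjunct1] by blast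
  show "(0, 0) \<in> \<Gamma>" using a[THEN conjunct2, THEN conjunct1] .
  show "(x, y) \<in> \<Gamma> \<Longrightarrow> (x', y') \<in> \<Gamma> \<Longrightarrow> (x + x', y + y') \<in> \<Gamma>"
    using b[THEN conjunct1] by blast
  show "(x, y) \<in> \<Gamma> \<Longrightarrow> (c *s x, tscale c y) \<in> \<Gamma>"
    using b[THEN conjunct2, THEN conjunct1] by blast
  show "(x, y) \<in> \<Gamma> \<Longrightarrow> (act \<sigma> x, tact \<sigma> y) \<in> \<Gamma>"
    using b[THEN conjunct2, THEN conjunct2, THEN conjunct1] by blast
  show "snd ` \<Gamma> \<subseteq> TW G"
    using b[THEN conjunct2, THEN conjunct2, THEN conjunct2] .
qed

lemma partial_hom_graph:
  assumes "stab {} N" "thom {} N f" "f ` N \<subseteq> TW G"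
  shows "partial_hom G {(x, f x) | x. x \<in> N}"
proof -
  have s: "subspace N" using assms(1) by (rule stab_subspace)
  have "f (0 *s 0) = tscale 0 (f 0)" using subspace_0[OF s] by (rule hom_onD(2)[OF assms(2)])
  then have "f 0 = 0" by simp
  then show ?thesis
    unfolding partial_hom_def
    using assms(3) s stab_act[OF assms(1)] hom_onD[OF assms(2)]
    by (auto simp: subspace_0 subspace_add subspace_scale)
qed

lemma partial_hom_fun:
  assumes "partial_hom G \<Gamma>"
  obtains N f where "stab {} N" "thom {} N f" "f ` N \<subseteq> TW G" "\<Gamma> = {(x, f x) | x. x \<in> N}"
proof -
  define f where "f x = (THE y. (x, y) \<in> \<Gamma>)" for x
  let ?N = "fst ` \<Gamma>"
  note single = partial_homD(1)[OF assms] and add = partial_homD(3)[OF assms]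
    and scale = partial_homD(4)[OF assms] and act = partial_homD(5)[OF assms]
  have fI: "f x = y" if "(x, y) \<in> \<Gamma>" for x y
    unfolding f_def by (rule the_equality) (use that single in blast)+
  have eq: "\<Gamma> = {(x, f x) | x. x \<in> ?N}" using fI by force
  have G: "(x, f x) \<in> \<Gamma>" if "x \<in> ?N" for x using eq that by blast
  have mem: "x \<in> ?N" if "(x, y) \<in> \<Gamma>" for x y using that by force
  have "stab {} ?N"
    unfolding stab_def
  proof (intro conjI ballI subspaceI)
    show "0 \<in> ?N" using partial_homD(2)[OF assms] by (rule mem)
    show "x + y \<in> ?N" if "x \<in> ?N" "y \<in> ?N" for x y using add[OF G G, OF that] by (rule mem)
    show "c *s x \<in> ?N" if "x \<in> ?N" for c x using scale[OF G, OF that] by (rule mem)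
    show "act \<sigma> x \<in> ?N" if "x \<in> ?N" for \<sigma> x using act[OF G, OF that] by (rule mem)
  qed
  moreover have "thom {} ?N f"
    unfolding hom_on_def
  proof (intro conjI ballI allI)
    show "f (x + y) = f x + f y" if "x \<in> ?N" "y \<in> ?N" for x y using add[OF G G, OF that] by (rule fI)
    show "f (c *s x) = tscale c (f x)" if "x \<in> ?N" for c x using scale[OF G, OF that] by (rule fI)
    show "f (act \<sigma> x) = tact \<sigma> (f x)" if "x \<in> ?N" for \<sigma> x using act[OF G, OF that] by (rule fI)
  qed
  moreover have "f ` ?N \<subseteq> TW G"
  proof (rule image_subsetI)
    fix x assume "x \<in> ?N"
    then have "snd (x, f x) \<in> snd ` \<Gamma>" using G by (intro imageI)
    then show "f x \<in> TW G" using partial_homD(6)[OF assms] by auto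
  qed
  ultimately show thesis using eq by (rule that)
qed

text \<open>A maximal extension is defined everywhere: every vector is a combination of setwise
  invariant ones by \<open>hilbert90\<close>, so a vector missing from the domain yields an
  invariant one missing from it, and \<open>extend_step\<close> would enlarge the domain.\<close>

theorem standard_injective:
  fixes f :: "'v \<Rightarrow> ('i \<times> nat set \<Rightarrow>\<^sub>0 'k ratfun)"
  assumes N: "stab {} N" and f: "thom {} N f" "f ` N \<subseteq> TW G" and G: "perm_closed G"
  shows "\<exists>h. thom {} UNIV h \<and> range h \<subseteq> TW G \<and> (\<forall>x\<in>N. h x = f x)"
proof -
  let ?\<Gamma>0 = "{(x, f x) | x. x \<in> N}"
  define \<A> where "\<A> = {\<Gamma>. partial_hom G \<Gamma> \<and> ?\<Gamma>0 \<subseteq> \<Gamma>}"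
  have "\<exists>M\<in>\<A>. \<forall>X\<in>\<A>. M \<subseteq> X \<longrightarrow> X = M"
  proof (rule subset_Zorn_nonempty)
    show "\<A> \<noteq> {}" using partial_hom_graph[OF N f] by (auto simp: \<A>_def)
    fix \<C> assume ne: "\<C> \<noteq> {}" and chain: "subset.chain \<A> \<C>"
    have ph: "partial_hom G \<Gamma>" if "\<Gamma> \<in> \<C>" for \<Gamma> using chain that by (auto simp: subset.chain_def \<A>_def)
    have two: "\<exists>\<Gamma>\<in>\<C>. u \<in> \<Gamma> \<and> v \<in> \<Gamma>" if "u \<in> \<Union>\<C>" "v \<in> \<Union>\<C>" for u v
    proof -
      from that(1) obtain \<Gamma> where 1: "\<Gamma> \<in> \<C>" "u \<in> \<Gamma>" by (rule UnionE)
      from that(2) obtain \<Delta> where 2: "\<Delta> \<in> \<C>" "v \<in> \<Delta>" by (rule UnionE)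
      have "\<Gamma> \<subseteq> \<Delta> \<or> \<Delta> \<subseteq> \<Gamma>" using chain[unfolded subset_chain_def] 1 2 by blast
      then show ?thesis using 1 2 by blast
    qed
    have "partial_hom G (\<Union>\<C>)"
      unfolding partial_hom_def
    proof (intro conjI allI impI)
      show "y = y'" if "(x, y) \<in> \<Union>\<C>" "(x, y') \<in> \<Union>\<C>" for x y y'
        using two[OF that] partial_homD(1)[OF ph] by blast
      show "(0, 0) \<in> \<Union>\<C>" using ne partial_homD(2)[OF ph] by blast
      show "(x + x', y + y') \<in> \<Union>\<C>" if "(x, y) \<in> \<Union>\<C>" "(x', y') \<in> \<Union>\<C>" for x y x' y'
        using two[OF that] partial_homD(3)[OF ph] by blast
      show "(c *s x, tscale c y) \<in> \<Union>\<C>" if "(x, y) \<in> \<Union>\<C>" for c x y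
        using that partial_homD(4)[OF ph] by blast
      show "(act \<sigma> x, tact \<sigma> y) \<in> \<Union>\<C>" if "(x, y) \<in> \<Union>\<C>" for \<sigma> x y
        using that partial_homD(5)[OF ph] by blast
      show "snd ` \<Union>\<C> \<subseteq> TW G" using partial_homD(6)[OF ph] by blast
    qed
    moreover have "?\<Gamma>0 \<subseteq> \<Union>\<C>"
    proof -
      obtain \<Gamma> where "\<Gamma> \<in> \<C>" using ne by blast
      moreover from this have "?\<Gamma>0 \<subseteq> \<Gamma>" using chain by (auto simp: subset.chain_def \<A>_def)
      ultimately show ?thesis by blast
    qed
    ultimately show "\<Union>\<C> \<in> \<A>" by (simp add: \<A>_def)
  qed
  then obtain \<Gamma> where \<Gamma>: "partial_hom G \<Gamma>" "?\<Gamma>0 \<subseteq> \<Gamma>" and max: "\<And>X. X \<in> \<A> \<Longrightarrow> \<Gamma> \<subseteq> X \<Longrightarrow> X = \<Gamma>"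
    by (auto simp: \<A>_def)
  obtain N1 h where h: "stab {} N1" "thom {} N1 h" "h ` N1 \<subseteq> TW G" "\<Gamma> = {(x, h x) | x. x \<in> N1}"
    using partial_hom_fun[OF \<Gamma>(1)] .
  have "N1 = UNIV"
  proof (rule ccontr)
    assume "N1 \<noteq> UNIV"
    then obtain x where x: "x \<notin> N1" by blast
    obtain X where X: "finite X" "supports X x" using smooth by blast
    have "\<not> {y. invar {} X y \<and> y \<in> genset {} {x}} \<subseteq> N1"
      using hilbert90[OF X] x span_minimal[OF _ stab_subspace[OF h(1)]] by blast
    then obtain p where p: "invar {} X p" "p \<notin> N1" by blast
    obtain N2 h2 where h2: "stab {} N2" "N1 \<subseteq> N2" "p \<in> N2" "thom {} N2 h2" "h2 ` N2 \<subseteq> TW G" "\<forall>x\<in>N1. h2 x = h x"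
      using extend_step[OF h(1-3) G X(1) p(1)] by blast
    let ?\<Gamma>2 = "{(x, h2 x) | x. x \<in> N2}"
    have "\<Gamma> \<subseteq> ?\<Gamma>2" using h(4) h2(2,6) by auto
    moreover have "?\<Gamma>2 \<in> \<A>" using partial_hom_graph[OF h2(1,4,5)] \<Gamma>(2) calculation by (auto simp: \<A>_def)
    ultimately have "?\<Gamma>2 = \<Gamma>" by (intro max)
    then show False using p(2) h2(3) h(4) by auto
  qed
  moreover have "h x = f x" if "x \<in> N" for x using \<Gamma>(2) h(4) that by auto
  ultimately show ?thesis using h by auto
qed

end

section \<open>Finitely generated subrepresentations of minimal size\<close>

lemma hom_on_zero:
  assumes "hom_on s1 a1 s2 a2 C N g" "(0 :: 'v::ab_group_add) \<in> N"
  shows "g 0 = (0 :: 'w::ab_group_add)"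
  using hom_onD(1)[OF assms(1,2,2)] by simp

context semirep
begin

text \<open>Conjugation by \<tau> carries \<open>fixing C\<close> to the stabiliser of the moved
  set, hence orbits to orbits. It allows the generators of a fully stable space to be moved away
  from \<open>C\<close>.\<close>

lemma act_genset: "y \<in> genset C Z \<Longrightarrow> act \<tau> y \<in> genset (img \<tau> C) (act \<tau> ` Z)"
proof (rule span_act)
  fix y assume "y \<in> orb C Z"
  then obtain \<sigma> z where y: "\<sigma> \<in> fixing C" "z \<in> Z" "y = act \<sigma> z" by (auto simp: orb_def)
  have "\<tau> * \<sigma> * inverse \<tau> \<in> fixing (img \<tau> C)"
    using fixing_conj[of \<sigma> "inverse \<tau>" "img \<tau> C"] y(1) by simp
  then have "act (\<tau> * \<sigma> * inverse \<tau>) (act \<tau> z) \<in> orb (img \<tau> C) (act \<tau> ` Z)"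
    using y(2) by (intro orbI imageI)
  then show "act \<tau> y \<in> genset (img \<tau> C) (act \<tau> ` Z)"
    using y(3) by (intro span_base) (simp add: act_mult)
qed

lemma invar_conj:
  assumes "invar C B x"
  shows "invar (img \<tau> C) (img \<tau> B) (act \<tau> x)"
  unfolding invar_def
proof (intro ballI impI)
  fix \<sigma> assume \<sigma>: "\<sigma> \<in> fixing (img \<tau> C)" "img \<sigma> (img \<tau> B) = img \<tau> B"
  let ?\<rho> = "inverse \<tau> * \<sigma> * \<tau>"
  have "img ?\<rho> B = B" using \<sigma>(2) by (simp only: img_mult img_inverse)
  then have "act ?\<rho> x = x" using assms fixing_conj[OF \<sigma>(1)] unfolding invar_def by blast
  then show "act \<sigma> (act \<tau> x) = act \<tau> x" by (metis act_inverse(1) act_mult)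
qed

lemma indep_Int:
  assumes "stab C N" "invar C B p" "finite B" "B \<inter> C = {}" "\<not> depends C B p N"
  shows "N \<inter> genset C {p} = {0}"
proof -
  have "x = 0" if x: "x \<in> N" "x \<in> genset C {p}" for x
  proof -
    obtain z where z: "z \<in> TW (Gset C (card B))" "x = lincomb (\<lambda>(u, S). ptrans C B p S) z"
      using span_lincomb[OF x(2)[folded ptrans_image[OF assms(2-4)]]] by (elim bexE) (rule that)
    then have "z = 0" using lincomb_indep[OF assms z(1)] x(1) by simp
    then show ?thesis using z(2) by simp
  qed
  then show ?thesis using assms(1) by (auto simp: stab_def subspace_0 span_zero)
qed

lemma hom_image_genset:
  assumes "hom_on scale act scale act C (genset C Z) \<pi>"
  shows "\<pi> ` genset C Z = genset C (\<pi> ` Z)"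
proof
  note h = hom_onD[OF assms]
  show "\<pi> ` genset C Z \<subseteq> genset C (\<pi> ` Z)"
  proof (rule image_subsetI)
    fix x assume "x \<in> genset C Z"
    then have "x \<in> genset C Z \<and> \<pi> x \<in> genset C (\<pi> ` Z)"
    proof (induction x rule: span_induct_alt)
      case base
      then show ?case using hom_on_zero[OF assms span_zero] by (simp add: span_zero)
    next
      case (step c x y)
      obtain \<sigma> z where \<sigma>: "\<sigma> \<in> fixing C" "z \<in> Z" "x = act \<sigma> z" using step.hyps by (auto simp: orb_def)
      have "\<pi> x = act \<sigma> (\<pi> z)" using h(3)[OF genset_base[OF \<sigma>(2)] \<sigma>(1)] \<sigma>(3) by simp
      then have "\<pi> x \<in> orb C (\<pi> ` Z)" using \<sigma> by (auto intro: orbI)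
      moreover have x: "x \<in> genset C Z" using step.hyps by (rule span_base)
      ultimately show ?case
        using step.IH h(1)[OF span_scale[OF x]] h(2)[OF x] by (simp add: span_add span_scale span_base)
    qed
    then show "\<pi> x \<in> genset C (\<pi> ` Z)" by simp
  qed
  show "genset C (\<pi> ` Z) \<subseteq> \<pi> ` genset C Z"
  proof (rule genset_minimal)
    show "stab C (\<pi> ` genset C Z)"
      unfolding stab_def
    proof (intro conjI ballI subspaceI)
      show "0 \<in> \<pi> ` genset C Z" using hom_on_zero[OF assms span_zero] span_zero by (metis image_eqI)
      fix x y assume "x \<in> \<pi> ` genset C Z" "y \<in> \<pi> ` genset C Z"
      then obtain x' y' where "x' \<in> genset C Z" "y' \<in> genset C Z" "x = \<pi> x'" "y = \<pi> y'"
        by (elim imageE) (rule that)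
      then show "x + y \<in> \<pi> ` genset C Z" using h(1) by (intro image_eqI[of _ _ "x' + y'"] span_add) simp_all
    next
      fix c x assume "x \<in> \<pi> ` genset C Z"
      then obtain x' where "x' \<in> genset C Z" "x = \<pi> x'" by (rule imageE)
      then show "c *s x \<in> \<pi> ` genset C Z" using h(2) by (intro image_eqI[of _ _ "c *s x'"] span_scale) simp_all
    next
      fix \<sigma> x assume "\<sigma> \<in> fixing C" "x \<in> \<pi> ` genset C Z"
      then obtain x' where "\<sigma> \<in> fixing C" "x' \<in> genset C Z" "x = \<pi> x'" by (elim imageE)
      then show "act \<sigma> x \<in> \<pi> ` genset C Z"
        using h(3) by (intro image_eqI[of _ _ "act \<sigma> x'"] stab_act[OF stab_genset]) simp_all
    qed
    show "\<pi> ` Z \<subseteq> \<pi> ` genset C Z" using genset_base by blast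
  qed
qed

text \<open>The bookkeeping behind the pair \<open>(J, s)\<close>: arbitrarily but finitely many
  generators below size \<open>J\<close>, and at most \<open>s\<close> of size
  \<open>J\<close>.\<close>

definition fg :: "nat \<Rightarrow> nat \<Rightarrow> nat set \<Rightarrow> 'v set \<Rightarrow> bool" where
  "fg J s C Q \<longleftrightarrow> (\<exists>Z0 Z1. finite Z0 \<and> finite Z1 \<and> card Z1 \<le> s \<and> (\<forall>z\<in>Z0. \<exists>m<J. lev C m z) \<and>
     (\<forall>z\<in>Z1. lev C J z) \<and> Q = genset C (Z0 \<union> Z1))"

lemma fgI: "finite Z0 \<Longrightarrow> finite Z1 \<Longrightarrow> card Z1 \<le> s \<Longrightarrow> (\<And>z. z \<in> Z0 \<Longrightarrow> \<exists>m<J. lev C m z) \<Longrightarrow>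
    (\<And>z. z \<in> Z1 \<Longrightarrow> lev C J z) \<Longrightarrow> Q = genset C (Z0 \<union> Z1) \<Longrightarrow> fg J s C Q"
  unfolding fg_def by blast

lemma fgE:
  assumes "fg J s C Q"
  obtains Z0 Z1 where "finite Z0" "finite Z1" "card Z1 \<le> s" "\<forall>z\<in>Z0. \<exists>m<J. lev C m z"
    "\<forall>z\<in>Z1. lev C J z" "Q = genset C (Z0 \<union> Z1)"
  using assms unfolding fg_def by (elim exE conjE) (rule that)

lemma fg_lower: "finite Z \<Longrightarrow> (\<And>z. z \<in> Z \<Longrightarrow> \<exists>m<J. lev C m z) \<Longrightarrow> fg J 0 C (genset C Z)"
  by (rule fgI[of Z "{}"]) simp_all

lemma fg_mono: "fg J s C Q \<Longrightarrow> s \<le> s' \<Longrightarrow> fg J s' C Q"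
  by (erule fgE) (rule fgI; (assumption | blast | linarith))

lemma fg_sum:
  assumes "fg J s C Q" "fg J s' C Q'"
  shows "fg J (s + s') C (span (Q \<union> Q'))"
proof -
  obtain Z0 Z1 where Z: "finite Z0" "finite Z1" "card Z1 \<le> s" "\<forall>z\<in>Z0. \<exists>m<J. lev C m z"
    "\<forall>z\<in>Z1. lev C J z" "Q = genset C (Z0 \<union> Z1)"
    using fgE[OF assms(1)] .
  obtain Y0 Y1 where Y: "finite Y0" "finite Y1" "card Y1 \<le> s'" "\<forall>z\<in>Y0. \<exists>m<J. lev C m z"
    "\<forall>z\<in>Y1. lev C J z" "Q' = genset C (Y0 \<union> Y1)"
    using fgE[OF assms(2)] .
  have "Z0 \<union> Z1 \<union> (Y0 \<union> Y1) = (Z0 \<union> Y0) \<union> (Z1 \<union> Y1)" by blast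
  then have "span (Q \<union> Q') = genset C ((Z0 \<union> Y0) \<union> (Z1 \<union> Y1))"
    unfolding Z(6) Y(6) genset_Un[symmetric] by (simp only:)
  then show ?thesis
    using Z(1-5) Y(1-5) card_Un_le[of Z1 Y1] by (intro fgI[of "Z0 \<union> Y0" "Z1 \<union> Y1"]) auto
qed

lemma fg_zero: "fg J 0 C {0}"
  using fg_lower[of "{}" J C] by simp

lemma fg_genset:
  assumes "finite Z" "\<And>z. z \<in> Z \<Longrightarrow> fg J s C' (genset C {z})"
  shows "fg J (s * card Z) C' (genset C Z)"
  using assms
proof (induction Z rule: finite_induct)
  case empty then show ?case using fg_zero by simp
next
  case (insert z Z)
  have "fg J (s + s * card Z) C' (span (genset C {z} \<union> genset C Z))"
    using insert by (intro fg_sum) auto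
  then show ?case using insert.hyps genset_Un[of C "{z}" Z] by simp
qed

lemma refine_genset:
  assumes C: "finite C'" "C \<subseteq> C'" and z: "lev C m z"
  obtains z0 Z' where "finite Z'" "genset C {z} = genset C' (insert z0 Z')" "lev C' m z0"
    "\<forall>y\<in>Z'. \<exists>k<m. lev C' k y"
proof -
  obtain B where B: "finite B" "B \<inter> C = {}" "card B = m" "invar C B z" using z by (auto simp: lev_def)
  show thesis
  proof (rule refine[OF C B(1,2,4)])
    fix z0 Z'
    assume Z: "finite Z'" "orb C {z} \<subseteq> orb C' (insert z0 Z')" "insert z0 Z' \<subseteq> orb C {z}"
      "lev C' (card B) z0" "\<And>y. y \<in> Z' \<Longrightarrow> \<exists>m < card B. lev C' m y"
  have "genset C {z} = genset C' (insert z0 Z')"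
  proof
    show "genset C {z} \<subseteq> genset C' (insert z0 Z')" using Z(2) by (rule span_mono)
    show "genset C' (insert z0 Z') \<subseteq> genset C {z}"
      using Z(3) by (intro genset_minimal stab_mono[OF stab_genset C(2)]) (auto intro: span_base)
  qed
  then show thesis using that[OF Z(1)] Z(4,5) B(3) by blast
  qed
qed

text \<open>Over a smaller group each generator of size \<open>J\<close> breaks up into a single one
  of size \<open>J\<close> and smaller ones, so the count \<open>s\<close> is not raised. Minimality
  can therefore be tested over any smaller group.\<close>

lemma fg_refine:
  assumes "fg J s C Q" and C: "finite C'" "C \<subseteq> C'"
  shows "fg J s C' Q"
proof -
  obtain Z0 Z1 where Z: "finite Z0" "finite Z1" "card Z1 \<le> s" "\<forall>z\<in>Z0. \<exists>m<J. lev C m z"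
    "\<forall>z\<in>Z1. lev C J z" "Q = genset C (Z0 \<union> Z1)"
    using fgE[OF assms(1)] .
  have "fg J 0 C' (genset C {z})" if "z \<in> Z0" for z
  proof -
    obtain m where m: "m < J" "lev C m z" using Z(4) \<open>z \<in> Z0\<close> by blast
    obtain z0 Z' where "finite Z'" "genset C {z} = genset C' (insert z0 Z')" "lev C' m z0"
      "\<forall>y\<in>Z'. \<exists>k<m. lev C' k y" using refine_genset[OF C m(2)] .
    moreover from this have "\<exists>k<J. lev C' k y" if "y \<in> insert z0 Z'" for y
      using that m(1) by (metis insertE less_trans)
    ultimately show ?thesis using fg_lower[of "insert z0 Z'" J C'] by simp
  qed
  then have 0: "fg J 0 C' (genset C Z0)" using fg_genset[OF Z(1), of J 0] by simp
  have "fg J 1 C' (genset C {z})" if "z \<in> Z1" for z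
  proof -
    obtain z0 Z' where "finite Z'" "genset C {z} = genset C' (insert z0 Z')" "lev C' J z0"
      "\<forall>y\<in>Z'. \<exists>k<J. lev C' k y" using refine_genset[OF C bspec[OF Z(5) \<open>z \<in> Z1\<close>]] .
    then show ?thesis by (intro fgI[of Z' "{z0}"]) auto
  qed
  then have "fg J (card Z1) C' (genset C Z1)" using fg_genset[OF Z(2), of J 1] by simp
  from fg_mono[OF fg_sum[OF 0 this], of s] Z(3) show ?thesis
    unfolding Z(6) genset_Un by simp
qed

text \<open>A map equivariant under \<open>fixing C\<close> preserves invariance for each
  \<open>B\<close>, so the images of the generators keep their sizes, and they generate the
  image.\<close>

lemma fg_image:
  assumes "fg J s C Q" "hom_on scale act scale act C Q \<pi>"
  shows "fg J s C (\<pi> ` Q)"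
proof -
  obtain Z0 Z1 where Z: "finite Z0" "finite Z1" "card Z1 \<le> s" "\<forall>z\<in>Z0. \<exists>m<J. lev C m z"
    "\<forall>z\<in>Z1. lev C J z" "Q = genset C (Z0 \<union> Z1)"
    using fgE[OF assms(1)] .
  have lev: "lev C m (\<pi> z)" if "lev C m z" "z \<in> Q" for m z
    using that hom_onD(3)[OF assms(2) that(2)] unfolding lev_def invar_def by metis
  have "Z0 \<union> Z1 \<subseteq> Q" unfolding Z(6) using genset_base by blast
  then have "\<exists>m<J. lev C m (\<pi> z)" if "z \<in> Z0" for z using bspec[OF Z(4) that] lev that by blast
  moreover have "lev C J (\<pi> z)" if "z \<in> Z1" for z using bspec[OF Z(5) that] lev that \<open>Z0 \<union> Z1 \<subseteq> Q\<close> by blast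
  moreover have "\<pi> ` Q = genset C (\<pi> ` Z0 \<union> \<pi> ` Z1)"
    using hom_image_genset[OF assms(2)[unfolded Z(6)]] unfolding Z(6) image_Un .
  moreover have "card (\<pi> ` Z1) \<le> s" using Z(2,3) card_image_le le_trans by blast
  ultimately show ?thesis using Z(1,2) by (intro fgI[of "\<pi> ` Z0" "\<pi> ` Z1"]) auto
qed

text \<open>Without generators of size \<open>J\<close> all sizes are at most \<open>J - 1\<close>,
  and the generators of exactly that size become the counted ones. A nonzero space has a generator,
  so \<open>J\<close> is positive.\<close>

lemma fg_down:
  assumes "fg J 0 C Q" "Q \<noteq> {0}"
  shows "\<exists>J'<J. \<exists>s. fg J' s C Q"
proof -
  obtain Z0 Z1 where Z: "finite Z0" "finite Z1" "card Z1 \<le> 0" "\<forall>z\<in>Z0. \<exists>m<J. lev C m z"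
    "\<forall>z\<in>Z1. lev C J z" "Q = genset C (Z0 \<union> Z1)"
    using fgE[OF assms(1)] .
  then have Q: "Q = genset C Z0" by simp
  have "Z0 \<noteq> {}" using Q assms(2) by auto
  then obtain j where j: "J = Suc j" using Z(4) by (cases J) auto
  let ?Z1 = "{z\<in>Z0. lev C j z}"
  have "\<exists>m<j. lev C m z" if "z \<in> Z0 - ?Z1" for z
    using bspec[OF Z(4), of z] that j by (auto simp: less_Suc_eq)
  then have "fg j (card ?Z1) C Q"
  proof (intro fgI[of "Z0 - ?Z1" ?Z1])
    have "(Z0 - ?Z1) \<union> ?Z1 = Z0" by blast
    then show "Q = genset C ((Z0 - ?Z1) \<union> ?Z1)" unfolding Q by (simp only:)
  qed (use Z(1) in auto)
  then show ?thesis using j by blast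
qed

end

lemma (in semirep) hom_on_single:
  fixes \<eta> :: "('i \<times> nat set \<Rightarrow>\<^sub>0 'k ratfun) \<Rightarrow> 'v"
  assumes \<eta>: "hom_on tscale tact scale act C (TW G) \<eta>" and z: "z \<in> TW G"
    and 0: "\<And>w. w \<in> G \<Longrightarrow> \<eta> (Poly_Mapping.single w 1) = 0"
  shows "\<eta> z = 0"
  using z
proof (induction z rule: poly_mapping_add_induct)
  case zero
  show ?case by (rule hom_on_zero[OF \<eta> T.subspace_0[OF subspace_TW]])
next
  case (add p m c)
  have l: "Poly_Mapping.lookup (Poly_Mapping.single m c + p) w = (if w = m then c else Poly_Mapping.lookup p w)" for w
    using add.hyps by (auto simp: lookup_add lookup_single when_def in_keys_iff)
  have m: "m \<in> G" using add.prems add.hyps l[of m] by (metis TW_iff)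
  have p: "p \<in> TW G" unfolding TW_iff
    using add.prems add.hyps l by (metis TW_iff not_in_keys_iff_lookup_eq_zero)
  have s: "Poly_Mapping.single m a \<in> TW G" for a :: "'k ratfun"
    using m by (auto simp: TW_iff lookup_single when_def)
  have "Poly_Mapping.single m c = tscale c (Poly_Mapping.single m 1)"
    by (rule poly_mapping_eqI) (simp add: lookup_single when_def)
  then have "\<eta> (Poly_Mapping.single m c) = 0" using hom_onD(2)[OF \<eta> s] 0[OF m] by simp
  then show ?case using hom_onD(1)[OF \<eta> s p] add.IH[OF p] by simp
qed

context smooth_semirep
begin

text \<open>
  Among the nonzero subrepresentations that are generated over some open subgroup by finitely many elements of
  size at most \<open>J\<close>, at most \<open>s\<close> of which have size \<open>J\<close>, choose one with \<open>(J, s)\<close> lexicographically minimal.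
  It embeds into the standard representation on the \<open>J\<close>-subsets: the kernel of a nonzero map avoids
  the orbit of a generator of size \<open>J\<close>, so it is generated by fewer such elements.
\<close>

lemma minimal_embeds:
  assumes M: "stab {} M" "M \<noteq> {0}"
  obtains J Q and \<psi> :: "'v \<Rightarrow> (unit \<times> nat set \<Rightarrow>\<^sub>0 'k ratfun)"
  where "stab {} Q" "Q \<subseteq> M" "Q \<noteq> {0}" "thom {} Q \<psi>" "\<psi> ` Q \<subseteq> TW (Gset {} J)"
    "\<And>x. x \<in> Q \<Longrightarrow> \<psi> x = 0 \<Longrightarrow> x = 0"
    "\<And>C P. finite C \<Longrightarrow> fg J 0 C P \<Longrightarrow> stab {} P \<Longrightarrow> P \<subseteq> M \<Longrightarrow> P = {0}"
proof -
  define bad where "bad J s \<longleftrightarrow> (\<exists>C Q. finite C \<and> fg J s C Q \<and> stab {} Q \<and> Q \<subseteq> M \<and> Q \<noteq> {0})" for J s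
  have badI: "bad J s" if "finite C" "fg J s C Q" "stab {} Q" "Q \<subseteq> M" "Q \<noteq> {0}" for J s C Q
    unfolding bad_def using that by blast
  have "\<exists>J s. bad J s"
  proof -
    obtain x where x: "x \<in> M" "x \<noteq> 0" using M stab_subspace subspace_0 by blast
    obtain X where X: "finite X" "supports X x" using smooth by blast
    have "\<not> {y. invar {} X y \<and> y \<in> genset {} {x}} \<subseteq> {0}"
      using hilbert90[OF X] x(2) span_minimal[OF _ subspace_single_0] by blast
    then obtain y where y: "invar {} X y" "y \<in> genset {} {x}" "y \<noteq> 0" by blast
    have yM: "y \<in> M" using y(2) genset_minimal[OF M(1), of "{x}"] x(1) by blast
    have "lev {} (card X) y" using y(1) X(1) by (auto simp: lev_def)
    then have "fg (card X) 1 {} (genset {} {y})" by (intro fgI[of "{}" "{y}"]) auto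
    moreover have "genset {} {y} \<subseteq> M" using yM by (intro genset_minimal[OF M(1)]) simp
    moreover have "genset {} {y} \<noteq> {0}" using y(3) genset_base[of y "{y}" "{}"] by blast
    ultimately show ?thesis using badI stab_genset by blast
  qed
  define J where "J = (LEAST J. \<exists>s. bad J s)"
  define s where "s = (LEAST s. bad J s)"
  have "\<exists>s. bad J s" unfolding J_def using \<open>\<exists>J s. bad J s\<close> by (rule LeastI_ex)
  then have bad: "bad J s" unfolding s_def by (rule LeastI_ex)
  have minJ: "\<not> bad J' s'" if "J' < J" for J' s'
    using not_less_Least[of J' "\<lambda>J. \<exists>s. bad J s"] that unfolding J_def by blast
  have mins: "\<not> bad J s'" if "s' < s" for s'
    using not_less_Least[of s' "bad J"] that unfolding s_def by blast
  \<comment> \<open>A bad pair with second entry 0 would give, by \<open>fg_down\<close>, a bad pair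
    with smaller first entry. Hence \<open>s\<close> is positive and \<open>s - 1\<close> is a true
    decrease.\<close>
  have bad0: "\<not> bad J 0"
  proof
    assume "bad J 0"
    then obtain C Q where *: "finite C" "fg J 0 C Q" "stab {} Q" "Q \<subseteq> M" "Q \<noteq> {0}" by (auto simp: bad_def)
    obtain J' s' where "J' < J" "fg J' s' C Q" using fg_down[OF *(2,5)] by blast
    then show False using badI[OF *(1) _ *(3-5)] minJ by blast
  qed
  have s0: "s > 0" using bad bad0 by (cases s) auto
  obtain C Q where C: "finite C" and Q: "fg J s C Q" "stab {} Q" "Q \<subseteq> M" "Q \<noteq> {0}"
    using bad by (auto simp: bad_def)
  have no_fg: False if "finite C'" "fg J (s - 1) C' Q'" "stab {} Q'" "Q' \<subseteq> M" "Q' \<noteq> {0}" for C' Q'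
    using badI[OF that] mins[of "s - 1"] s0 by simp
  obtain Z0 Z1 where Z: "finite Z0" "finite Z1" "card Z1 \<le> s" "\<forall>z\<in>Z0. \<exists>m<J. lev C m z"
    "\<forall>z\<in>Z1. lev C J z" "Q = genset C (Z0 \<union> Z1)"
    using fgE[OF Q(1)] .
  have ZQ: "Z0 \<union> Z1 \<subseteq> Q" unfolding Z(6) using genset_base by blast
  have "Z1 \<noteq> {}"
  proof
    assume "Z1 = {}"
    then have "fg J 0 C Q" using Z by (intro fgI[of Z0 "{}"]) auto
    then show False using badI[OF C _ Q(2-4)] bad0 by blast
  qed
  have split: "Q = span (genset C (Z0 \<union> (Z1 - {q})) \<union> genset C {q})"
    "fg J (s - 1) C (genset C (Z0 \<union> (Z1 - {q})))" if q: "q \<in> Z1" for q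
  proof -
    have "Z0 \<union> (Z1 - {q}) \<union> {q} = Z0 \<union> Z1" using q by blast
    then show "Q = span (genset C (Z0 \<union> (Z1 - {q})) \<union> genset C {q})"
      unfolding genset_Un[symmetric] Z(6) by (simp only:)
    show "fg J (s - 1) C (genset C (Z0 \<union> (Z1 - {q})))"
      using Z(1-5) q by (intro fgI[of Z0 "Z1 - {q}"]) auto
  qed
  obtain x S and \<psi> :: "'v \<Rightarrow> (unit \<times> nat set \<Rightarrow>\<^sub>0 'k ratfun)"
    where x: "x \<in> Q" and S: "S \<inter> C = {}" "finite S" "card S = J"
    and \<psi>: "thom {} Q \<psi>" "\<psi> ` Q \<subseteq> TW (Gset {} J)" "Poly_Mapping.lookup (\<psi> x) ((), S) \<noteq> 0"
  proof -
    obtain q where q: "q \<in> Z1" using \<open>Z1 \<noteq> {}\<close> by blast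
    let ?L = "genset C (Z0 \<union> (Z1 - {q}))"
    note L = split[OF q]
    have "lev C J q" using Z(5) q by blast
    then obtain B where B: "finite B" "B \<inter> C = {}" "card B = J" "invar C B q" by (auto simp: lev_def)
    \<comment> \<open>A dependency would replace \<open>q\<close> by generators of smaller size,
      leaving only \<open>s - 1\<close> of size \<open>J\<close>.\<close>
    have nd: "\<not> depends C B q ?L"
    proof
      assume dep: "depends C B q ?L"
      show False
      proof (rule depends_smaller[OF C stab_genset B(1,2,4) dep])
        fix C' Z'
        assume *: "finite C'" "C \<subseteq> C'" "finite Z'" "\<And>y. y \<in> Z' \<Longrightarrow> \<exists>m < card B. lev C' m y"
          "span (?L \<union> genset C {q}) = span (?L \<union> genset C' Z')"
        have "fg J (s - 1 + 0) C' (span (?L \<union> genset C' Z'))"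
          using *(3,4) B(3) by (intro fg_sum fg_refine[OF L(2) *(1,2)] fg_lower) auto
        then show False using no_fg[OF *(1) _ Q(2-4)] L(1) *(5) by simp
      qed
    qed
    obtain g where g: "thom C Q g" "g ` Q \<subseteq> TW (Gset C J)" "\<And>x. x \<in> Q \<Longrightarrow> g x = 0 \<Longrightarrow> x \<in> ?L"
      using free_coordinates[OF stab_genset B(4,1,2) nd] unfolding L(1)[symmetric] B(3) by metis
    \<comment> \<open>The coordinates \<open>g\<close> are equivariant only under
      \<open>fixing C\<close>, and \<open>lift_nonzero\<close> needs a vector supported off
      \<open>C\<close> on which \<open>g\<close> does not vanish. If there were none, every vector
      of \<open>Q\<close> supported off \<open>C\<close> would lie in \<open>?L\<close>; moving all
      generators and \<open>C\<close> itself away from \<open>C\<close> then shows that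
      \<open>Q\<close> is the sum of \<open>?L\<close> and generators of smaller size, against
      minimality.\<close>
    have "\<exists>x A. x \<in> Q \<and> supports A x \<and> finite A \<and> A \<inter> C = {} \<and> g x \<noteq> 0"
    proof (rule ccontr)
      assume none: "\<nexists>x A. x \<in> Q \<and> supports A x \<and> finite A \<and> A \<inter> C = {} \<and> g x \<noteq> 0"
      have kill: "x \<in> ?L" if "x \<in> Q" "supports A x" "finite A" "A \<inter> C = {}" for x A
        using none that g(3) by blast
      have "\<forall>z\<in>Z0 \<union> Z1. \<exists>B. finite B \<and> B \<inter> C = {} \<and> invar C B z \<and> card B \<le> J \<and> (z \<in> Z0 \<longrightarrow> z \<notin> Z1 \<longrightarrow> card B < J)"
        using Z(4,5) unfolding lev_def by (metis UnE less_imp_le order_refl)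
      from bchoice[OF this] obtain b where b: "\<forall>z\<in>Z0 \<union> Z1. finite (b z) \<and> b z \<inter> C = {} \<and> invar C (b z) z \<and>
          card (b z) \<le> J \<and> (z \<in> Z0 \<longrightarrow> z \<notin> Z1 \<longrightarrow> card (b z) < J)" ..
      let ?Y = "C \<union> \<Union> (b ` (Z0 \<union> Z1))"
      have "finite ?Y" using C Z(1,2) b by blast
      then obtain \<tau> where \<tau>: "img \<tau> ?Y \<inter> C = {}" using ex_perm_avoid[of ?Y C "{}"] C by auto
      let ?C1 = "img \<tau> C" and ?C2 = "C \<union> img \<tau> C"
      have C2: "finite ?C2" "?C1 \<subseteq> ?C2" "C \<subseteq> ?C2" using C by auto
      have "\<exists>Y. finite Y \<and> (\<forall>y\<in>Y. \<exists>m<J. lev ?C2 m y) \<and> Y \<subseteq> Q \<and> act \<tau> ` {z} \<subseteq> Q \<and>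
          orb ?C1 {act \<tau> z} \<subseteq> span (?L \<union> genset ?C2 Y)" if z: "z \<in> Z0 \<union> Z1" for z
      proof -
        have bz: "finite (b z)" "b z \<inter> C = {}" "invar C (b z) z" "card (b z) \<le> J"
          "z \<in> Z0 \<Longrightarrow> z \<notin> Z1 \<Longrightarrow> card (b z) < J" using b z by blast+
        have inC: "img \<tau> (b z) \<inter> C = {}" "img \<tau> (b z) \<inter> ?C1 = {}"
          using \<tau> z bz(2) by (blast, simp flip: img_Int)
        have inv: "invar ?C1 (img \<tau> (b z)) (act \<tau> z)" by (rule invar_conj[OF bz(3)])
        have zQ: "act \<tau> z \<in> Q" using stab_act[OF Q(2)] ZQ z by auto
        have orbQ: "orb ?C1 {act \<tau> z} \<subseteq> Q" using zQ stab_act[OF Q(2)] by (auto simp: orb_def)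
        have "supports (?C1 \<union> img \<tau> (b z)) (act \<tau> z)" by (rule invar_supports[OF inv])
        then have zL: "act \<tau> z \<in> ?L"
          using \<tau> C bz(1) z by (intro kill[OF zQ]) blast+
        show ?thesis
        proof (rule refine[OF C2(1,2) _ inC(2) inv])
          show "finite (img \<tau> (b z))" using bz(1) by simp
          fix z0 Z'
          assume *: "finite Z'" "orb ?C1 {act \<tau> z} \<subseteq> orb ?C2 (insert z0 Z')" "insert z0 Z' \<subseteq> orb ?C1 {act \<tau> z}"
            "\<And>y. y \<in> Z' \<Longrightarrow> \<exists>m < card (img \<tau> (b z)). lev ?C2 m y" "img \<tau> (b z) \<inter> ?C2 = {} \<Longrightarrow> z0 = act \<tau> z"
          \<comment> \<open>Over the group fixing both \<open>C\<close> and its translate, the piece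
            of full size is the moved generator itself, which lies in \<open>?L\<close>.\<close>
          have z0: "z0 = act \<tau> z" using *(5) inC by blast
          have "orb ?C2 {z0} \<subseteq> ?L"
            by (rule order.trans[OF span_superset genset_minimal[OF stab_mono[OF stab_genset C2(3)]]]) (use zL z0 in simp)
          then have "orb ?C2 (insert z0 Z') \<subseteq> span (?L \<union> genset ?C2 Z')"
            using orb_Un[of ?C2 "{z0}" Z'] by (auto intro: span_base)
          then have "orb ?C1 {act \<tau> z} \<subseteq> span (?L \<union> genset ?C2 Z')" using *(2) by blast
          moreover have "\<forall>y\<in>Z'. \<exists>m<J. lev ?C2 m y" using *(4) bz(4) by (metis card_img less_le_trans)
          ultimately show ?thesis using *(1,3) orbQ zQ by (intro exI[of _ Z']) auto
        qed
      qed
      then have "\<forall>z\<in>Z0 \<union> Z1. \<exists>Y. finite Y \<and> (\<forall>y\<in>Y. \<exists>m<J. lev ?C2 m y) \<and> Y \<subseteq> Q \<and> act \<tau> ` {z} \<subseteq> Q \<and>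
          orb ?C1 {act \<tau> z} \<subseteq> span (?L \<union> genset ?C2 Y)" by blast
      from bchoice[OF this] obtain y where y: "\<forall>z\<in>Z0 \<union> Z1. finite (y z) \<and> (\<forall>u\<in>y z. \<exists>m<J. lev ?C2 m u) \<and>
          y z \<subseteq> Q \<and> act \<tau> ` {z} \<subseteq> Q \<and> orb ?C1 {act \<tau> z} \<subseteq> span (?L \<union> genset ?C2 (y z))" ..
      let ?Z = "\<Union> (y ` (Z0 \<union> Z1))"
      let ?R = "span (?L \<union> genset ?C2 ?Z)"
      have "fg J (s - 1 + 0) ?C2 ?R"
        using y Z(1,2) by (intro fg_sum fg_refine[OF L(2) C2(1,3)] fg_lower) auto
      moreover have "?R = Q"
      proof
        have "?L \<subseteq> Q" unfolding Z(6) by (intro span_mono orb_mono) blast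
        moreover have "?Z \<subseteq> Q" using y by blast
        then have "genset ?C2 ?Z \<subseteq> Q" by (rule genset_minimal[OF stab_mono[OF Q(2) empty_subsetI]])
        ultimately show "?R \<subseteq> Q" using stab_subspace[OF Q(2)] by (intro span_minimal) auto
        have "orb ?C1 (act \<tau> ` (Z0 \<union> Z1)) \<subseteq> ?R"
        proof
          fix u assume "u \<in> orb ?C1 (act \<tau> ` (Z0 \<union> Z1))"
          then obtain z where z: "z \<in> Z0 \<union> Z1" "u \<in> orb ?C1 {act \<tau> z}" by (auto simp: orb_def)
          then have "u \<in> span (?L \<union> genset ?C2 (y z))" using y by blast
          also have "\<dots> \<subseteq> ?R"
            using z(1) orb_mono[of "y z" ?Z ?C2] by (intro span_mono Un_mono span_mono) auto
          finally show "u \<in> ?R" .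
        qed
        then have sub: "genset ?C1 (act \<tau> ` (Z0 \<union> Z1)) \<subseteq> ?R" by (rule span_minimal) simp
        \<comment> \<open>As \<open>Q\<close> is stable under the full group, it is generated over
          the conjugate group by the moved generators.\<close>
        show "Q \<subseteq> ?R"
        proof
          fix u assume "u \<in> Q"
          then have "act (inverse \<tau>) u \<in> genset C (Z0 \<union> Z1)" using stab_act[OF Q(2)] Z(6) by auto
          from act_genset[OF this, of \<tau>] show "u \<in> ?R" using sub by auto
        qed
      qed
      ultimately show False using no_fg[OF C2(1) _ Q(2-4)] by simp
    qed
    then obtain x A where x: "x \<in> Q" "supports A x" "finite A" "A \<inter> C = {}" "g x \<noteq> 0" by blast
    then obtain w where w: "Poly_Mapping.lookup (g x) w \<noteq> 0" by (metis lookup_zero poly_mapping_eqI)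
    obtain u S where uS: "w = (u, S)" by (rule prod.exhaust)
    have mem: "w \<in> Gset C J" using w subsetD[OF g(2) imageI[OF x(1)]] unfolding TW_iff by blast
    then have S: "finite S" "card S = J" "S \<inter> C = {}" using uS by (auto simp: Gset_def)
    have "Gset C J \<subseteq> Gset {} J" by (auto simp: Gset_def)
    then have gW: "g ` Q \<subseteq> TW (Gset {} J)" using g(2) by (auto simp: TW_def)
    have "Poly_Mapping.lookup (g x) ((), S) \<noteq> 0" using w uS by simp
    then obtain \<psi> where "thom {} Q \<psi>" "\<psi> ` Q \<subseteq> TW (Gset {} J)" "Poly_Mapping.lookup (\<psi> x) ((), S) \<noteq> 0"
      using lift_nonzero[OF C g(1) Q(2) x(1-3) perm_closed_Gset gW _ x(4) S(3)] by blast
    then show thesis using that[OF x(1) S(3,1,2)] by blast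
  qed
  have QC: "x \<in> Q \<Longrightarrow> supports A x \<Longrightarrow> T.supports A (\<psi> x)" for x A
    using thom_supports[OF \<psi>(1), of x A] by simp
  have supp: "S' \<subseteq> A" if "x \<in> Q" "supports A x" "finite A" "Poly_Mapping.lookup (\<psi> x) (u, S') \<noteq> 0" for x A u S'
    by (rule T_keys_supports(1)[OF QC[OF that(1,2)] that(3) perm_closed_Gset subsetD[OF \<psi>(2) imageI[OF that(1)]]])
      (use that(4) in \<open>simp add: in_keys_iff\<close>)
  \<comment> \<open>The component of \<psi> at \<open>S\<close> cannot vanish on all translates of
    generators. A generator where it survives has size \<open>J\<close>, since \<open>S\<close> has
    \<open>J\<close> points, avoids \<open>C\<close> and lies in the support of the translate;
    moving back places the nonzero component at \<open>B\<close>.\<close>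
  obtain q B where q: "q \<in> Z1" and B: "finite B" "B \<inter> C = {}" "card B = J" "invar C B q"
    and qB: "Poly_Mapping.lookup (\<psi> q) ((), B) \<noteq> 0"
  proof -
    have "\<exists>z\<in>orb C (Z0 \<union> Z1). Poly_Mapping.lookup (\<psi> z) ((), S) \<noteq> 0"
    proof (rule ccontr)
      assume none: "\<not> (\<exists>z\<in>orb C (Z0 \<union> Z1). Poly_Mapping.lookup (\<psi> z) ((), S) \<noteq> 0)"
      have "x \<in> Q \<and> Poly_Mapping.lookup (\<psi> x) ((), S) = 0" if "x \<in> genset C (Z0 \<union> Z1)" for x
        using that
      proof (induction x rule: span_induct_alt)
        case base
        then show ?case
          using stab_subspace[OF Q(2)] hom_on_zero[OF \<psi>(1)] by (simp add: subspace_0)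
      next
        case (step c x y)
        have xQ: "x \<in> Q" unfolding Z(6) using step.hyps by (rule span_base)
        have cx: "c *s x \<in> Q" using stab_subspace[OF Q(2)] xQ by (rule subspace_scale)
        have "Poly_Mapping.lookup (\<psi> (c *s x + y)) ((), S) = 0"
          using hom_onD(1)[OF \<psi>(1) cx] hom_onD(2)[OF \<psi>(1) xQ] step none by (simp add: lookup_add)
        then show ?case using stab_subspace[OF Q(2)] cx step.IH by (simp add: subspace_add)
      qed
      then show False using x \<psi>(3) Z(6) by blast
    qed
    then obtain \<sigma> z where \<sigma>: "\<sigma> \<in> fixing C" "z \<in> Z0 \<union> Z1" "Poly_Mapping.lookup (\<psi> (act \<sigma> z)) ((), S) \<noteq> 0"
      by (auto simp: orb_def)
    have zQ: "z \<in> Q" using \<sigma>(2) ZQ by blast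
    have szQ: "act \<sigma> z \<in> Q" using stab_act[OF Q(2) _ zQ] by simp
    have *: "card B \<ge> J \<and> (card B = J \<longrightarrow> S = img \<sigma> B)" if B: "finite B" "invar C B z" for B
    proof -
      have "supports (C \<union> img \<sigma> B) (act \<sigma> z)" by (rule invar_supports[OF invar_act[OF B(2) \<sigma>(1)]])
      then have "S \<subseteq> C \<union> img \<sigma> B" using C B(1) \<sigma>(3) by (intro supp[OF szQ]) auto
      then have "S \<subseteq> img \<sigma> B" using S(1) by blast
      then show ?thesis using S(3) B(1) by (metis card_img card_mono card_subset_eq finite_img)
    qed
    have "z \<in> Z1"
    proof (rule ccontr)
      assume "z \<notin> Z1"
      then obtain m where "m < J" "lev C m z" using Z(4) \<sigma>(2) by blast
      then show False using * by (fastforce simp: lev_def)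
    qed
    then have "lev C J z" using Z(5) by blast
    then obtain B where B: "finite B" "B \<inter> C = {}" "card B = J" "invar C B z" by (auto simp: lev_def)
    have SB: "S = img \<sigma> B" using *[OF B(1,4)] B(3) by blast
    have "\<psi> (act \<sigma> z) = tact \<sigma> (\<psi> z)" using hom_onD(3)[OF \<psi>(1) zQ] by simp
    then have "Poly_Mapping.lookup (\<psi> z) ((), B) \<noteq> 0" using \<sigma>(3) unfolding SB by simp
    then show thesis using that[OF \<open>z \<in> Z1\<close> B] by blast
  qed
  let ?K = "{x\<in>Q. \<psi> x = 0}"
  have sQ: "subspace Q" using Q(2) by (rule stab_subspace)
  have K: "stab {} ?K"
    unfolding stab_def
  proof (intro conjI subspaceI ballI)
    show "0 \<in> ?K" using subspace_0[OF sQ] hom_on_zero[OF \<psi>(1)] by simp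
    show "x + y \<in> ?K" if "x \<in> ?K" "y \<in> ?K" for x y
      using that hom_onD(1)[OF \<psi>(1)] subspace_add[OF sQ] by simp
    show "c *s x \<in> ?K" if "x \<in> ?K" for c x
      using that hom_onD(2)[OF \<psi>(1)] subspace_scale[OF sQ] by simp
    show "act \<sigma> x \<in> ?K" if "x \<in> ?K" for \<sigma> x
      using that hom_onD(3)[OF \<psi>(1)] stab_act[OF Q(2)] by simp
  qed
  have KC: "stab C ?K" using K by (rule stab_mono) simp
  have qQ: "q \<in> Q" using q ZQ by blast
  \<comment> \<open>A translate of \<open>q\<close> with another image of \<open>B\<close> has a
    support that does not contain \<open>B\<close>, so its component at \<open>B\<close> is zero, as
    it is on the kernel; that of \<open>q\<close> is not.\<close>
  have nd: "\<not> depends C B q ?K"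
  proof
    let ?O = "(\<lambda>\<sigma>. act \<sigma> q) ` {\<sigma>\<in>fixing C. img \<sigma> B \<noteq> B}"
    assume "depends C B q ?K"
    then have "q \<in> span (?K \<union> ?O)" by (simp add: depends_def)
    then have "q \<in> Q \<and> Poly_Mapping.lookup (\<psi> q) ((), B) = 0"
    proof (induction q rule: span_induct_alt)
      case base
      then show ?case using subspace_0[OF sQ] hom_on_zero[OF \<psi>(1)] by simp
    next
      case (step c y y')
      have y: "y \<in> Q \<and> Poly_Mapping.lookup (\<psi> y) ((), B) = 0"
      proof (cases "y \<in> ?K")
        case True then show ?thesis by simp
      next
        case False
        then obtain \<sigma> where \<sigma>: "\<sigma> \<in> fixing C" "img \<sigma> B \<noteq> B" "y = act \<sigma> q" using step.hyps by blast
        have yQ: "y \<in> Q" using stab_act[OF Q(2) _ qQ] \<sigma>(3) by simp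
        have "Poly_Mapping.lookup (\<psi> y) ((), B) = 0"
        proof (rule ccontr)
          assume "Poly_Mapping.lookup (\<psi> y) ((), B) \<noteq> 0"
          moreover have "supports (C \<union> img \<sigma> B) y" unfolding \<sigma>(3) by (rule invar_supports[OF invar_act[OF B(4) \<sigma>(1)]])
          ultimately have "B \<subseteq> C \<union> img \<sigma> B" using C B(1) by (intro supp[OF yQ]) auto
          then have "B \<subseteq> img \<sigma> B" using B(2) by blast
          then show False using \<sigma>(2) B(1) by (metis card_img card_subset_eq finite_img)
        qed
        then show ?thesis using yQ by simp
      qed
      have cy: "c *s y \<in> Q" using y subspace_scale[OF sQ] by blast
      have "\<psi> (c *s y + y') = tscale c (\<psi> y) + \<psi> y'"
        using hom_onD(1)[OF \<psi>(1) cy] hom_onD(2)[OF \<psi>(1)] y step.IH by simp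
      then show ?case using y step.IH subspace_add[OF sQ cy] by (simp add: lookup_add)
    qed
    then show False using qB by blast
  qed
  have Kq: "?K \<inter> genset C {q} = {0}" by (rule indep_Int[OF KC B(4,1,2) nd])
  let ?N = "span (?K \<union> genset C {q})"
  have NC: "stab C ?N" by (intro stab_sum KC stab_genset)
  have gqQ: "genset C {q} \<subseteq> Q" using qQ by (intro genset_minimal[OF stab_mono[OF Q(2)]]) auto
  have NQ: "?N \<subseteq> Q" using gqQ sQ by (intro span_minimal) auto
  have "splits C ?N (genset C (Z0 \<union> Z1))"
    using Z(1,2,4,5) by (intro splits_genset[OF C NC]) auto
  then obtain C' D where D: "finite C'" "C \<subseteq> C'" "stab C' D" "?N \<inter> D = {0}" "span (?N \<union> D) = span (?N \<union> Q)"
    unfolding splits_def Z(6)[symmetric] by (elim exE conjE) (rule that)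
  have "span (?N \<union> Q) = Q" using NQ sQ by (simp add: Un_absorb1)
  then have ND: "span (?N \<union> D) = Q" using D(5) by simp
  \<comment> \<open>A complement of the kernel that contains \<open>q\<close>: the projection onto
    the kernel along \<open>?E\<close> kills \<open>q\<close>, so the kernel is the image of the
    subspace generated without \<open>q\<close> and has only \<open>s - 1\<close> generators of size
    \<open>J\<close>.\<close>
  let ?E = "span (genset C {q} \<union> D)"
  have E: "stab C' ?E" by (intro stab_sum D(3) stab_mono[OF stab_genset D(2)])
  have KC': "stab C' ?K" using K by (rule stab_mono) simp
  have sD: "subspace D" using D(3) by (rule stab_subspace)
  have KE: "?K \<inter> ?E = {0}"
  proof -
    have "x = 0" if x: "x \<in> ?K" "x \<in> ?E" for x
    proof -
      from iffD1[OF subspace_span_Un[OF subspace_span sD] x(2)]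
      obtain a d where ad: "a \<in> genset C {q}" "d \<in> D" "x = a + d" by (elim bexE) (rule that)
      have "x - a \<in> ?N" using x(1) ad(1) by (intro span_diff span_base) blast+
      then have "d \<in> ?N" using ad(3) by simp
      then have "d = 0" using D(4) ad(2) by blast
      then have "x \<in> genset C {q}" using ad by simp
      then show ?thesis using x(1) Kq by blast
    qed
    then show ?thesis using subspace_0[OF stab_subspace[OF K]] span_zero by auto
  qed
  have KEQ: "span (?K \<union> ?E) = Q"
  proof -
    have "span (?K \<union> ?E) = span ((?K \<union> genset C {q}) \<union> D)" by (simp only: span_absorb Un_assoc)
    also have "\<dots> = span (?N \<union> D)" by (rule span_Un_cong) (rule span_span[symmetric])
    finally show ?thesis using ND by simp
  qed
  let ?\<pi> = "pr ?K ?E"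
  let ?L = "genset C (Z0 \<union> (Z1 - {q}))"
  have sK: "subspace ?K" using K by (rule stab_subspace)
  have pi: "hom_on scale act scale act C' Q ?\<pi>" using pr_hom[OF KC' E KE] unfolding KEQ .
  have LQ: "?L \<subseteq> Q" unfolding Z(6) by (intro span_mono orb_mono) blast
  have "?\<pi> ` ?L = ?K"
  proof
    show "?\<pi> ` ?L \<subseteq> ?K" using pr_in(1)[OF sK subspace_span KE] LQ unfolding KEQ by blast
    show "?K \<subseteq> ?\<pi> ` ?L"
    proof
      fix x assume x: "x \<in> ?K"
      then have "x \<in> span (?L \<union> genset C {q})" using split(1)[OF q] by blast
      from iffD1[OF subspace_span_Un[OF subspace_span subspace_span] this]
      obtain l a where la: "l \<in> ?L" "a \<in> genset C {q}" "x = l + a" by (elim bexE) (rule that)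
      have "?\<pi> a = 0" using la(2) by (intro pr_zero[OF sK subspace_span KE] span_base) blast
      then have "?\<pi> x = ?\<pi> l" using hom_onD(1)[OF pi, of l a] la LQ gqQ by auto
      moreover have "?\<pi> x = x" by (rule pr_id[OF sK subspace_span KE x])
      ultimately have "x = ?\<pi> l" by (simp only:)
      then show "x \<in> ?\<pi> ` ?L" using la(1) by (rule image_eqI)
    qed
  qed
  moreover have "fg J (s - 1) C' (?\<pi> ` ?L)"
    by (rule fg_image[OF fg_refine[OF split(2)[OF q] D(1,2)] hom_on_mono[OF pi subset_refl LQ]])
  ultimately have fgK: "fg J (s - 1) C' ?K" by (simp only:)
  have "?K \<subseteq> M" using Q(3) by blast
  then have "?K = {0}" using no_fg[OF D(1) fgK K] by blast
  then have "x = 0" if "x \<in> Q" "\<psi> x = 0" for x using that by blast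
  moreover have "P = {0}" if "finite C" "fg J 0 C P" "stab {} P" "P \<subseteq> M" for C P
    using badI[OF that] bad0 by blast
  ultimately show thesis using that[OF Q(2-4) \<psi>(1,2)] by blast
qed

text \<open>The vector \<open>p\<close> is the image of a basis vector under a map \<eta> that
  extends the inverse of the embedding \<psi>. It is nonzero, as otherwise \<eta> and then
  \<open>Q\<close> would vanish; and a dependency would make it generate a nonzero subrepresentation
  of \<open>M\<close> from sizes below \<open>J\<close>, which minimality excludes. The hypothesis
  \<open>inj\<close> is injectivity for embeddings into a single \<open>Iobj J\<close>.\<close>

lemma injective_has_free_vector:
  assumes M: "stab {} M" "M \<noteq> {0}"
    and inj: "\<And>J Q \<psi>. stab {} Q \<Longrightarrow> Q \<subseteq> M \<Longrightarrow> thom {} Q \<psi> \<Longrightarrow> \<psi> ` Q \<subseteq> TW (Gset {} J) \<Longrightarrow> inj_on \<psi> Q \<Longrightarrow>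
      \<exists>\<eta>. hom_on tscale tact scale act {} (TW (Gset {} J)) \<eta> \<and> \<eta> ` TW (Gset {} J) \<subseteq> M \<and> (\<forall>x\<in>Q. \<eta> (\<psi> x) = x)"
  shows "\<exists>p\<in>M. \<exists>r. invar {} {..<r} p \<and> \<not> depends {} {..<r} p {0}"
proof (rule minimal_embeds[OF M])
  fix J Q and \<psi> :: "'v \<Rightarrow> (unit \<times> nat set \<Rightarrow>\<^sub>0 'k ratfun)"
  assume Q: "stab {} Q" "Q \<subseteq> M" "Q \<noteq> {0}" "thom {} Q \<psi>" "\<psi> ` Q \<subseteq> TW (Gset {} J)"
    "\<And>x. x \<in> Q \<Longrightarrow> \<psi> x = 0 \<Longrightarrow> x = 0"
    and small: "\<And>C P. finite C \<Longrightarrow> fg J 0 C P \<Longrightarrow> stab {} P \<Longrightarrow> P \<subseteq> M \<Longrightarrow> P = {0}"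
  have sQ: "subspace Q" using Q(1) by (rule stab_subspace)
  have "inj_on \<psi> Q"
  proof (rule inj_onI)
    fix x y assume xy: "x \<in> Q" "y \<in> Q" "\<psi> x = \<psi> y"
    have y: "(- 1) *s y \<in> Q" using sQ xy(2) by (rule subspace_scale)
    have "\<psi> (x + (- 1) *s y) = \<psi> x + tscale (- 1) (\<psi> y)"
      unfolding hom_onD(1)[OF Q(4) xy(1) y] hom_onD(2)[OF Q(4) xy(2)] by (rule refl)
    then have "\<psi> (x - y) = 0" using xy(3) by simp
    then show "x = y" using Q(6)[of "x - y"] subspace_diff[OF sQ xy(1,2)] by simp
  qed
  then obtain \<eta> where \<eta>: "hom_on tscale tact scale act {} (TW (Gset {} J)) \<eta>"
    "\<eta> ` TW (Gset {} J) \<subseteq> M" "\<forall>x\<in>Q. \<eta> (\<psi> x) = x"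
    using inj[OF Q(1,2,4,5)] by blast
  have single: "Poly_Mapping.single (u, S) 1 \<in> TW (Gset {} J)" if "finite S" "card S = J" for u S
    using that by (auto simp: TW_iff Gset_def lookup_single when_def)
  have tact_single: "tact \<sigma> (Poly_Mapping.single (u, S) 1) = Poly_Mapping.single (u, img \<sigma> S) 1" for \<sigma> u S
  proof (rule poly_mapping_eqI, clarify)
    fix v T
    have "S = img (inverse \<sigma>) T \<longleftrightarrow> img \<sigma> S = T" by (metis img_inverse)
    then show "Poly_Mapping.lookup (tact \<sigma> (Poly_Mapping.single (u, S) 1)) (v, T) =
        Poly_Mapping.lookup (Poly_Mapping.single (u, img \<sigma> S) 1) (v, T)"
      by (simp add: lookup_single when_def)
  qed
  define p where "p = \<eta> (Poly_Mapping.single ((), {..<J}) 1)"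
  have act_p: "act \<sigma> p = \<eta> (Poly_Mapping.single ((), img \<sigma> {..<J}) 1)" for \<sigma>
    unfolding p_def using hom_onD(3)[OF \<eta>(1) single, of "{..<J}" \<sigma>] by (simp add: tact_single)
  have pM: "p \<in> M" unfolding p_def by (intro subsetD[OF \<eta>(2)] imageI single) simp_all
  have inv: "invar {} {..<J} p" unfolding invar_def using act_p by (auto simp: p_def)
  have "p \<noteq> 0"
  proof
    assume "p = 0"
    have z: "\<eta> (Poly_Mapping.single w 1) = 0" if w: "w \<in> Gset {} J" for w
    proof -
      obtain u S where uS: "w = (u, S)" by (rule prod.exhaust)
      then obtain \<sigma> where "S = img \<sigma> {..<J}" using Gset_imgE[of u S "{}" "{..<J}"] w by auto
      then show ?thesis using act_p[of \<sigma>] \<open>p = 0\<close> uS by simp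
    qed
    have "x = 0" if "x \<in> Q" for x
      using hom_on_single[OF \<eta>(1) _ z, of "\<psi> x"] \<eta>(3) Q(5) that by auto
    then show False using Q(3) subspace_0[OF sQ] by blast
  qed
  have "\<not> depends {} {..<J} p {0}"
  proof
    assume dep: "depends {} {..<J} p {0}"
    show False
    proof (rule depends_smaller[OF _ _ _ _ inv dep])
      fix C' Z'
      assume *: "finite C'" "finite Z'" "\<And>y. y \<in> Z' \<Longrightarrow> \<exists>m < card {..<J}. lev C' m y"
        "span ({0} \<union> genset {} {p}) = span ({0} \<union> genset C' Z')"
      have "genset {} {p} = genset C' Z'" using *(4) by (simp add: span_span)
      then have "fg J 0 C' (genset {} {p})" using fg_lower[OF *(2)] *(3) by simp
      moreover have "genset {} {p} \<subseteq> M" using pM by (intro genset_minimal[OF M(1)]) simp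
      ultimately have "genset {} {p} = {0}" using small[OF *(1)] stab_genset by blast
      then show False using \<open>p \<noteq> 0\<close> genset_base[of p "{p}" "{}"] by blast
    qed simp_all
  qed
  then show ?thesis using pM inv by blast
qed

end

hide_const (open) Polynomial.smult Multiset.mult

section \<open>Realising a representation on a type\<close>

text \<open>The quotient by \<open>N\<close> is modelled on the same type. A projection
  \<open>g\<close> onto \<open>N\<close>, merely linear and not equivariant, gives the map
  \<open>P\<close> with kernel \<open>N\<close>, whose range stands for the quotient.\<close>

lemma (in smooth_semirep) quotient_action:
  assumes N: "stab {} N"
  obtains ac P where "smooth_semirep scale ac" "\<And>x y. P (x + y) = P x + P y" "\<And>c x. P (c *s x) = c *s P x"
    "\<And>x. P x = 0 \<longleftrightarrow> x \<in> N" "\<And>\<sigma> x. ac \<sigma> (P x) = P (act \<sigma> x)"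
proof -
  interpret vector_space_pair scale scale ..
  have sN: "subspace N" using N by (rule stab_subspace)
  have "\<exists>g. g ` UNIV \<subseteq> N \<and> Vector_Spaces.linear scale scale g \<and> (\<forall>v\<in>N. g (id v) = v)"
    by (rule linear_exists_left_inverse_on[OF linear_id sN]) simp
  then obtain g where g: "range g \<subseteq> N" "Vector_Spaces.linear scale scale g" "\<And>v. v \<in> N \<Longrightarrow> g v = v" by auto
  interpret g: Vector_Spaces.linear scale scale g by (rule g(2))
  define P where "P x = x - g x" for x
  \<comment> \<open>The quotient action on the range of \<open>P\<close> and the old action on
    \<open>N\<close>: together they act on the whole type, as the locale demands.\<close>
  define ac where "ac \<sigma> x = P (act \<sigma> (P x)) + act \<sigma> (g x)" for \<sigma> x
  have gN: "g x \<in> N" for x using g(1) by blast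
  have P_add: "P (x + y) = P x + P y" for x y by (simp add: P_def g.add)
  have P_scale: "P (c *s x) = c *s P x" for c x by (simp add: P_def g.scale scale_right_diff_distrib)
  have P_diff: "P (x - y) = P x - P y" for x y by (simp add: P_def g.diff)
  have P0: "P x = 0 \<longleftrightarrow> x \<in> N" for x
    using g(3)[of x] gN[of x] by (auto simp: P_def)
  have gP: "g (P x) = 0" for x by (simp add: P_def g.diff g(3)[OF gN])
  have PP: "P (P x) = P x" for x by (simp add: P_def[of "P x"] gP)
  have split: "P x + g x = x" for x by (simp add: P_def)
  have actN: "act \<sigma> x \<in> N" if "x \<in> N" for \<sigma> x using stab_act[OF N _ that] by simp
  have PactP: "P (act \<sigma> (P x)) = P (act \<sigma> x)" for \<sigma> x
    unfolding P_def[of x] act_diff P_diff using P0[of "act \<sigma> (g x)"] actN[OF gN] by simp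
  have P_ac: "P (ac \<sigma> x) = P (act \<sigma> x)" for \<sigma> x
    using P0[of "act \<sigma> (g x)"] actN[OF gN] by (simp add: ac_def P_add PP PactP)
  have g_ac: "g (ac \<sigma> x) = act \<sigma> (g x)" for \<sigma> x
    by (simp add: ac_def g.add gP g(3)[OF actN[OF gN]])
  have ac': "ac \<sigma> x = P (act \<sigma> x) + act \<sigma> (g x)" for \<sigma> x by (simp add: ac_def PactP)
  interpret ac: semirep scale ac
  proof (unfold_locales)
    fix \<sigma> \<tau> v w a
    show "ac 1 v = v" by (simp add: ac' split)
    show "ac (\<sigma> * \<tau>) v = ac \<sigma> (ac \<tau> v)"
    proof -
      have "P (act \<sigma> (ac \<tau> v)) = P (act \<sigma> (P (ac \<tau> v)))" by (simp add: PactP)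
      also have "\<dots> = P (act (\<sigma> * \<tau>) v)" by (simp add: P_ac PactP act_mult)
      finally show ?thesis by (simp add: ac'[of \<sigma> "ac \<tau> v"] ac'[of "\<sigma> * \<tau>"] g_ac act_mult)
    qed
    show "ac \<sigma> (v + w) = ac \<sigma> v + ac \<sigma> w" by (simp add: ac' act_add P_add g.add)
    show "ac \<sigma> (a *s v) = perm_ratfun \<sigma> a *s ac \<sigma> v"
      by (simp add: ac' act_scale P_scale g.scale scale_right_distrib)
  qed
  have "smooth_semirep scale ac"
  proof (unfold_locales)
    fix x
    obtain A where A: "finite A" "supports A x" using smooth by blast
    obtain B where B: "finite B" "supports B (g x)" using smooth by blast
    have "ac \<sigma> x = x" if "\<sigma> \<in> fixing (A \<union> B)" for \<sigma>
      using that supportsD[OF A(2)] supportsD[OF B(2)] by (simp add: fixing_Un ac' split)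
    then show "\<exists>A. finite A \<and> ac.supports A x"
      using A(1) B(1) by (intro exI[of _ "A \<union> B"]) (simp add: ac.supports_def)
  qed
  moreover have "ac \<sigma> (P x) = P (act \<sigma> x)" for \<sigma> x by (simp add: ac_def PP gP PactP)
  ultimately show thesis using that P_add P_scale P0 by blast
qed

section \<open>The free vector space on the elements of an object\<close>

context smooth_semilinear
begin

text \<open>Extended by the identity outside the carrier, so that it permutes the whole type and
  therefore acts on all finitely supported functions.\<close>

definition total_act :: "nat perm \<Rightarrow> 'a \<Rightarrow> 'a" where
  "total_act \<sigma> x = (if x \<in> carrier M then act M \<sigma> x else x)"

lemma total_act_simps [simp]:
  "total_act 1 x = x" "total_act \<sigma> (total_act \<tau> x) = total_act (\<sigma> * \<tau>) x"
  "total_act \<sigma> x \<in> carrier M \<longleftrightarrow> x \<in> carrier M"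
  by (auto simp: total_act_def act_one act_mult act_closed)

definition pact :: "nat perm \<Rightarrow> ('a \<Rightarrow>\<^sub>0 'k ratfun) \<Rightarrow> ('a \<Rightarrow>\<^sub>0 'k ratfun)" where
  "pact \<sigma> v = Poly_Mapping.map (perm_ratfun \<sigma>) (Poly_Mapping.map_key (total_act (inverse \<sigma>)) v)"

lemma inj_total_act: "inj (total_act \<sigma>)"
  by (rule inj_on_inverseI[where g = "total_act (inverse \<sigma>)"]) simp

lemma lookup_pact [simp]:
  "Poly_Mapping.lookup (pact \<sigma> v) x = perm_ratfun \<sigma> (Poly_Mapping.lookup v (total_act (inverse \<sigma>) x))"
  using lookup_map_0[of "perm_ratfun \<sigma>" "Poly_Mapping.map_key (total_act (inverse \<sigma>)) v" x]
  by (simp add: pact_def map_key.rep_eq[OF inj_total_act])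

lemma pact_single: "pact \<sigma> (Poly_Mapping.single x c) = Poly_Mapping.single (total_act \<sigma> x) (perm_ratfun \<sigma> c)"
proof (rule poly_mapping_eqI)
  fix y
  have "x = total_act (inverse \<sigma>) y \<longleftrightarrow> total_act \<sigma> x = y"
    by (metis perm.left_inverse perm.right_inverse total_act_simps(1,2))
  then show "Poly_Mapping.lookup (pact \<sigma> (Poly_Mapping.single x c)) y =
      Poly_Mapping.lookup (Poly_Mapping.single (total_act \<sigma> x) (perm_ratfun \<sigma> c)) y"
    by (simp add: lookup_single when_def)
qed

lemma semirep_pact: "semirep tscale pact"
proof (intro semirep.intro semirep_axioms.intro vector_space_tscale)
  fix \<sigma> \<tau> and z w :: "'a \<Rightarrow>\<^sub>0 'k ratfun" and a
  show "pact (\<sigma> * \<tau>) z = pact \<sigma> (pact \<tau> z)"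
    by (rule poly_mapping_eqI) (simp add: perm_ratfun_mult_perm)
  show "pact 1 z = z" by (rule poly_mapping_eqI) simp
  show "pact \<sigma> (z + w) = pact \<sigma> z + pact \<sigma> w"
    by (rule poly_mapping_eqI) (simp add: lookup_add perm_ratfun_add)
  show "pact \<sigma> (tscale a z) = tscale (perm_ratfun \<sigma> a) (pact \<sigma> z)"
    by (rule poly_mapping_eqI) (simp add: perm_ratfun_mult)
qed

lemma smooth_semirep_pact: "smooth_semirep tscale pact"
proof -
  interpret semirep tscale pact by (rule semirep_pact)
  have "\<exists>A. finite A \<and> supports A v" for v
  proof (induction v rule: poly_mapping_add_induct)
    case zero show ?case by (intro exI[of _ "{}"]) simp
  next
    case (add p x c)
    obtain A where A: "finite A" "supports A p" using add by blast
    obtain B where B: "finite B" "K.supports B c" using K_smooth by blast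
    obtain n where n: "\<forall>\<sigma>. (\<forall>i<n. \<sigma> \<langle>$\<rangle> i = i) \<longrightarrow> total_act \<sigma> x = x"
      using local.smooth[of x] by (cases "x \<in> carrier M") (auto simp: total_act_def)
    have "supports (B \<union> {..<n}) (Poly_Mapping.single x c)"
      unfolding supports_def fixing_Un
      using n K.supportsD[OF B(2)] by (auto simp: pact_single fixing_def)
    then have "supports (A \<union> (B \<union> {..<n})) (Poly_Mapping.single x c + p)"
      using A(2) by (intro supports_add) (auto intro: supports_mono)
    then show ?case using A(1) B(1) by (intro exI[of _ "A \<union> (B \<union> {..<n})"]) simp
  qed
  then show ?thesis by unfold_locales
qed

lemma zero_smult: "x \<in> carrier M \<Longrightarrow> 0 \<odot> x = \<zero>"
  using smult_l_null[of x] by simp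

text \<open>Evaluation of formal linear combinations in \<open>M\<close>; basis elements outside the
  carrier count as zero.\<close>

definition lin :: "('a \<Rightarrow>\<^sub>0 'k ratfun) \<Rightarrow> 'a" where
  "lin v = finsum M (\<lambda>x. Poly_Mapping.lookup v x \<odot> x) (Poly_Mapping.keys v \<inter> carrier M)"

lemma lin_superset:
  assumes "finite F" "Poly_Mapping.keys v \<inter> carrier M \<subseteq> F" "F \<subseteq> carrier M"
  shows "lin v = finsum M (\<lambda>x. Poly_Mapping.lookup v x \<odot> x) F"
  unfolding lin_def
proof (rule add.finprod_mono_neutral_cong_left[OF assms(1,2)])
  show "Poly_Mapping.lookup v x \<odot> x = \<zero>" if "x \<in> F - Poly_Mapping.keys v \<inter> carrier M" for x
    using that assms(3) by (auto simp: in_keys_iff zero_smult)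
  show "(\<lambda>x. Poly_Mapping.lookup v x \<odot> x) \<in> F \<rightarrow> carrier M"
    using assms(3) by auto
qed simp

lemma lin_closed [simp]: "lin v \<in> carrier M"
  unfolding lin_def by (intro finsum_closed) auto

lemma lin_add: "lin (v + w) = lin v \<oplus> lin w"
proof -
  let ?F = "(Poly_Mapping.keys v \<union> Poly_Mapping.keys w) \<inter> carrier M"
  have F: "finite ?F" by simp
  have "lin (v + w) = finsum M (\<lambda>x. Poly_Mapping.lookup (v + w) x \<odot> x) ?F"
    using Poly_Mapping.keys_add[of v w] by (intro lin_superset) auto
  also have "\<dots> = finsum M (\<lambda>x. Poly_Mapping.lookup v x \<odot> x \<oplus> Poly_Mapping.lookup w x \<odot> x) ?F"
    using smult_l_distr by (intro finsum_cong') (auto simp: lookup_add)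
  also have "\<dots> = finsum M (\<lambda>x. Poly_Mapping.lookup v x \<odot> x) ?F \<oplus> finsum M (\<lambda>x. Poly_Mapping.lookup w x \<odot> x) ?F"
    by (rule finsum_addf) auto
  also have "\<dots> = lin v \<oplus> lin w"
    by (intro arg_cong2[where f = "(\<oplus>)"] lin_superset[symmetric]) auto
  finally show ?thesis .
qed

lemma lin_single: "lin (Poly_Mapping.single x c) = (if x \<in> carrier M then c \<odot> x else \<zero>)"
proof (cases "x \<in> carrier M")
  case True
  have "lin (Poly_Mapping.single x c) = finsum M (\<lambda>y. Poly_Mapping.lookup (Poly_Mapping.single x c) y \<odot> y) {x}"
    using True by (intro lin_superset) auto
  also have "\<dots> = c \<odot> x" using True by simp
  finally show ?thesis using True by simp
next
  case False
  then have "Poly_Mapping.keys (Poly_Mapping.single x c) \<inter> carrier M = {}" by auto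
  then show ?thesis using False by (simp add: lin_def)
qed

lemma lin_0: "lin 0 = \<zero>"
  by (simp add: lin_def)

lemma lin_tscale: "lin (tscale a v) = a \<odot> lin v"
proof (induction v rule: poly_mapping_add_induct)
  case zero
  have "tscale a 0 = (0 :: 'a \<Rightarrow>\<^sub>0 'k ratfun)" by (rule poly_mapping_eqI) simp
  then show ?case using smult_r_null[of a] by (simp add: lin_0)
next
  case (add p x c)
  have "tscale a (Poly_Mapping.single x c + p) = Poly_Mapping.single x (a * c) + tscale a p"
    by (rule poly_mapping_eqI) (simp add: lookup_add lookup_single when_def distrib_left)
  then show ?case
    using add.IH smult_r_null[of a] smult_assoc1[of a c x] smult_r_distr[of a] by (simp add: lin_add lin_single)
qed

lemma lin_pact: "lin (pact \<sigma> v) = act M \<sigma> (lin v)"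
proof (induction v rule: poly_mapping_add_induct)
  case zero
  have "pact \<sigma> 0 = 0" by (rule poly_mapping_eqI) simp
  then show ?case by (simp add: lin_0 act_zero)
next
  case (add p x c)
  have "pact \<sigma> (Poly_Mapping.single x c + p) = pact \<sigma> (Poly_Mapping.single x c) + pact \<sigma> p"
    by (rule poly_mapping_eqI) (simp add: lookup_add perm_ratfun_add)
  then show ?case
    using add.IH by (simp add: lin_add lin_single pact_single act_add act_zero act_smult) (simp add: total_act_def act_smult)
qed

text \<open>\<open>M\<close> is the quotient of the free vector space on its elements by the kernel
  of \<open>lin\<close>, and \<open>quotient_action\<close> places this quotient on the type of
  finitely supported functions. The embedding \<beta> sends an element to the class of its basis
  vector.\<close>

lemma realisation:
  obtains ac and \<beta> :: "'a \<Rightarrow> ('a \<Rightarrow>\<^sub>0 'k ratfun)"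
  where "smooth_semirep tscale ac" "inj_on \<beta> (carrier M)"
    "\<And>x y. x \<in> carrier M \<Longrightarrow> y \<in> carrier M \<Longrightarrow> \<beta> (x \<oplus> y) = \<beta> x + \<beta> y"
    "\<And>a x. x \<in> carrier M \<Longrightarrow> \<beta> (a \<odot> x) = tscale a (\<beta> x)"
    "\<And>\<sigma> x. x \<in> carrier M \<Longrightarrow> \<beta> (act M \<sigma> x) = ac \<sigma> (\<beta> x)"
proof -
  interpret P: smooth_semirep tscale pact by (rule smooth_semirep_pact)
  let ?N = "{v. lin v = \<zero>}"
  have N: "P.stab {} ?N"
    unfolding P.stab_def P.subspace_def
    using smult_r_null by (auto simp: lin_0 lin_add lin_tscale lin_pact act_zero)
  show thesis
  proof (rule P.quotient_action[OF N])
    fix ac and p :: "('a \<Rightarrow>\<^sub>0 'k ratfun) \<Rightarrow> ('a \<Rightarrow>\<^sub>0 'k ratfun)"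
    assume p: "smooth_semirep tscale ac" "\<And>x y. p (x + y) = p x + p y" "\<And>c x. p (tscale c x) = tscale c (p x)"
      "\<And>x. p x = 0 \<longleftrightarrow> x \<in> ?N" "\<And>\<sigma> x. ac \<sigma> (p x) = p (pact \<sigma> x)"
    have neg: "tscale (- 1) z = - z" for z :: "'a \<Rightarrow>\<^sub>0 'k ratfun"
      by (rule poly_mapping_eqI) simp
    note p4 = p(4)[unfolded mem_Collect_eq]
    have eq: "p v = p w" if "lin v = lin w" for v w
    proof -
      have "lin (v + tscale (- 1) w) = lin v \<oplus> (- 1) \<odot> lin v"
        by (simp only: lin_add lin_tscale that)
      also have "\<dots> = (1 + - 1) \<odot> lin v"
        using smult_l_distr[of 1 "- 1" "lin v"] smult_one[of "lin v"] by simp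
      also have "\<dots> = \<zero>" by (simp add: zero_smult)
      finally have "p (v + tscale (- 1) w) = 0" by (simp only: p4)
      then have "p v + tscale (- 1) (p w) = 0" by (simp only: p(2,3))
      then have "p v + - p w = 0" unfolding neg .
      then show ?thesis by (simp only: add_uminus_conv_diff right_minus_eq)
    qed
    have eq': "lin v = lin w" if "p v = p w" for v w
    proof -
      have "p (v + tscale (- 1) w) = 0" unfolding p(2,3) that unfolding neg by (rule right_minus)
      then have "lin v \<oplus> lin (tscale (- 1) w) = \<zero>" by (simp only: p4 lin_add)
      moreover have "lin w \<oplus> lin (tscale (- 1) w) = \<zero>"
      proof -
        have "p (w + tscale (- 1) w) = 0" unfolding p(2,3) unfolding neg by (rule right_minus)
        then show ?thesis by (simp only: p4 lin_add)
      qed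
      ultimately show ?thesis
        by (metis add.right_cancel lin_closed)
    qed
    define \<beta> where "\<beta> x = p (Poly_Mapping.single x 1)" for x
    have lin1: "lin (Poly_Mapping.single x 1) = x" if "x \<in> carrier M" for x
      using that smult_one[of x] by (simp add: lin_single)
    show thesis
    proof (rule that[OF p(1)])
      show "inj_on \<beta> (carrier M)"
        by (rule inj_onI) (metis \<beta>_def eq' lin1)
      show "\<beta> (x \<oplus> y) = \<beta> x + \<beta> y" if "x \<in> carrier M" "y \<in> carrier M" for x y
        unfolding \<beta>_def p(2)[symmetric] using that by (intro eq) (simp add: lin_add lin1)
      show "\<beta> (a \<odot> x) = tscale a (\<beta> x)" if "x \<in> carrier M" for a x
        unfolding \<beta>_def p(3)[symmetric] using that by (intro eq) (simp add: lin_tscale lin1)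
      show "\<beta> (act M \<sigma> x) = ac \<sigma> (\<beta> x)" if "x \<in> carrier M" for \<sigma> x
        unfolding \<beta>_def p(5) using that by (intro eq) (simp add: lin_pact lin1 act_closed)
    qed
  qed
qed

end

section \<open>Transport of structure\<close>

text \<open>\<open>injective_object\<close> tests objects whose elements have the type of
  \<open>M\<close>, so \<open>Iobj r\<close> must be copied into that type along an
  injection.\<close>

definition transport :: "('a \<Rightarrow> 'b) \<Rightarrow> ('k::field ratfun, 'a) semilin \<Rightarrow> ('k ratfun, 'b) semilin" where
  "transport i N = (let j = inv_into (carrier N) i in
    \<lparr>carrier = i ` carrier N, mult = undefined, one = undefined, zero = i \<zero>\<^bsub>N\<^esub>,
     add = (\<lambda>x y. i (j x \<oplus>\<^bsub>N\<^esub> j y)), smult = (\<lambda>a x. i (a \<odot>\<^bsub>N\<^esub> j x)), act = (\<lambda>\<sigma> x. i (act N \<sigma> (j x)))\<rparr>)"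

lemma transport_simps:
  assumes "inj_on i (carrier N)"
  shows "carrier (transport i N) = i ` carrier N" "\<zero>\<^bsub>transport i N\<^esub> = i \<zero>\<^bsub>N\<^esub>"
    "x \<in> carrier N \<Longrightarrow> y \<in> carrier N \<Longrightarrow> i x \<oplus>\<^bsub>transport i N\<^esub> i y = i (x \<oplus>\<^bsub>N\<^esub> y)"
    "x \<in> carrier N \<Longrightarrow> a \<odot>\<^bsub>transport i N\<^esub> i x = i (a \<odot>\<^bsub>N\<^esub> x)"
    "x \<in> carrier N \<Longrightarrow> act (transport i N) \<sigma> (i x) = i (act N \<sigma> x)"
  using assms by (simp_all add: transport_def Let_def)

lemma smooth_semilinear_transport:
  assumes N: "smooth_semilinear N" and i: "inj_on i (carrier N)"
  shows "smooth_semilinear (transport i N)"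
proof -
  interpret smooth_semilinear N by (rule N)
  note t = transport_simps[OF i]
  let ?T = "transport i N"
  have ab: "abelian_group ?T"
  proof (rule abelian_groupI)
    fix x y z assume "x \<in> carrier ?T" "y \<in> carrier ?T" "z \<in> carrier ?T"
    then obtain x' y' z' where xyz: "x' \<in> carrier N" "y' \<in> carrier N" "z' \<in> carrier N" "x = i x'" "y = i y'" "z = i z'"
      unfolding t by (elim imageE) (rule that)
    then show "(x \<oplus>\<^bsub>?T\<^esub> y) \<oplus>\<^bsub>?T\<^esub> z = x \<oplus>\<^bsub>?T\<^esub> (y \<oplus>\<^bsub>?T\<^esub> z)" by (simp add: t a_assoc)
  next
    fix x y assume "x \<in> carrier ?T" "y \<in> carrier ?T"
    then obtain x' y' where xyz: "x' \<in> carrier N" "y' \<in> carrier N" "x = i x'" "y = i y'"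
      unfolding t by (elim imageE) (rule that)
    then show "x \<oplus>\<^bsub>?T\<^esub> y = y \<oplus>\<^bsub>?T\<^esub> x" "x \<oplus>\<^bsub>?T\<^esub> y \<in> carrier ?T" by (simp_all add: t a_comm)
  next
    fix x assume "x \<in> carrier ?T"
    then obtain x' where x: "x' \<in> carrier N" "x = i x'" unfolding t by (rule imageE)
    then show "\<zero>\<^bsub>?T\<^esub> \<oplus>\<^bsub>?T\<^esub> x = x" by (simp add: t)
    have "i (\<ominus>\<^bsub>N\<^esub> x') \<oplus>\<^bsub>?T\<^esub> x = \<zero>\<^bsub>?T\<^esub>" using x by (simp add: t l_neg)
    then show "\<exists>y\<in>carrier ?T. y \<oplus>\<^bsub>?T\<^esub> x = \<zero>\<^bsub>?T\<^esub>" using x by (intro bexI[of _ "i (\<ominus>\<^bsub>N\<^esub> x')"]) (simp_all add: t)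
  qed (simp add: t)
  show ?thesis
  proof (intro smooth_semilinear.intro smooth_semilinear_axioms.intro moduleI cring_ratfun_ring ab)
    fix x assume "x \<in> carrier ?T"
    then obtain x' where x: "x' \<in> carrier N" "x = i x'" unfolding t by (rule imageE)
    show "a \<odot>\<^bsub>?T\<^esub> x \<in> carrier ?T" for a using x smult_closed[of a x'] by (simp add: t)
    show "\<one>\<^bsub>ratfun_ring\<^esub> \<odot>\<^bsub>?T\<^esub> x = x" using x smult_one[of x'] by (simp add: t)
    show "(a \<oplus>\<^bsub>ratfun_ring\<^esub> b) \<odot>\<^bsub>?T\<^esub> x = a \<odot>\<^bsub>?T\<^esub> x \<oplus>\<^bsub>?T\<^esub> b \<odot>\<^bsub>?T\<^esub> x" for a b
      using x smult_closed[of a x'] smult_closed[of b x'] smult_l_distr[of a b x'] by (simp add: t)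
    show "(a \<otimes>\<^bsub>ratfun_ring\<^esub> b) \<odot>\<^bsub>?T\<^esub> x = a \<odot>\<^bsub>?T\<^esub> (b \<odot>\<^bsub>?T\<^esub> x)" for a b
      using x smult_closed[of b x'] smult_assoc1[of a b x'] by (simp add: t)
    show "act ?T \<sigma> x \<in> carrier ?T" for \<sigma> using x act_closed[of x' \<sigma>] by (simp add: t)
    show "act ?T 1 x = x" using x by (simp add: t act_one)
    show "act ?T (\<sigma> * \<tau>) x = act ?T \<sigma> (act ?T \<tau> x)" for \<sigma> \<tau> using x by (simp add: t act_mult act_closed)
    show "act ?T \<sigma> (a \<odot>\<^bsub>?T\<^esub> x) = perm_ratfun \<sigma> a \<odot>\<^bsub>?T\<^esub> act ?T \<sigma> x" for \<sigma> a
      using x smult_closed[of a x'] by (simp add: t act_smult act_closed)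
    show "\<exists>n. \<forall>\<sigma>. (\<forall>i<n. \<sigma> \<langle>$\<rangle> i = i) \<longrightarrow> act ?T \<sigma> x = x"
      using smooth[OF x(1)] unfolding x(2) t(5)[OF x(1)] by metis
  next
    fix x y assume "x \<in> carrier ?T" "y \<in> carrier ?T"
    then obtain x' y' where xyz: "x' \<in> carrier N" "y' \<in> carrier N" "x = i x'" "y = i y'"
      unfolding t by (elim imageE) (rule that)
    show "act ?T \<sigma> (x \<oplus>\<^bsub>?T\<^esub> y) = act ?T \<sigma> x \<oplus>\<^bsub>?T\<^esub> act ?T \<sigma> y" for \<sigma>
      using xyz by (simp add: t act_add act_closed)
    show "a \<odot>\<^bsub>?T\<^esub> (x \<oplus>\<^bsub>?T\<^esub> y) = a \<odot>\<^bsub>?T\<^esub> x \<oplus>\<^bsub>?T\<^esub> a \<odot>\<^bsub>?T\<^esub> y" for a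
      using xyz smult_closed[of a x'] smult_closed[of a y'] smult_r_distr[of a x' y'] by (simp add: t)
  qed
qed

section \<open>Room for a standard object inside the field\<close>

lemma inj_xi: "inj (xi :: nat \<Rightarrow> 'k::field ratfun)"
proof (rule injI)
  fix i j assume "(xi i :: 'k ratfun) = xi j"
  then have "Poly_Mapping.single (Poly_Mapping.single i (1 :: nat)) (1 :: 'k) =
      Poly_Mapping.single (Poly_Mapping.single j (1 :: nat)) 1"
    by (simp add: xi_def eq_fract del: One_nat_def)
  then have "Poly_Mapping.single i (1 :: nat) = Poly_Mapping.single j 1"
    by (metis lookup_single_eq lookup_single_not_eq one_neq_zero)
  then show "i = j" by (metis lookup_single_eq lookup_single_not_eq one_neq_zero)
qed

text \<open>The field is infinite, hence equinumerous with its square. A vector becomes a finite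
  list of pairs of a set and a coefficient, each pair coded by one field element, and the list is
  folded by the pairing \<open>h\<close>.\<close>

lemma Vspace_le_ratfun:
  "\<exists>f :: (nat set \<Rightarrow>\<^sub>0 'k::field ratfun) \<Rightarrow> 'k ratfun. inj_on f (Vspace r)"
proof -
  have "infinite (UNIV :: 'k ratfun set)"
    by (rule infinite_super[OF subset_UNIV range_inj_infinite[OF inj_xi]])
  from card_of_Times_same_infinite[OF this] obtain h :: "'k ratfun \<times> 'k ratfun \<Rightarrow> 'k ratfun"
    where "bij_betw h (UNIV \<times> UNIV) UNIV"
    unfolding card_of_ordIso[symmetric] by blast
  then have h: "inj h" by (simp add: bij_betw_def)
  define c where "c S a = h (xi (set_encode S), a)" for S and a :: "'k ratfun"
  have c: "S = S' \<and> a = a'" if "c S a = c S' a'" "finite S" "finite S'" for S S' a a'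
    using that inj_eq[OF h] by (simp add: c_def inj_eq[OF inj_xi] set_encode_eq)
  define L where "L v = (SOME xs. set xs = (\<lambda>S. c S (Poly_Mapping.lookup v S)) ` Poly_Mapping.keys v)" for v
  have L: "set (L v) = (\<lambda>S. c S (Poly_Mapping.lookup v S)) ` Poly_Mapping.keys v" for v
    unfolding L_def by (rule someI_ex) (simp add: finite_list)
  have inj_L: "v = w" if "L v = L w" "v \<in> Vspace r" "w \<in> Vspace r" for v w
  proof -
    have fin: "finite S" if "S \<in> Poly_Mapping.keys u" "u \<in> Vspace r" for S and u :: "nat set \<Rightarrow>\<^sub>0 'k ratfun"
      using that by (auto simp: Vspace_def subsets_of_card_def)
    have sub: "Poly_Mapping.lookup u' S = Poly_Mapping.lookup u S"
      if "S \<in> Poly_Mapping.keys u" "L u = L u'" "u \<in> Vspace r" "u' \<in> Vspace r" for S u u'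
    proof -
      have "c S (Poly_Mapping.lookup u S) \<in> set (L u')" using that(1,2) L[of u] by simp
      then obtain S' where S': "S' \<in> Poly_Mapping.keys u'" "c S (Poly_Mapping.lookup u S) = c S' (Poly_Mapping.lookup u' S')"
        unfolding L by blast
      then show ?thesis using c[OF S'(2)] fin[OF that(1,3)] fin[OF S'(1) that(4)] by metis
    qed
    show ?thesis
    proof (rule poly_mapping_eqI)
      fix S
      show "Poly_Mapping.lookup v S = Poly_Mapping.lookup w S"
        using sub[of S v w] sub[of S w v] that by (metis not_in_keys_iff_lookup_eq_zero)
    qed
  qed
  define F where "F xs = foldr (\<lambda>x y. h (x, y)) xs 0" for xs
  have F: "xs = ys" if "F xs = F ys" "length xs = length ys" for xs ys
    using that(2,1)
  proof (induction xs ys rule: list_induct2)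
    case (Cons x xs y ys)
    then show ?case using inj_eq[OF h] by (simp add: F_def)
  qed simp
  \<comment> \<open>The fold is shown injective only between lists of equal length, so the length is
    coded along with it, as a variable of the field.\<close>
  have "inj_on (\<lambda>v. h (xi (length (L v)), F (L v))) (Vspace r)"
  proof (rule inj_onI)
    fix v w assume v: "v \<in> Vspace r" "w \<in> Vspace r"
      and "h (xi (length (L v)), F (L v)) = h (xi (length (L w)), F (L w))"
    then have "xi (length (L v)) = (xi (length (L w)) :: 'k ratfun)" "F (L v) = F (L w)"
      using inj_eq[OF h] by simp_all
    then have "L v = L w" using F by (simp add: inj_eq[OF inj_xi])
    then show "v = w" using inj_L v by blast
  qed
  then show ?thesis by blast
qed

section \<open>Maximal free families\<close>

context smooth_semirep
begin

definition ptran :: "('v \<times> nat) \<times> nat set \<Rightarrow> 'v" where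
  "ptran = (\<lambda>((p, r), S). ptrans {} {..<r} p S)"

definition Wset :: "('v \<times> nat) set \<Rightarrow> (('v \<times> nat) \<times> nat set) set" where
  "Wset G = {((p, r), S). (p, r) \<in> G \<and> finite S \<and> card S = r}"

text \<open>A pair \<open>(p, r)\<close> stands for a copy of \<open>Iobj r\<close> in which
  \<open>p\<close> is the image of the basis vector at \<open>{..<r}\<close>; the second condition
  says that the copies are free and that their sum is direct.\<close>

definition free_family :: "'v set \<Rightarrow> ('v \<times> nat) set \<Rightarrow> bool" where
  "free_family D G \<longleftrightarrow> (\<forall>(p, r)\<in>G. p \<in> D \<and> invar {} {..<r} p) \<and> (\<forall>z\<in>TW (Wset G). lincomb ptran z = 0 \<longrightarrow> z = 0)"

lemma perm_closed_Wset: "perm_closed (Wset G)"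
  by (auto simp: perm_closed_def Wset_def)

lemma free_familyD:
  assumes "free_family D G" "(p, r) \<in> G"
  shows "p \<in> D" "invar {} {..<r} p"
  using assms by (auto simp: free_family_def)

lemma free_family_indep: "free_family D G \<Longrightarrow> z \<in> TW (Wset G) \<Longrightarrow> lincomb ptran z = 0 \<Longrightarrow> z = 0"
  by (simp add: free_family_def)

lemma ptran_act:
  assumes "invar {} {..<r} p" "finite S" "card S = r"
  shows "ptran ((p, r), img \<sigma> S) = act \<sigma> (ptran ((p, r), S))"
  using ptrans_act[OF assms(1), of "()" S \<sigma>] assms(2,3) by (simp add: ptran_def Gset_def)

lemma ptran_mem: "stab {} D \<Longrightarrow> p \<in> D \<Longrightarrow> ptran ((p, r), S) \<in> D"
  by (simp add: ptran_def ptrans_def stab_act)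

lemma ptran_initial: "invar {} {..<r} p \<Longrightarrow> ptran ((p, r), {..<r}) = p"
  using ptrans_eq[of "{}" "{..<r}" p 1] by (simp add: ptran_def)

lemma lincomb_ptran_act:
  assumes "free_family D G" "z \<in> TW (Wset G)"
  shows "lincomb ptran (tact \<sigma> z) = act \<sigma> (lincomb ptran z)"
proof (rule lincomb_act[OF _ assms(2)])
  fix b S assume b: "(b, S) \<in> Wset G"
  obtain p r where pr: "b = (p, r)" by (rule prod.exhaust)
  then show "ptran (b, img \<sigma> S) = act \<sigma> (ptran (b, S))"
    using b free_familyD(2)[OF assms(1), of p r] by (simp add: Wset_def ptran_act)
qed

lemma lincomb_ptran_mem:
  assumes "free_family D G" "stab {} D" "z \<in> TW (Wset G)"
  shows "lincomb ptran z \<in> D"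
  unfolding lincomb_def
proof (intro subspace_sum subspace_scale stab_subspace[OF assms(2)])
  fix w assume "w \<in> Poly_Mapping.keys z"
  then have "w \<in> Wset G" using assms(3) by (auto simp: TW_def)
  moreover obtain p r S where "w = ((p, r), S)" by (metis surj_pair)
  ultimately show "ptran w \<in> D"
    using free_familyD(1)[OF assms(1), of p r] ptran_mem[OF assms(2)] by (simp add: Wset_def)
qed

lemma single_TW: "w \<in> G \<Longrightarrow> Poly_Mapping.single w c \<in> TW G"
  by (auto simp: TW_iff lookup_single when_def)

lemma free_family_inj:
  assumes "free_family D G" "z \<in> TW (Wset G)" "z' \<in> TW (Wset G)" "lincomb ptran z = lincomb ptran z'"
  shows "z = z'"
proof -
  have "z - z' \<in> TW (Wset G)" using assms by (intro T.subspace_diff[OF subspace_TW])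
  moreover have "lincomb ptran (z - z') = 0" using assms(4) by (simp add: lincomb_diff)
  ultimately show ?thesis using free_family_indep[OF assms(1)] by fastforce
qed

text \<open>Two sizes for one \<open>p\<close> would be two different basis vectors with the same
  image. Hence elements alone, without sizes, can index the final sum.\<close>

lemma free_family_unique:
  assumes "free_family D G" "(p, r) \<in> G" "(p, r') \<in> G"
  shows "r = r'"
proof -
  let ?s = "\<lambda>r. Poly_Mapping.single ((p, r), {..<r}) (1 :: 'k ratfun)"
  have "((p, r), {..<r}) \<in> Wset G" "((p, r'), {..<r'}) \<in> Wset G"
    using assms by (auto simp: Wset_def)
  moreover have "lincomb ptran (?s r) = lincomb ptran (?s r')"
    using assms free_familyD(2) by (simp add: ptran_initial)
  ultimately have "?s r = ?s r'" by (intro free_family_inj[OF assms(1)] single_TW)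
  then show ?thesis by (metis lookup_single_eq lookup_single_not_eq one_neq_zero prod.inject)
qed

text \<open>In a relation the terms belonging to \<open>p\<close> lie in \<open>M\<close>, so the
  remaining terms sum to an element of \<open>M\<close> and vanish by \<open>disj\<close> and the
  freeness of \<open>G\<close>; then the terms of \<open>p\<close> vanish by its own
  independence.\<close>

lemma free_family_insert:
  assumes G: "free_family D G" and p: "p \<in> D" "invar {} {..<r} p" "\<not> depends {} {..<r} p {0}"
    and M: "stab {} M" "p \<in> M" and disj: "\<And>z. z \<in> TW (Wset G) \<Longrightarrow> lincomb ptran z \<in> M \<Longrightarrow> lincomb ptran z = 0"
  shows "free_family D (insert (p, r) G)"
  unfolding free_family_def
proof (intro conjI ballI impI)
  show "case x of (p, r) \<Rightarrow> p \<in> D \<and> invar {} {..<r} p" if "x \<in> insert (p, r) G" for x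
    using that p(1,2) G by (auto simp: free_family_def)
  fix z :: "('v \<times> nat) \<times> nat set \<Rightarrow>\<^sub>0 'k ratfun"
  assume z: "z \<in> TW (Wset (insert (p, r) G))" "lincomb ptran z = 0"
  define z1 where "z1 = Poly_Mapping.mapp (\<lambda>w c. if fst w = (p, r) then c else 0) z"
  have l1: "Poly_Mapping.lookup z1 w = (if fst w = (p, r) then Poly_Mapping.lookup z w else 0)" for w
    by (simp add: z1_def lookup_mapp when_def in_keys_iff)
  define z2 where "z2 = z - z1"
  have l2: "Poly_Mapping.lookup z2 w = (if fst w = (p, r) then 0 else Poly_Mapping.lookup z w)" for w
    by (simp add: z2_def lookup_minus l1)
  have z2: "z2 \<in> TW (Wset G)" using z(1) by (auto simp: TW_iff l2 Wset_def)
  have k1: "\<exists>S. w = ((p, r), S) \<and> finite S \<and> card S = r" if "w \<in> Poly_Mapping.keys z1" for w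
  proof -
    have "fst w = (p, r)" "Poly_Mapping.lookup z w \<noteq> 0" using that by (auto simp: in_keys_iff l1 split: if_splits)
    then have "w \<in> Wset (insert (p, r) G)" using z(1) unfolding TW_iff by blast
    then show ?thesis using \<open>fst w = (p, r)\<close> by (auto simp: Wset_def)
  qed
  have sum: "lincomb ptran z1 + lincomb ptran z2 = 0"
    using z(2) by (simp add: z2_def lincomb_diff)
  have "lincomb ptran z1 \<in> M"
    unfolding lincomb_def using k1 ptran_mem[OF M]
    by (intro subspace_sum subspace_scale stab_subspace[OF M(1)]) blast
  then have "- lincomb ptran z1 \<in> M" by (rule subspace_neg[OF stab_subspace[OF M(1)]])
  then have "lincomb ptran z2 \<in> M" using minus_unique[OF sum] by simp
  then have 0: "lincomb ptran z2 = 0" by (rule disj[OF z2])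
  then have "z2 = 0" by (rule free_family_indep[OF G z2])
  \<comment> \<open>Relabelled by \<open>unit\<close>, the part belonging to \<open>p\<close> takes
    the form to which \<open>lincomb_indep\<close> applies.\<close>
  define y where "y = Poly_Mapping.map_key (\<lambda>(u :: unit, S). ((p, r), S)) z1"
  have "inj (\<lambda>(u :: unit, S :: nat set). ((p, r), S))" by (auto simp: inj_def)
  then have ly: "Poly_Mapping.lookup y (u, S) = Poly_Mapping.lookup z1 ((p, r), S)" for u S
    by (simp add: y_def map_key.rep_eq)
  have "lincomb (\<lambda>(u, S). ptrans {} {..<r} p S) y = lincomb ptran z1"
    unfolding lincomb_def
  proof (rule sum.reindex_bij_witness[of _ "\<lambda>w. ((), snd w)" "\<lambda>w. ((p, r), snd w)"])
    fix w assume w: "w \<in> Poly_Mapping.keys z1"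
    then obtain S where S: "w = ((p, r), S)" using k1 by blast
    show "((p, r), snd ((), snd w)) = w" using S by simp
    show "((), snd w) \<in> Poly_Mapping.keys y" using w S by (simp add: in_keys_iff ly)
  next
    fix w assume w: "w \<in> Poly_Mapping.keys y"
    obtain u S where uS: "w = (u, S)" by (rule prod.exhaust)
    show "((), snd ((p, r), snd w)) = w" using uS by simp
    show "((p, r), snd w) \<in> Poly_Mapping.keys z1" using w uS by (simp add: in_keys_iff ly)
    show "Poly_Mapping.lookup z1 ((p, r), snd w) *s ptran ((p, r), snd w) =
        Poly_Mapping.lookup y w *s (case w of (u, S) \<Rightarrow> ptrans {} {..<r} p S)"
      using uS by (simp add: ly ptran_def)
  qed
  then have "lincomb (\<lambda>(u, S). ptrans {} {..<r} p S) y \<in> {0}" using sum 0 by simp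
  moreover have "y \<in> TW (Gset {} (card {..<r}))"
    unfolding TW_def
  proof (intro CollectI subsetI)
    fix w assume w: "w \<in> Poly_Mapping.keys y"
    obtain u S where uS: "w = (u, S)" by (rule prod.exhaust)
    then have "((p, r), S) \<in> Poly_Mapping.keys z1" using w by (simp add: in_keys_iff ly)
    then show "w \<in> Gset {} (card {..<r})" using k1[of "((p, r), S)"] uS by (auto simp: Gset_def)
  qed
  ultimately have "y = 0"
    using p(3) by (intro lincomb_indep[OF stab_zero p(2)]) auto
  have "z1 = 0"
  proof (rule poly_mapping_eqI)
    fix w
    show "Poly_Mapping.lookup z1 w = Poly_Mapping.lookup 0 w"
    proof (cases "w \<in> Poly_Mapping.keys z1")
      case True
      then obtain S where "w = ((p, r), S)" using k1 by blast
      then show ?thesis using ly[of "()" S] \<open>y = 0\<close> by simp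
    qed (simp add: in_keys_iff)
  qed
  then show "z = 0" using \<open>z2 = 0\<close> by (simp add: z2_def)
qed

text \<open>A relation involves finitely many members, and these lie in a single family of the
  chain.\<close>

lemma free_family_Union:
  assumes "\<C> \<noteq> {}" "subset.chain {G. free_family D G} \<C>"
  shows "free_family D (\<Union>\<C>)"
  unfolding free_family_def
proof (intro conjI ballI impI)
  have free: "free_family D G" if "G \<in> \<C>" for G using assms(2) that by (auto simp: subset_chain_def)
  show "case x of (p, r) \<Rightarrow> p \<in> D \<and> invar {} {..<r} p" if "x \<in> \<Union>\<C>" for x
    using that free free_familyD by (auto, blast+)
  fix z :: "('v \<times> nat) \<times> nat set \<Rightarrow>\<^sub>0 'k ratfun"
  assume z: "z \<in> TW (Wset (\<Union>\<C>))" "lincomb ptran z = 0"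
  have ex: "\<exists>G\<in>\<C>. F \<subseteq> G" if "finite F" "F \<subseteq> \<Union>\<C>" for F
    using that
  proof (induction F rule: finite_induct)
    case empty then show ?case using assms(1) by blast
  next
    case (insert x F)
    then obtain G where "G \<in> \<C>" "F \<subseteq> G" by blast
    moreover from insert.prems obtain G' where "G' \<in> \<C>" "x \<in> G'" by blast
    ultimately have *: "G \<in> \<C>" "F \<subseteq> G" "G' \<in> \<C>" "x \<in> G'" by simp_all
    then have "G \<subseteq> G' \<or> G' \<subseteq> G" using assms(2)[unfolded subset_chain_def] by blast
    then show ?case using * by blast
  qed
  have "finite (fst ` Poly_Mapping.keys z)" by simp
  moreover have "fst ` Poly_Mapping.keys z \<subseteq> \<Union>\<C>" using z(1) by (auto simp: TW_def Wset_def)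
  ultimately have "\<exists>G\<in>\<C>. fst ` Poly_Mapping.keys z \<subseteq> G" by (rule ex)
  then obtain G where G: "G \<in> \<C>" "fst ` Poly_Mapping.keys z \<subseteq> G" by (elim bexE)
  have "Poly_Mapping.keys z \<subseteq> Wset G"
  proof
    fix w assume w: "w \<in> Poly_Mapping.keys z"
    then have "w \<in> Wset (\<Union>\<C>)" "fst w \<in> G" using z(1) G(2) by (auto simp: TW_def)
    then show "w \<in> Wset G" by (auto simp: Wset_def)
  qed
  then show "z = 0" using free_family_indep[OF free[OF G(1)] _ z(2)] by (simp add: TW_def)
qed

theorem injective_decomposition:
  assumes D: "stab {} D"
    and inj: "\<And>J Q \<psi>. stab {} Q \<Longrightarrow> Q \<subseteq> D \<Longrightarrow> thom {} Q \<psi> \<Longrightarrow> \<psi> ` Q \<subseteq> TW (Gset {} J) \<Longrightarrow> inj_on \<psi> Q \<Longrightarrow>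
      \<exists>\<eta>. hom_on tscale tact scale act {} (TW (Gset {} J)) \<eta> \<and> \<eta> ` TW (Gset {} J) \<subseteq> D \<and> (\<forall>x\<in>Q. \<eta> (\<psi> x) = x)"
  shows "\<exists>G. free_family D G \<and> D \<subseteq> lincomb ptran ` TW (Wset G)"
proof -
  have "\<exists>G\<in>{G. free_family D G}. \<forall>X\<in>{G. free_family D G}. G \<subseteq> X \<longrightarrow> X = G"
  proof (rule subset_Zorn_nonempty)
    have "free_family D {}"
      unfolding free_family_def
    proof (intro conjI ballI impI)
      fix z :: "('v \<times> nat) \<times> nat set \<Rightarrow>\<^sub>0 'k ratfun"
      assume "z \<in> TW (Wset {})"
      moreover have "Wset {} = {}" by (simp add: Wset_def)
      ultimately have "Poly_Mapping.keys z = {}" by (simp add: TW_def)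
      then show "z = 0" by (simp add: keys_eq_empty)
    qed simp
    then show "{G. free_family D G} \<noteq> {}" by blast
    show "\<Union>\<C> \<in> {G. free_family D G}" if "\<C> \<noteq> {}" "subset.chain {G. free_family D G} \<C>" for \<C>
      using free_family_Union[OF that] by simp
  qed
  then obtain G where G: "free_family D G" and max: "\<And>X. free_family D X \<Longrightarrow> G \<subseteq> X \<Longrightarrow> X = G" by blast
  let ?W = "TW (Wset G) :: (('v \<times> nat) \<times> nat set \<Rightarrow>\<^sub>0 'k ratfun) set"
  let ?L = "lincomb ptran"
  let ?U = "?L ` ?W"
  have sW: "T.subspace ?W" by (rule subspace_TW)
  have actW: "tact \<sigma> z \<in> ?W" if "z \<in> ?W" for \<sigma> z using that by (rule tact_TW[OF perm_closed_Wset])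
  have U: "stab {} ?U"
    unfolding stab_def
  proof (intro conjI subspaceI ballI)
    show "0 \<in> ?U" by (rule image_eqI[of _ _ 0]) (simp_all add: T.subspace_0[OF sW])
    fix x y assume "x \<in> ?U" "y \<in> ?U"
    then obtain x' y' where "x' \<in> ?W" "y' \<in> ?W" "x = ?L x'" "y = ?L y'" by (elim imageE) (rule that)
    then show "x + y \<in> ?U" by (intro image_eqI[of _ _ "x' + y'"] T.subspace_add[OF sW]) (simp_all add: lincomb_add)
  next
    fix c x assume "x \<in> ?U"
    then obtain x' where "x' \<in> ?W" "x = ?L x'" by (elim imageE)
    then show "c *s x \<in> ?U" by (intro image_eqI[of _ _ "tscale c x'"] T.subspace_scale[OF sW]) (simp_all add: lincomb_scale)
  next
    fix \<sigma> x assume "x \<in> ?U"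
    then obtain x' where "x' \<in> ?W" "x = ?L x'" by (elim imageE)
    then show "act \<sigma> x \<in> ?U"
      by (intro image_eqI[of _ _ "tact \<sigma> x'"] actW) (simp_all add: lincomb_ptran_act[OF G])
  qed
  define f where "f = inv_into ?W ?L"
  have injL: "inj_on ?L ?W" by (rule inj_onI) (rule free_family_inj[OF G])
  have fL: "f (?L z) = z" if "z \<in> ?W" for z unfolding f_def using injL that by (rule inv_into_f_f)
  have fU: "f ` ?U \<subseteq> ?W" using fL by force
  have "thom {} ?U f"
    unfolding hom_on_def
  proof (intro conjI ballI allI; elim imageE; hypsubst)
    show "f (?L x + ?L y) = f (?L x) + f (?L y)" if "x \<in> ?W" "y \<in> ?W" for x y
      using that fL[OF T.subspace_add[OF sW that]] by (simp add: fL lincomb_add)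
    show "f (c *s ?L x) = tscale c (f (?L x))" if "x \<in> ?W" for c x
      using that fL[OF T.subspace_scale[OF sW that]] by (simp add: fL lincomb_scale)
    show "f (act \<sigma> (?L x)) = tact \<sigma> (f (?L x))" if "x \<in> ?W" for \<sigma> x
      using that fL[OF actW[OF that]] by (simp add: fL lincomb_ptran_act[OF G])
  qed
  then obtain h where h: "thom {} UNIV h" "range h \<subseteq> ?W" "\<forall>x\<in>?U. h x = f x"
    using standard_injective[OF U _ fU perm_closed_Wset] by blast
  \<comment> \<open>Since the sum of the family is a standard representation, the inverse of
    \<open>?L\<close> extends to the whole space, and \<open>?\<theta>\<close> is an equivariant
    projection onto the sum.\<close>
  let ?\<theta> = "\<lambda>x. ?L (h x)"
  have hW: "h x \<in> ?W" for x using h(2) by blast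
  have \<theta>: "hom_on scale act scale act {} UNIV ?\<theta>"
    unfolding hom_on_def using hom_onD[OF h(1)] hW
    by (simp add: lincomb_add lincomb_scale lincomb_ptran_act[OF G])
  have \<theta>U: "?\<theta> (?L z) = ?L z" if "z \<in> ?W" for z using h(3) fL[OF that] that by simp
  have \<theta>D: "?\<theta> x \<in> D" for x using lincomb_ptran_mem[OF G D hW] .
  let ?M = "{x\<in>D. ?\<theta> x = 0}"
  have sD: "subspace D" using D by (rule stab_subspace)
  have M: "stab {} ?M"
    unfolding stab_def
  proof (intro conjI subspaceI ballI)
    show "0 \<in> ?M" using subspace_0[OF sD] hom_on_zero[OF \<theta>] by simp
    show "x + y \<in> ?M" if "x \<in> ?M" "y \<in> ?M" for x y
      using that hom_onD(1)[OF \<theta>, of x y] subspace_add[OF sD] by simp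
    show "c *s x \<in> ?M" if "x \<in> ?M" for c x
      using that hom_onD(2)[OF \<theta>, of x c] subspace_scale[OF sD] by simp
    show "act \<sigma> x \<in> ?M" if "x \<in> ?M" for \<sigma> x
      using that hom_onD(3)[OF \<theta>, of x \<sigma>] stab_act[OF D] by simp
  qed
  have \<theta>_diff: "?\<theta> (x - ?\<theta> x) = 0" for x
  proof -
    have "?\<theta> (x + (- 1) *s ?\<theta> x) = ?\<theta> x + (- 1) *s ?\<theta> (?\<theta> x)"
      unfolding hom_onD(1)[OF \<theta> UNIV_I UNIV_I] hom_onD(2)[OF \<theta> UNIV_I] by (rule refl)
    then show ?thesis using \<theta>U[OF hW] by simp
  qed
  have "?M = {0}"
  proof (rule ccontr)
    assume "?M \<noteq> {0}"
    have "\<exists>p\<in>?M. \<exists>r. invar {} {..<r} p \<and> \<not> depends {} {..<r} p {0}"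
    proof (rule injective_has_free_vector[OF M \<open>?M \<noteq> {0}\<close>])
      fix J Q and \<psi> :: "'v \<Rightarrow> (unit \<times> nat set \<Rightarrow>\<^sub>0 'k ratfun)"
      let ?J = "TW (Gset {} J) :: (unit \<times> nat set \<Rightarrow>\<^sub>0 'k ratfun) set"
      assume Q: "stab {} Q" "Q \<subseteq> ?M" "thom {} Q \<psi>" "\<psi> ` Q \<subseteq> ?J" "inj_on \<psi> Q"
      then obtain \<eta> where \<eta>: "hom_on tscale tact scale act {} ?J \<eta>" "\<eta> ` ?J \<subseteq> D" "\<forall>x\<in>Q. \<eta> (\<psi> x) = x"
        using inj[OF Q(1) _ Q(3-5)] by blast
      \<comment> \<open>The kernel of the projection inherits the extension property: subtracting
        the projection moves the values into \<open>?M\<close> and changes nothing on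
        \<open>Q\<close>, where the projection is zero.\<close>
      let ?\<eta> = "\<lambda>z. \<eta> z - ?\<theta> (\<eta> z)"
      have "hom_on tscale tact scale act {} ?J ?\<eta>"
        unfolding hom_on_def
        using hom_onD[OF \<eta>(1)] hom_onD[OF \<theta>] by (simp add: act_diff scale_right_diff_distrib)
      moreover have "?\<eta> ` ?J \<subseteq> ?M"
        using \<theta>_diff \<theta>D \<eta>(2) subspace_diff[OF sD] by blast
      moreover have "?\<eta> (\<psi> x) = x" if "x \<in> Q" for x
        using \<eta>(3) Q(2) that by auto
      ultimately show "\<exists>\<eta>. hom_on tscale tact scale act {} ?J \<eta> \<and> \<eta> ` ?J \<subseteq> ?M \<and> (\<forall>x\<in>Q. \<eta> (\<psi> x) = x)" by blast
    qed
    then obtain p r where p: "p \<in> ?M" "invar {} {..<r} p" "\<not> depends {} {..<r} p {0}" by blast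
    have disj: "?L z = 0" if "z \<in> ?W" "?L z \<in> ?M" for z using \<theta>U[OF that(1)] that(2) by simp
    have "free_family D (insert (p, r) G)"
      using p(1) by (intro free_family_insert[OF G _ p(2,3) M p(1) disj]) auto
    \<comment> \<open>By maximality the new member already belongs to the family, so
      \<open>p\<close> lies both in the sum and in the kernel of the projection and is zero; but
      zero is dependent.\<close>
    then have "(p, r) \<in> G" using max by blast
    then have "((p, r), {..<r}) \<in> Wset G" by (auto simp: Wset_def)
    then have "Poly_Mapping.single ((p, r), {..<r}) 1 \<in> ?W" by (rule single_TW)
    moreover have "?L (Poly_Mapping.single ((p, r), {..<r}) 1) = p" using ptran_initial[OF p(2)] by simp
    ultimately have "p = 0" using disj[of "Poly_Mapping.single ((p, r), {..<r}) 1"] p(1) by simp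
    then show False using p(3) by (simp add: depends_def span_zero)
  qed
  have "D \<subseteq> ?U"
  proof
    fix x assume x: "x \<in> D"
    have "x - ?\<theta> x \<in> ?M" using \<theta>_diff subspace_diff[OF sD x \<theta>D] by simp
    then have "x = ?\<theta> x" using \<open>?M = {0}\<close> by simp
    then show "x \<in> ?U" using hW by blast
  qed
  then show ?thesis using G by blast
qed

end

section \<open>Injective objects are standard\<close>

definition comp :: "'i \<Rightarrow> ('i \<times> nat set \<Rightarrow>\<^sub>0 'k::field ratfun) \<Rightarrow> (nat set \<Rightarrow>\<^sub>0 'k ratfun)" where
  "comp b z = Poly_Mapping.map_key (\<lambda>S. (b, S)) z"

lemma lookup_comp [simp]: "Poly_Mapping.lookup (comp b z) S = Poly_Mapping.lookup z (b, S)"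
  by (simp add: comp_def map_key.rep_eq inj_def)

lemma comp_add: "comp b (z + w) = comp b z + comp b w"
  by (rule poly_mapping_eqI) (simp add: lookup_add)

lemma comp_scale: "comp b (tscale a z) = Poly_Mapping.map (\<lambda>x. a * x) (comp b z)"
  by (rule poly_mapping_eqI) (simp add: lookup_map_0)

lemma comp_act: "comp b (tact \<sigma> z) = Poly_Mapping.map (perm_ratfun \<sigma>) (perm_vec \<sigma> (comp b z))"
  by (rule poly_mapping_eqI) (simp add: lookup_map_0)

lemma comp_Gset: "z \<in> TW (Gset {} r) \<Longrightarrow> comp u z \<in> Vspace r"
  by (auto simp: TW_iff Vspace_iff Gset_def subsets_of_card_def)

lemma comp_Wset_nonzero: "finite {b. comp b z \<noteq> 0}"
proof (rule finite_subset)
  show "{b. comp b z \<noteq> 0} \<subseteq> fst ` Poly_Mapping.keys z"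
  proof
    fix b assume "b \<in> {b. comp b z \<noteq> 0}"
    then obtain S where "Poly_Mapping.lookup (comp b z) S \<noteq> 0" by (metis (mono_tags) lookup_zero mem_Collect_eq poly_mapping_eqI)
    then show "b \<in> fst ` Poly_Mapping.keys z" by (force simp: in_keys_iff)
  qed
qed simp

section \<open>Morphisms and subobjects given by carriers\<close>

lemma semilin_homI:
  assumes "\<And>x. x \<in> carrier X \<Longrightarrow> f x \<in> carrier Y"
    and "\<And>x y. x \<in> carrier X \<Longrightarrow> y \<in> carrier X \<Longrightarrow> f (x \<oplus>\<^bsub>X\<^esub> y) = f x \<oplus>\<^bsub>Y\<^esub> f y"
    and "\<And>a x. x \<in> carrier X \<Longrightarrow> f (a \<odot>\<^bsub>X\<^esub> x) = a \<odot>\<^bsub>Y\<^esub> f x"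
    and "\<And>\<sigma> x. x \<in> carrier X \<Longrightarrow> f (act X \<sigma> x) = act Y \<sigma> (f x)"
  shows "f \<in> semilin_hom X Y"
  using assms by (auto simp: semilin_hom_def hom_def)

lemma semilin_homD:
  assumes "f \<in> semilin_hom X Y" "x \<in> carrier X"
  shows "f x \<in> carrier Y" "y \<in> carrier X \<Longrightarrow> f (x \<oplus>\<^bsub>X\<^esub> y) = f x \<oplus>\<^bsub>Y\<^esub> f y"
    "f (a \<odot>\<^bsub>X\<^esub> x) = a \<odot>\<^bsub>Y\<^esub> f x" "f (act X \<sigma> x) = act Y \<sigma> (f x)"
  using assms by (auto simp: semilin_hom_def hom_def)

text \<open>Closure under negatives comes from the scalar -1.\<close>

lemma (in smooth_semilinear) subobjectI:
  assumes "H \<subseteq> carrier M" "\<zero> \<in> H" "\<And>x y. x \<in> H \<Longrightarrow> y \<in> H \<Longrightarrow> x \<oplus> y \<in> H"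
    and smult: "\<And>a x. x \<in> H \<Longrightarrow> a \<odot> x \<in> H" and "\<And>\<sigma> x. x \<in> H \<Longrightarrow> act M \<sigma> x \<in> H"
  shows "submodule H ratfun_ring M" "\<And>\<sigma> x. x \<in> H \<Longrightarrow> act M \<sigma> x \<in> H"
proof -
  have "\<ominus> x \<in> H" if "x \<in> H" for x
  proof -
    have x: "x \<in> carrier M" using that assms(1) by blast
    have "(- 1) \<odot> x \<oplus> x = \<zero>"
      using smult_l_distr[of "- 1" 1 x] smult_one[of x] x by (simp add: zero_smult)
    then have "\<ominus> x = (- 1) \<odot> x" using x smult_closed[of "- 1" x] minus_equality[of "(- 1) \<odot> x" x] by simp
    then show ?thesis using smult[OF that] by simp
  qed
  then have "subgroup H (add_monoid M)"
    using assms by (intro add.subgroupI) (auto simp: a_inv_def)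
  then show "submodule H ratfun_ring M"
    using smult by (simp add: submodule_def submodule_axioms_def)
qed (use assms in simp)

lemma (in smooth_semilinear) smooth_semilinear_restrict:
  assumes "submodule H ratfun_ring M" "\<And>\<sigma> x. x \<in> H \<Longrightarrow> act M \<sigma> x \<in> H"
  shows "smooth_semilinear (M\<lparr>carrier := H\<rparr>)"
proof (intro smooth_semilinear.intro smooth_semilinear_axioms.intro)
  show "Module.module ratfun_ring (M\<lparr>carrier := H\<rparr>)"
    by (rule submodule.submodule_is_module[OF assms(1) module_axioms])
  have "x \<in> carrier M" if "x \<in> H" for x
    using assms(1) that subgroup.mem_carrier[of H "add_monoid M" x] by (simp add: submodule_def)
  then show "v \<in> carrier (M\<lparr>carrier := H\<rparr>) \<Longrightarrow> act (M\<lparr>carrier := H\<rparr>) 1 v = v"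
    "v \<in> carrier (M\<lparr>carrier := H\<rparr>) \<Longrightarrow> act (M\<lparr>carrier := H\<rparr>) (\<sigma> * \<tau>) v = act (M\<lparr>carrier := H\<rparr>) \<sigma> (act (M\<lparr>carrier := H\<rparr>) \<tau> v)"
    "v \<in> carrier (M\<lparr>carrier := H\<rparr>) \<Longrightarrow> w \<in> carrier (M\<lparr>carrier := H\<rparr>) \<Longrightarrow>
      act (M\<lparr>carrier := H\<rparr>) \<sigma> (v \<oplus>\<^bsub>M\<lparr>carrier := H\<rparr>\<^esub> w) =
      act (M\<lparr>carrier := H\<rparr>) \<sigma> v \<oplus>\<^bsub>M\<lparr>carrier := H\<rparr>\<^esub> act (M\<lparr>carrier := H\<rparr>) \<sigma> w"
    "v \<in> carrier (M\<lparr>carrier := H\<rparr>) \<Longrightarrow>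
      act (M\<lparr>carrier := H\<rparr>) \<sigma> (a \<odot>\<^bsub>M\<lparr>carrier := H\<rparr>\<^esub> v) = perm_ratfun \<sigma> a \<odot>\<^bsub>M\<lparr>carrier := H\<rparr>\<^esub> act (M\<lparr>carrier := H\<rparr>) \<sigma> v"
    "v \<in> carrier (M\<lparr>carrier := H\<rparr>) \<Longrightarrow> \<exists>n. \<forall>\<sigma>. (\<forall>i<n. \<sigma> \<langle>$\<rangle> i = i) \<longrightarrow> act (M\<lparr>carrier := H\<rparr>) \<sigma> v = v"
    for v w \<sigma> \<tau> a
    by (simp_all add: act_one act_mult act_add act_smult smooth)
qed (use assms(2) in simp)

text \<open>The subspace \<open>Q\<close> is pulled back to a subobject of \<open>M\<close>, and
  \<open>Iobj J\<close> is copied into the type of \<open>M\<close>; injectivity of \<open>M\<close>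
  then extends the inclusion of the subobject along the embedding given by \<psi>.\<close>

lemma injective_extends:
  fixes M :: "('k::field ratfun, 'a) semilin" and \<beta> :: "'a \<Rightarrow> ('a \<Rightarrow>\<^sub>0 'k ratfun)"
    and \<psi> :: "('a \<Rightarrow>\<^sub>0 'k ratfun) \<Rightarrow> (unit \<times> nat set \<Rightarrow>\<^sub>0 'k ratfun)"
  assumes M: "injective_object M" and ac: "smooth_semirep tscale ac"
    and \<beta>: "inj_on \<beta> (carrier M)"
      "\<And>x y. x \<in> carrier M \<Longrightarrow> y \<in> carrier M \<Longrightarrow> \<beta> (x \<oplus>\<^bsub>M\<^esub> y) = \<beta> x + \<beta> y"
      "\<And>a x. x \<in> carrier M \<Longrightarrow> \<beta> (a \<odot>\<^bsub>M\<^esub> x) = tscale a (\<beta> x)"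
      "\<And>\<sigma> x. x \<in> carrier M \<Longrightarrow> \<beta> (act M \<sigma> x) = ac \<sigma> (\<beta> x)"
    and Q: "semirep.stab tscale ac {} Q" "Q \<subseteq> \<beta> ` carrier M" "hom_on tscale ac tscale tact {} Q \<psi>"
      "\<psi> ` Q \<subseteq> TW (Gset {} J)" "inj_on \<psi> Q"
  shows "\<exists>\<eta>. hom_on tscale tact tscale ac {} (TW (Gset {} J)) \<eta> \<and> \<eta> ` TW (Gset {} J) \<subseteq> \<beta> ` carrier M \<and>
    (\<forall>x\<in>Q. \<eta> (\<psi> x) = x)"
proof -
  interpret R: smooth_semirep tscale ac by (rule ac)
  interpret M: smooth_semilinear M using M by (simp add: injective_object_def)
  have sQ: "R.subspace Q" using Q(1) by (rule R.stab_subspace)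
  have \<beta>0: "\<beta> \<zero>\<^bsub>M\<^esub> = 0" using \<beta>(2)[of "\<zero>\<^bsub>M\<^esub>" "\<zero>\<^bsub>M\<^esub>"] by simp
  show ?thesis
  proof (cases "Q = {0}")
    \<comment> \<open>Here no nonzero vector is at hand to carry a copy of \<open>Iobj J\<close>,
      but the zero map already extends.\<close>
    case True
    have "hom_on tscale tact tscale ac {} (TW (Gset {} J)) (\<lambda>_ :: unit \<times> nat set \<Rightarrow>\<^sub>0 'k ratfun. 0 :: 'a \<Rightarrow>\<^sub>0 'k ratfun)"
      by (simp add: hom_on_def)
    moreover have "0 \<in> \<beta> ` carrier M" using \<beta>0 by (metis M.zero_closed imageI)
    ultimately show ?thesis using True by (intro exI[of _ "\<lambda>_. 0"]) auto
  next
    case False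
    then obtain q where q: "q \<in> Q" "q \<noteq> 0" using R.subspace_0[OF sQ] by blast
    then obtain m0 where m0: "m0 \<in> carrier M" "\<beta> m0 = q" using Q(2) by blast
    have inj0: "a = b" if "a \<odot>\<^bsub>M\<^esub> m0 = b \<odot>\<^bsub>M\<^esub> m0" for a b
    proof -
      have "tscale a q = tscale b q" using that \<beta>(3)[OF m0(1)] m0(2) by metis
      then show ?thesis using q(2) R.scale_right_imp_eq by blast
    qed
    obtain f0 :: "(nat set \<Rightarrow>\<^sub>0 'k ratfun) \<Rightarrow> 'k ratfun" where f0: "inj_on f0 (Vspace J)"
      using Vspace_le_ratfun by blast
    \<comment> \<open>The multiples of the nonzero \<open>m0\<close> are a copy of the field inside
      \<open>carrier M\<close>, and the field has room for \<open>Iobj J\<close>. The map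
      \<open>i\<close> only has to be injective; the structure is transported along it.\<close>
    define i where "i v = f0 v \<odot>\<^bsub>M\<^esub> m0" for v
    have i: "inj_on i (carrier (Iobj J :: ('k ratfun, _) semilin))"
      using f0 inj0 by (auto simp: inj_on_def i_def)
    let ?Y = "transport i (Iobj J)"
    note t = transport_simps[OF i, simplified]
    have Y: "smooth_semilinear ?Y" by (rule smooth_semilinear_transport[OF smooth_semilinear_Iobj i])
    let ?H = "{m \<in> carrier M. \<beta> m \<in> Q}"
    let ?X = "M\<lparr>carrier := ?H\<rparr>"
    have H: "?H \<subseteq> carrier M" "\<zero>\<^bsub>M\<^esub> \<in> ?H" "\<And>x y. x \<in> ?H \<Longrightarrow> y \<in> ?H \<Longrightarrow> x \<oplus>\<^bsub>M\<^esub> y \<in> ?H"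
      "\<And>a x. x \<in> ?H \<Longrightarrow> a \<odot>\<^bsub>M\<^esub> x \<in> ?H" "\<And>\<sigma> x. x \<in> ?H \<Longrightarrow> act M \<sigma> x \<in> ?H"
    proof -
      show "?H \<subseteq> carrier M" by blast
      show "\<zero>\<^bsub>M\<^esub> \<in> ?H" using \<beta>0 R.subspace_0[OF sQ] by simp
      show "x \<oplus>\<^bsub>M\<^esub> y \<in> ?H" if "x \<in> ?H" "y \<in> ?H" for x y
        using that R.subspace_add[OF sQ] by (simp add: \<beta>(2))
      show "a \<odot>\<^bsub>M\<^esub> x \<in> ?H" if "x \<in> ?H" for a x
        using that R.subspace_scale[OF sQ] M.smult_closed[of a x] by (simp add: \<beta>(3))
      show "act M \<sigma> x \<in> ?H" if "x \<in> ?H" for \<sigma> x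
        using that R.stab_act[OF Q(1)] M.act_closed[of x \<sigma>] by (simp add: \<beta>(4))
    qed
    have X: "smooth_semilinear ?X"
      by (rule M.smooth_semilinear_restrict[OF M.subobjectI(1)[OF H] H(5)])
    let ?f = "\<lambda>m. i (comp () (\<psi> (\<beta> m)))"
    have V: "comp () (\<psi> (\<beta> m)) \<in> Vspace J" if "m \<in> ?H" for m
      using that Q(4) by (intro comp_Gset) auto
    have f: "?f \<in> semilin_hom ?X ?Y"
    proof (rule semilin_homI)
      show "?f x \<in> carrier ?Y" if "x \<in> carrier ?X" for x using V that by (simp add: t)
      show "?f (x \<oplus>\<^bsub>?X\<^esub> y) = ?f x \<oplus>\<^bsub>?Y\<^esub> ?f y" if "x \<in> carrier ?X" "y \<in> carrier ?X" for x y
        using that V by (simp add: t \<beta>(2) hom_onD(1)[OF Q(3)] comp_add)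
      show "?f (a \<odot>\<^bsub>?X\<^esub> x) = a \<odot>\<^bsub>?Y\<^esub> ?f x" if "x \<in> carrier ?X" for a x
        using that V by (simp add: t \<beta>(3) hom_onD(2)[OF Q(3)] comp_scale)
      show "?f (act ?X \<sigma> x) = act ?Y \<sigma> (?f x)" if "x \<in> carrier ?X" for \<sigma> x
        using that V by (simp add: t \<beta>(4) hom_onD(3)[OF Q(3)] comp_act)
    qed
    have "inj_on ?f (carrier ?X)"
    proof (rule inj_onI)
      fix x y assume xy: "x \<in> carrier ?X" "y \<in> carrier ?X" "?f x = ?f y"
      then have "comp () (\<psi> (\<beta> x)) = comp () (\<psi> (\<beta> y))"
        using inj_onD[OF i, of "comp () (\<psi> (\<beta> x))" "comp () (\<psi> (\<beta> y))"] V by simp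
      then have "\<psi> (\<beta> x) = \<psi> (\<beta> y)"
        by (intro poly_mapping_eqI) (metis lookup_comp old.unit.exhaust surj_pair)
      then have "\<beta> x = \<beta> y" using inj_onD[OF Q(5)] xy by simp
      then show "x = y" using inj_onD[OF \<beta>(1)] xy by simp
    qed
    moreover have "(\<lambda>m. m) \<in> semilin_hom ?X M" by (rule semilin_homI) simp_all
    ultimately obtain h where h: "h \<in> semilin_hom ?Y M" "\<forall>x\<in>carrier ?X. h (?f x) = x"
      using M X Y f unfolding injective_object_def by blast
    define \<eta> where "\<eta> z = \<beta> (h (i (comp () z)))" for z :: "unit \<times> nat set \<Rightarrow>\<^sub>0 'k ratfun"
    have iY: "i (comp () z) \<in> carrier ?Y" if "z \<in> TW (Gset {} J)" for z :: "unit \<times> nat set \<Rightarrow>\<^sub>0 'k ratfun"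
      using comp_Gset[OF that] by (simp add: t)
    have "hom_on tscale tact tscale ac {} (TW (Gset {} J)) \<eta>"
      unfolding hom_on_def
    proof (intro conjI ballI allI)
      fix z w :: "unit \<times> nat set \<Rightarrow>\<^sub>0 'k ratfun" assume z: "z \<in> TW (Gset {} J)"
      note hz = semilin_homD[OF h(1) iY[OF z]]
      show "\<eta> (z + w) = \<eta> z + \<eta> w" if w: "w \<in> TW (Gset {} J)"
      proof -
        have "i (comp () (z + w)) = i (comp () z) \<oplus>\<^bsub>?Y\<^esub> i (comp () w)"
          using comp_Gset[OF z] comp_Gset[OF w] by (simp add: t comp_add)
        then show ?thesis using hz(1,2) iY[OF w] semilin_homD(1)[OF h(1) iY[OF w]] by (simp add: \<eta>_def \<beta>(2))
      qed
      show "\<eta> (tscale c z) = tscale c (\<eta> z)" for c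
      proof -
        have "i (comp () (tscale c z)) = c \<odot>\<^bsub>?Y\<^esub> i (comp () z)"
          using comp_Gset[OF z] by (simp add: t comp_scale)
        then show ?thesis using hz(1,3) by (simp add: \<eta>_def \<beta>(3))
      qed
      show "\<eta> (tact \<sigma> z) = ac \<sigma> (\<eta> z)" for \<sigma>
      proof -
        have "i (comp () (tact \<sigma> z)) = act ?Y \<sigma> (i (comp () z))"
          using comp_Gset[OF z] by (simp add: t comp_act)
        then show ?thesis using hz(1,4) by (simp add: \<eta>_def \<beta>(4))
      qed
    qed
    moreover have "\<eta> ` TW (Gset {} J) \<subseteq> \<beta> ` carrier M"
      using semilin_homD(1)[OF h(1) iY] by (auto simp: \<eta>_def)
    moreover have "\<eta> (\<psi> x) = x" if x: "x \<in> Q" for x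
    proof -
      obtain m where "m \<in> carrier M" "x = \<beta> m" using x Q(2) by blast
      then show ?thesis using h(2) x by (simp add: \<eta>_def)
    qed
    ultimately show ?thesis by blast
  qed
qed

text \<open>After realisation, \<open>injective_decomposition\<close> writes the image of
  \<open>M\<close> as the sum of a free family. What remains is to convert coordinates in that
  family into an element of \<open>semilin_sum\<close>, component by component.\<close>

lemma injective_is_standard:
  fixes M :: "('k::field ratfun, 'a) semilin"
  assumes M: "injective_object M"
  shows "standard_object M"
proof -
  interpret M: smooth_semilinear M using M by (simp add: injective_object_def)
  obtain ac and \<beta> :: "'a \<Rightarrow> ('a \<Rightarrow>\<^sub>0 'k ratfun)"
    where ac: "smooth_semirep tscale ac" and \<beta>: "inj_on \<beta> (carrier M)"
    "\<And>x y. x \<in> carrier M \<Longrightarrow> y \<in> carrier M \<Longrightarrow> \<beta> (x \<oplus>\<^bsub>M\<^esub> y) = \<beta> x + \<beta> y"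
    "\<And>a x. x \<in> carrier M \<Longrightarrow> \<beta> (a \<odot>\<^bsub>M\<^esub> x) = tscale a (\<beta> x)"
    "\<And>\<sigma> x. x \<in> carrier M \<Longrightarrow> \<beta> (act M \<sigma> x) = ac \<sigma> (\<beta> x)"
    using M.realisation by metis
  interpret R: smooth_semirep tscale ac by (rule ac)
  let ?D = "\<beta> ` carrier M"
  have \<beta>0: "\<beta> \<zero>\<^bsub>M\<^esub> = 0" using \<beta>(2)[of "\<zero>\<^bsub>M\<^esub>" "\<zero>\<^bsub>M\<^esub>"] by simp
  have D: "R.stab {} ?D"
    unfolding R.stab_def
  proof (intro conjI R.subspaceI ballI)
    show "0 \<in> ?D" using \<beta>0 by (metis M.zero_closed imageI)
    fix x y assume "x \<in> ?D" "y \<in> ?D"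
    then obtain x' y' where "x' \<in> carrier M" "y' \<in> carrier M" "x = \<beta> x'" "y = \<beta> y'" by (elim imageE) (rule that)
    then show "x + y \<in> ?D" by (intro image_eqI[of _ _ "x' \<oplus>\<^bsub>M\<^esub> y'"]) (simp_all add: \<beta>(2))
  next
    fix c x assume "x \<in> ?D"
    then obtain x' where "x' \<in> carrier M" "x = \<beta> x'" by (elim imageE)
    then show "tscale c x \<in> ?D"
      using M.smult_closed[of c x'] by (intro image_eqI[of _ _ "c \<odot>\<^bsub>M\<^esub> x'"]) (simp_all add: \<beta>(3))
  next
    fix \<sigma> x assume "x \<in> ?D"
    then obtain x' where "x' \<in> carrier M" "x = \<beta> x'" by (elim imageE)
    then show "ac \<sigma> x \<in> ?D" by (intro image_eqI[of _ _ "act M \<sigma> x'"]) (simp_all add: \<beta>(4) M.act_closed)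
  qed
  obtain G where G: "R.free_family ?D G" "?D \<subseteq> R.lincomb R.ptran ` TW (R.Wset G)"
    using R.injective_decomposition[OF D injective_extends[OF M ac \<beta>]] by blast
  let ?W = "TW (R.Wset G) :: ((('a \<Rightarrow>\<^sub>0 'k ratfun) \<times> nat) \<times> nat set \<Rightarrow>\<^sub>0 'k ratfun) set"
  let ?L = "R.lincomb R.ptran"
  define \<zeta> where "\<zeta> m = inv_into ?W ?L (\<beta> m)" for m
  have mem: "\<beta> m \<in> ?L ` ?W" if "m \<in> carrier M" for m using G(2) that by blast
  have \<zeta>W: "\<zeta> m \<in> ?W" if "m \<in> carrier M" for m unfolding \<zeta>_def by (rule inv_into_into[OF mem[OF that]])
  have L\<zeta>: "?L (\<zeta> m) = \<beta> m" if "m \<in> carrier M" for m unfolding \<zeta>_def by (rule f_inv_into_f[OF mem[OF that]])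
  have \<zeta>I: "\<zeta> m = z" if "m \<in> carrier M" "z \<in> ?W" "?L z = \<beta> m" for m z
    using R.free_family_inj[OF G(1) \<zeta>W[OF that(1)] that(2)] L\<zeta>[OF that(1)] that(3) by simp
  have \<zeta>_add: "\<zeta> (x \<oplus>\<^bsub>M\<^esub> y) = \<zeta> x + \<zeta> y" if "x \<in> carrier M" "y \<in> carrier M" for x y
    using that \<zeta>W L\<zeta> by (intro \<zeta>I T.subspace_add[OF subspace_TW]) (simp_all add: R.lincomb_add \<beta>(2))
  have \<zeta>_scale: "\<zeta> (a \<odot>\<^bsub>M\<^esub> x) = tscale a (\<zeta> x)" if "x \<in> carrier M" for a x
    using that \<zeta>W L\<zeta> M.smult_closed[of a x]
    by (intro \<zeta>I T.subspace_scale[OF subspace_TW]) (simp_all add: R.lincomb_scale \<beta>(3))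
  have \<zeta>_act: "\<zeta> (act M \<sigma> x) = tact \<sigma> (\<zeta> x)" if "x \<in> carrier M" for \<sigma> x
    using that \<zeta>W L\<zeta> M.act_closed
    by (intro \<zeta>I tact_TW[OF R.perm_closed_Wset]) (simp_all add: R.lincomb_ptran_act[OF G(1)] \<beta>(4))
  \<comment> \<open>The summands are indexed by the elements of \<open>M\<close> that generate them,
    as \<open>standard_object\<close> asks for indices in the type of \<open>M\<close>.\<close>
  define J where "J = {j \<in> carrier M. \<exists>r. (\<beta> j, r) \<in> G}"
  define r where "r j = (THE r. (\<beta> j, r) \<in> G)" for j
  have r: "r j = s" if "(\<beta> j, s) \<in> G" for j s
    unfolding r_def using that R.free_family_unique[OF G(1)] by (intro the_equality) blast+
  have rJ: "(\<beta> j, r j) \<in> G" if "j \<in> J" for j using that r unfolding J_def by blast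
  define F where "F m = (\<lambda>j\<in>J. comp (\<beta> j, r j) (\<zeta> m))" for m
  let ?S = "semilin_sum J (\<lambda>j. Iobj (r j) :: ('k ratfun, _) semilin)"
  have V: "comp (\<beta> j, r j) z \<in> Vspace (r j)" if "z \<in> ?W" "j \<in> J" for j z
    using that(1) by (auto simp: TW_iff Vspace_iff R.Wset_def subsets_of_card_def)
  have inj\<beta>: "j = j'" if "j \<in> J" "j' \<in> J" "\<beta> j = \<beta> j'" for j j'
    using inj_onD[OF \<beta>(1) that(3)] that(1,2) by (simp add: J_def)
  have fin: "finite {j \<in> J. F m j \<noteq> 0}" for m
  proof (rule finite_imageD)
    show "finite ((\<lambda>j. (\<beta> j, r j)) ` {j \<in> J. F m j \<noteq> 0})"
      by (rule finite_subset[OF _ comp_Wset_nonzero[of "\<zeta> m"]]) (auto simp: F_def)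
    show "inj_on (\<lambda>j. (\<beta> j, r j)) {j \<in> J. F m j \<noteq> 0}" using inj\<beta> by (auto simp: inj_on_def)
  qed
  have F: "F \<in> semilin_hom M ?S"
  proof (rule semilin_homI)
    show "F x \<in> carrier ?S" if "x \<in> carrier M" for x
      using V[OF \<zeta>W[OF that]] fin by (auto simp: F_def)
    show "F (x \<oplus>\<^bsub>M\<^esub> y) = F x \<oplus>\<^bsub>?S\<^esub> F y" if "x \<in> carrier M" "y \<in> carrier M" for x y
      using that by (auto simp: F_def \<zeta>_add comp_add intro!: restrict_ext)
    show "F (a \<odot>\<^bsub>M\<^esub> x) = a \<odot>\<^bsub>?S\<^esub> F x" if "x \<in> carrier M" for a x
      using that by (auto simp: F_def \<zeta>_scale comp_scale intro!: restrict_ext)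
    show "F (act M \<sigma> x) = act ?S \<sigma> (F x)" if "x \<in> carrier M" for \<sigma> x
      using that by (auto simp: F_def \<zeta>_act comp_act intro!: restrict_ext)
  qed
  have keyJ: "\<exists>j\<in>J. \<exists>S. w = ((\<beta> j, r j), S)" if "w \<in> R.Wset G" for w
  proof -
    obtain p s S where w: "w = ((p, s), S)" by (metis surj_pair)
    then have ps: "(p, s) \<in> G" using that by (simp add: R.Wset_def)
    then obtain j where "j \<in> carrier M" "p = \<beta> j" using R.free_familyD(1)[OF G(1)] by blast
    then show ?thesis using ps w r by (auto simp: J_def)
  qed
  have "inj_on F (carrier M)"
  proof (rule inj_onI)
    fix x y assume xy: "x \<in> carrier M" "y \<in> carrier M" "F x = F y"
    have "\<zeta> x = \<zeta> y"
    proof (rule poly_mapping_eqI)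
      fix w
      show "Poly_Mapping.lookup (\<zeta> x) w = Poly_Mapping.lookup (\<zeta> y) w"
      proof (cases "w \<in> R.Wset G")
        case True
        then obtain j S where j: "j \<in> J" "w = ((\<beta> j, r j), S)" using keyJ by blast
        have "F x j = F y j" using xy(3) by simp
        then show ?thesis using j by (simp add: F_def) (metis lookup_comp)
      next
        case False
        then show ?thesis using \<zeta>W[OF xy(1)] \<zeta>W[OF xy(2)] unfolding TW_iff by metis
      qed
    qed
    then have "\<beta> x = \<beta> y" using L\<zeta> xy by metis
    then show "x = y" using inj_onD[OF \<beta>(1)] xy by blast
  qed
  moreover have "carrier ?S \<subseteq> F ` carrier M"
  proof
    fix x :: "'a \<Rightarrow> nat set \<Rightarrow>\<^sub>0 'k ratfun" assume x: "x \<in> carrier ?S"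
    let ?F = "{j \<in> J. x j \<noteq> 0}"
    have xV: "x j \<in> Vspace (r j)" if "j \<in> J" for j using x that by auto
    have finF: "finite ?F" using x by simp
    \<comment> \<open>The components are assembled into one coordinate vector. Distinct
      \<open>j\<close> give distinct labels, so at each key at most one term of the sum is
      nonzero.\<close>
    define g :: "(('a \<Rightarrow>\<^sub>0 'k ratfun) \<times> nat) \<times> nat set \<Rightarrow> 'k ratfun"
      where "g w = (\<Sum>j\<in>?F. if fst w = (\<beta> j, r j) then Poly_Mapping.lookup (x j) (snd w) else 0)" for w
    have "{w. g w \<noteq> 0} \<subseteq> (\<Union>j\<in>?F. Pair (\<beta> j, r j) ` Poly_Mapping.keys (x j))"
    proof
      fix w assume "w \<in> {w. g w \<noteq> 0}"
      then obtain j where j: "j \<in> ?F" "(if fst w = (\<beta> j, r j) then Poly_Mapping.lookup (x j) (snd w) else 0) \<noteq> 0"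
        unfolding g_def using sum.not_neutral_contains_not_neutral by blast
      then have "w = ((\<beta> j, r j), snd w)" "snd w \<in> Poly_Mapping.keys (x j)"
        by (auto simp: in_keys_iff prod_eq_iff split: if_splits)
      then show "w \<in> (\<Union>j\<in>?F. Pair (\<beta> j, r j) ` Poly_Mapping.keys (x j))" using j(1) by blast
    qed
    moreover have "finite (\<Union>j\<in>?F. Pair (\<beta> j, r j) ` Poly_Mapping.keys (x j))" using finF by simp
    ultimately have "finite {w. g w \<noteq> 0}" by (rule finite_subset)
    then have lz: "Poly_Mapping.lookup (Abs_poly_mapping g) = g" by (rule lookup_Abs_poly_mapping)
    have gj: "g ((\<beta> j, r j), S) = Poly_Mapping.lookup (x j) S" if j: "j \<in> J" for j S
    proof -
      have "g ((\<beta> j, r j), S) = (\<Sum>k\<in>?F. if k = j then Poly_Mapping.lookup (x j) S else 0)"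
        unfolding g_def using inj\<beta> j by (intro sum.cong) auto
      also have "\<dots> = Poly_Mapping.lookup (x j) S" using finF j by auto
      finally show ?thesis .
    qed
    have zW: "Abs_poly_mapping g \<in> ?W"
      unfolding TW_iff lz
    proof (intro allI impI)
      fix w assume w: "w \<notin> R.Wset G"
      have "(if fst w = (\<beta> j, r j) then Poly_Mapping.lookup (x j) (snd w) else 0) = 0" if j: "j \<in> ?F" for j
      proof (cases "fst w = (\<beta> j, r j)")
        case True
        then have "w = ((\<beta> j, r j), snd w)" by (metis prod.collapse)
        then have "snd w \<notin> subsets_of_card (r j)"
          using w rJ[of j] j unfolding R.Wset_def subsets_of_card_def by auto
        then show ?thesis using xV[of j] j by (simp add: Vspace_iff)
      qed simp
      then show "g w = 0" unfolding g_def by (intro sum.neutral) blast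
    qed
    have "?L (Abs_poly_mapping g) \<in> ?D" by (rule R.lincomb_ptran_mem[OF G(1) D zW])
    then obtain m where m: "m \<in> carrier M" "?L (Abs_poly_mapping g) = \<beta> m" by blast
    have \<zeta>m: "\<zeta> m = Abs_poly_mapping g" by (rule \<zeta>I[OF m(1) zW m(2)])
    have "F m = x"
    proof
      fix j
      show "F m j = x j"
      proof (cases "j \<in> J")
        case True
        have "comp (\<beta> j, r j) (Abs_poly_mapping g) = x j"
          by (rule poly_mapping_eqI) (simp add: lz gj[OF True])
        then show ?thesis using True by (simp add: F_def \<zeta>m)
      next
        case False
        then show ?thesis using x by (auto simp: F_def PiE_iff extensional_def)
      qed
    qed
    then show "x \<in> F ` carrier M" using m(1) by blast
  qed
  moreover have "F ` carrier M \<subseteq> carrier ?S" using semilin_homD(1)[OF F] by blast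
  ultimately have "bij_betw F (carrier M) (carrier ?S)" by (auto simp: bij_betw_def)
  then have "semilin_iso M ?S" using F by (auto simp: semilin_iso_def)
  then show ?thesis unfolding standard_object_def using M.smooth_semilinear_axioms by blast
qed

text \<open>Fix an index \<open>k\<close> and split the sum into the \<open>k\<close>-th summand and
  all others. The former is nonzero, so indecomposability makes the latter zero and the
  \<open>k\<close>-th coordinate an isomorphism.\<close>

lemma indecomposable_standard:
  fixes M :: "('k::field ratfun, 'a) semilin"
  assumes "standard_object M" "indecomposable_object M"
  shows "\<exists>r. semilin_iso M (Iobj r)"
proof -
  interpret M: smooth_semilinear M using assms(1) by (simp add: standard_object_def)
  obtain J :: "'a set" and r F where F: "F \<in> semilin_hom M (semilin_sum J (\<lambda>j. Iobj (r j)))"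
    and bij: "bij_betw F (carrier M) (carrier (semilin_sum J (\<lambda>j. Iobj (r j) :: ('k ratfun, _) semilin)))"
    using assms(1) unfolding standard_object_def semilin_iso_def by blast
  let ?S = "semilin_sum J (\<lambda>j. Iobj (r j) :: ('k ratfun, _) semilin)"
  note hF = semilin_homD[OF F]
  have injF: "x = y" if "x \<in> carrier M" "y \<in> carrier M" "F x = F y" for x y
    using bij that by (auto simp: bij_betw_def inj_on_def)
  have surjF: "\<exists>m\<in>carrier M. F m = x" if "x \<in> carrier ?S" for x
  proof -
    have "F ` carrier M = carrier ?S" using bij by (simp only: bij_betw_def)
    then have "x \<in> F ` carrier M" using that by (simp only:)
    then show ?thesis by blast
  qed
  have map_zero: "Poly_Mapping.map (\<lambda>b. 0 * b) v = 0" for v :: "nat set \<Rightarrow>\<^sub>0 'k ratfun"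
    by (rule poly_mapping_eqI) (simp add: lookup_map_0)
  have F0: "F \<zero>\<^bsub>M\<^esub> = (\<lambda>j\<in>J. 0)"
  proof -
    have "F (0 \<odot>\<^bsub>M\<^esub> \<zero>\<^bsub>M\<^esub>) = 0 \<odot>\<^bsub>?S\<^esub> F \<zero>\<^bsub>M\<^esub>" by (rule hF(3)) (rule M.zero_closed)
    moreover have "0 \<odot>\<^bsub>M\<^esub> \<zero>\<^bsub>M\<^esub> = \<zero>\<^bsub>M\<^esub>" by (rule M.zero_smult) (rule M.zero_closed)
    moreover have "0 \<odot>\<^bsub>?S\<^esub> x = (\<lambda>j\<in>J. 0)" for x
      by (simp only: semilin_sum_simps Iobj_simps map_zero)
    ultimately show ?thesis by (simp only:)
  qed
  have ne: "carrier M \<noteq> {\<zero>\<^bsub>M\<^esub>}" using assms(2) by (simp add: indecomposable_object_def)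
  then obtain m where m: "m \<in> carrier M" "m \<noteq> \<zero>\<^bsub>M\<^esub>" using M.zero_closed by blast
  have "J \<noteq> {}"
  proof
    assume "J = {}"
    then have "F m = F \<zero>\<^bsub>M\<^esub>" using hF(1)[OF m(1)] hF(1)[OF M.zero_closed] by simp
    then show False using injF m by auto
  qed
  then obtain k where k: "k \<in> J" by blast
  have S_iff: "x \<in> carrier ?S \<longleftrightarrow> x \<in> extensional J \<and> (\<forall>j\<in>J. x j \<in> Vspace (r j)) \<and> finite {j \<in> J. x j \<noteq> 0}" for x
    by (auto simp: PiE_iff)
  have V0: "(0 :: nat set \<Rightarrow>\<^sub>0 'k ratfun) \<in> Vspace s" for s by (simp add: Vspace_iff)
  let ?A = "{m \<in> carrier M. \<forall>j\<in>J - {k}. F m j = 0}" and ?B = "{m \<in> carrier M. F m k = 0}"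
  define put where "put v = (\<lambda>j\<in>J. if j = k then v else (0 :: nat set \<Rightarrow>\<^sub>0 'k ratfun))" for v
  have put: "put v \<in> carrier ?S" if "v \<in> Vspace (r k)" for v
    unfolding S_iff
  proof (intro conjI ballI)
    show "put v \<in> extensional J" by (simp add: put_def)
    show "put v j \<in> Vspace (r j)" if "j \<in> J" for j using that \<open>v \<in> Vspace (r k)\<close> V0 by (simp add: put_def)
    show "finite {j \<in> J. put v j \<noteq> 0}"
      by (rule finite_subset[of _ "{k}"]) (auto simp: put_def)
  qed
  have map0: "Poly_Mapping.map f 0 = 0" if "f 0 = 0" for f :: "'k ratfun \<Rightarrow> 'k ratfun"
    by (rule poly_mapping_eqI) (simp add: lookup_map_0[of f, OF that] that)
  have vec0: "perm_vec \<sigma> 0 = (0 :: nat set \<Rightarrow>\<^sub>0 'k ratfun)" for \<sigma> by (rule poly_mapping_eqI) simp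
  have Fadd: "F (x \<oplus>\<^bsub>M\<^esub> y) j = F x j + F y j" if "x \<in> carrier M" "y \<in> carrier M" "j \<in> J" for x y j
    using hF(2)[OF that(1,2)] that(3) by simp
  have Fscale: "F (a \<odot>\<^bsub>M\<^esub> x) j = Poly_Mapping.map (\<lambda>b. a * b) (F x j)" if "x \<in> carrier M" "j \<in> J" for a x j
    using hF(3)[OF that(1), of a] that(2) by simp
  have Fact: "F (act M \<sigma> x) j = Poly_Mapping.map (perm_ratfun \<sigma>) (perm_vec \<sigma> (F x j))" if "x \<in> carrier M" "j \<in> J" for \<sigma> x j
    using hF(4)[OF that(1), of \<sigma>] that(2) by simp
  have sub: "subobject {m \<in> carrier M. \<forall>j\<in>I. F m j = 0} M" if "I \<subseteq> J" for I
    unfolding subobject_def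
  proof (rule conjI)
    let ?H = "{m \<in> carrier M. \<forall>j\<in>I. F m j = 0}"
    have *: "?H \<subseteq> carrier M" "\<zero>\<^bsub>M\<^esub> \<in> ?H" "\<And>x y. x \<in> ?H \<Longrightarrow> y \<in> ?H \<Longrightarrow> x \<oplus>\<^bsub>M\<^esub> y \<in> ?H"
      "\<And>a x. x \<in> ?H \<Longrightarrow> a \<odot>\<^bsub>M\<^esub> x \<in> ?H" "\<And>\<sigma> x. x \<in> ?H \<Longrightarrow> act M \<sigma> x \<in> ?H"
    proof -
      show "?H \<subseteq> carrier M" by blast
      show "\<zero>\<^bsub>M\<^esub> \<in> ?H" using that by (auto simp: F0)
      show "x \<oplus>\<^bsub>M\<^esub> y \<in> ?H" if "x \<in> ?H" "y \<in> ?H" for x y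
        using that \<open>I \<subseteq> J\<close> Fadd[of x y] by (simp add: subset_iff)
      show "a \<odot>\<^bsub>M\<^esub> x \<in> ?H" if "x \<in> ?H" for a x
        using that \<open>I \<subseteq> J\<close> Fscale[of x _ a] M.smult_closed[of a x] by (simp add: subset_iff map0)
      show "act M \<sigma> x \<in> ?H" if "x \<in> ?H" for \<sigma> x
        using that \<open>I \<subseteq> J\<close> Fact[of x _ \<sigma>] M.act_closed[of x \<sigma>] by (simp add: subset_iff map0 vec0)
    qed
    show "submodule ?H ratfun_ring M" by (rule M.subobjectI(1)[OF *])
    show "\<forall>\<sigma>. \<forall>v\<in>?H. act M \<sigma> v \<in> ?H" using *(5) by blast
  qed
  have A: "subobject ?A M" by (rule sub) blast
  have B: "subobject ?B M" using sub[of "{k}"] k by simp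
  have F_eq: "x = \<zero>\<^bsub>M\<^esub>" if "x \<in> carrier M" "\<And>j. j \<in> J \<Longrightarrow> F x j = 0" for x
  proof -
    have "F x = F \<zero>\<^bsub>M\<^esub>"
    proof (rule extensionalityI[of _ J])
      show "F x \<in> extensional J" using hF(1)[OF that(1)] unfolding S_iff by (elim conjE)
    qed (simp_all add: F0 that(2))
    then show ?thesis using injF that(1) by blast
  qed
  have AB: "?A \<inter> ?B = {\<zero>\<^bsub>M\<^esub>}"
  proof
    show "?A \<inter> ?B \<subseteq> {\<zero>\<^bsub>M\<^esub>}"
    proof
      fix x assume "x \<in> ?A \<inter> ?B"
      then show "x \<in> {\<zero>\<^bsub>M\<^esub>}" using F_eq[of x] by (metis (mono_tags, lifting) DiffI IntE mem_Collect_eq singletonD singletonI)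
    qed
    show "{\<zero>\<^bsub>M\<^esub>} \<subseteq> ?A \<inter> ?B" using k by (auto simp: F0)
  qed
  have Fk: "F m k \<in> Vspace (r k)" if "m \<in> carrier M" for m using hF(1)[OF that] k unfolding S_iff by blast
  have "?A <+>\<^bsub>M\<^esub> ?B = carrier M"
  proof
    show "?A <+>\<^bsub>M\<^esub> ?B \<subseteq> carrier M" by (auto simp: set_add_def')
    show "carrier M \<subseteq> ?A <+>\<^bsub>M\<^esub> ?B"
    proof
      fix m assume m: "m \<in> carrier M"
      obtain a where a: "a \<in> carrier M" "F a = put (F m k)" using surjF[OF put[OF Fk[OF m]]] by blast
      let ?x = "\<lambda>j\<in>J. if j = k then 0 else F m j"
      have "?x \<in> carrier ?S"
        unfolding S_iff
      proof (intro conjI ballI)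
        have Fm: "F m \<in> carrier ?S" by (rule hF(1)[OF m])
        show "?x j \<in> Vspace (r j)" if "j \<in> J" for j using Fm that V0 unfolding S_iff by simp
        have "finite {j \<in> J. F m j \<noteq> 0}" using Fm unfolding S_iff by blast
        then show "finite {j \<in> J. ?x j \<noteq> 0}" by (rule finite_subset[rotated]) auto
      qed simp
      then obtain b where b: "b \<in> carrier M" "F b = ?x" using surjF by blast
      have "F (a \<oplus>\<^bsub>M\<^esub> b) = F m"
      proof (rule extensionalityI[of _ J])
        show "F (a \<oplus>\<^bsub>M\<^esub> b) \<in> extensional J" "F m \<in> extensional J"
          using hF(1)[of "a \<oplus>\<^bsub>M\<^esub> b"] hF(1)[OF m] a(1) b(1) unfolding S_iff by auto
        show "F (a \<oplus>\<^bsub>M\<^esub> b) j = F m j" if "j \<in> J" for j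
          using Fadd[OF a(1) b(1) that] a(2) b(2) that by (simp add: put_def)
      qed
      then have "m = a \<oplus>\<^bsub>M\<^esub> b" using injF[of "a \<oplus>\<^bsub>M\<^esub> b" m] a(1) b(1) m by simp
      moreover have "a \<in> ?A" using a by (auto simp: put_def)
      moreover have "b \<in> ?B" using b k by auto
      ultimately show "m \<in> ?A <+>\<^bsub>M\<^esub> ?B" by (auto simp: set_add_def')
    qed
  qed
  moreover have "?A \<noteq> {\<zero>\<^bsub>M\<^esub>}"
  proof
    assume *: "?A = {\<zero>\<^bsub>M\<^esub>}"
    \<comment> \<open>A basis vector shows that \<open>Iobj (r k)\<close> is nonzero, also for
      \<open>r k = 0\<close>, where the empty set is the only basis index.\<close>
    let ?v = "Poly_Mapping.single {..<r k} (1 :: 'k ratfun)"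
    have v: "?v \<in> Vspace (r k)" by (rule single_in_Vspace) (simp add: subsets_of_card_def)
    obtain a where a: "a \<in> carrier M" "F a = put ?v" using surjF[OF put[OF v]] by blast
    then have "a \<in> ?A" by (auto simp: put_def)
    then have "put ?v = (\<lambda>j\<in>J. 0)" using * a F0 by auto
    then have "put ?v k = (\<lambda>j\<in>J. 0) k" by (rule fun_cong)
    then have "Poly_Mapping.lookup ?v {..<r k} = Poly_Mapping.lookup 0 {..<r k}" using k by (simp only: put_def restrict_apply' if_True refl)
    then show False by (simp only: lookup_single_eq lookup_zero one_neq_zero)
  qed
  ultimately have B0: "?B = {\<zero>\<^bsub>M\<^esub>}"
    using assms(2) A B AB unfolding indecomposable_object_def by blast
  let ?G = "\<lambda>m. F m k"
  have "?G \<in> semilin_hom M (Iobj (r k))"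
    using Fk Fadd Fscale Fact k by (intro semilin_homI) simp_all
  moreover have "bij_betw ?G (carrier M) (carrier (Iobj (r k) :: ('k ratfun, _) semilin))"
    unfolding bij_betw_def
  proof
    show "inj_on ?G (carrier M)"
    proof (rule inj_onI)
      fix x y assume xy: "x \<in> carrier M" "y \<in> carrier M" "F x k = F y k"
      have y': "(- 1) \<odot>\<^bsub>M\<^esub> y \<in> carrier M" using M.smult_closed[of "- 1" y] xy(2) by simp
      have "F (x \<oplus>\<^bsub>M\<^esub> (- 1) \<odot>\<^bsub>M\<^esub> y) k = 0"
        using xy(3) by (intro poly_mapping_eqI) (simp add: Fadd[OF xy(1) y' k] Fscale[OF xy(2) k] lookup_add lookup_map_0)
      then have "x \<oplus>\<^bsub>M\<^esub> (- 1) \<odot>\<^bsub>M\<^esub> y \<in> ?B" using xy(1) y' by simp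
      then have 0: "x \<oplus>\<^bsub>M\<^esub> (- 1) \<odot>\<^bsub>M\<^esub> y = \<zero>\<^bsub>M\<^esub>" using B0 by blast
      have "y \<oplus>\<^bsub>M\<^esub> (- 1) \<odot>\<^bsub>M\<^esub> y = \<zero>\<^bsub>M\<^esub>"
        using M.smult_l_distr[of 1 "- 1" y] M.smult_one[of y] xy(2) by (simp add: M.zero_smult)
      then show "x = y" using 0 xy(1,2) y' by (metis M.add.right_cancel)
    qed
    show "?G ` carrier M = carrier (Iobj (r k))"
    proof
      show "?G ` carrier M \<subseteq> carrier (Iobj (r k))" using Fk by auto
      show "carrier (Iobj (r k)) \<subseteq> ?G ` carrier M"
      proof
        fix v :: "nat set \<Rightarrow>\<^sub>0 'k ratfun" assume "v \<in> carrier (Iobj (r k))"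
        then obtain a where a: "a \<in> carrier M" "F a = put v" using surjF[OF put] by auto
        then have "v = F a k" using k by (simp add: put_def)
        then show "v \<in> ?G ` carrier M" using a(1) by blast
      qed
    qed
  qed
  ultimately show ?thesis unfolding semilin_iso_def by blast
qed

theorem corollary4p11:
  fixes M :: "('k::field ratfun, 'a) semilin"
  assumes "injective_object M"
  shows "standard_object M \<and>
    (indecomposable_object M \<longrightarrow> (\<exists>r. semilin_iso M (Iobj r)))"
  using injective_is_standard[OF assms] indecomposable_standard by blast

end
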